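(* Assume that the Riemannian metric $G$ on $\mathrm{Imm}(S^1,\mathbb{R}^2)$ satisfies $$\int_{S^1}|h|^2+|D_s^nh|^2\,ds\le A\,G_c(h,h)\qquad\text{for all } c\in\mathrm{Imm}(S^1,\mathbb{R}^2),\ h\in T_c\mathrm{Imm}(S^1,\mathbb{R}^2),$$ for some $n\ge 2$ and some $A>0$. For each $c_0\in\mathrm{Imm}(S^1,\mathbb{R}^2)$ and $N>0$ there exists a constant $C=C(c_0,N)$ such that for all $c_1,c_2\in\mathrm{Imm}(S^1,\mathbb{R}^2)$ with $\mathrm{dist}^G(c_0,c_i)<N$ ($i=1,2$) and all $0\le k\le n-2$ we have $$\Big\|(D_{c_1}^k\kappa_1)\sqrt{|c_1'|}-(D_{c_2}^k\kappa_2)\sqrt{|c_2'|}\Big\|_{L^2(d\theta)}\le C\,\mathrm{dist}^G(c_1,c_2),$$ $$\Big\|(D_{c_1}^{k+1}\log|c_1'|)\sqrt{|c_1'|}-(D_{c_2}^{k+1}\log|c_2'|)\sqrt{|c_2'|}\Big\|_{L^2(d\theta)}\le C\,\mathrm{dist}^G(c_1,c_2).$$ In particular the functions $$c\mapsto (D_s^k\kappa)\sqrt{|c'|}:(\mathrm{Imm}(S^1,\mathbb{R}^2),\mathrm{dist}^G)\to L^2(S^1,\mathbb{R}),$$ $$c\mapsto (D_s^{k+1}\log|c'|)\sqrt{|c'|}:(\mathrm{Imm}(S^1,\mathbb{R}^2),\mathrm{dist}^G)\to L^2(S^1,\mathbb{R})$$ are continuous, and Lipschitz continuous on every metric ball.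
   Context: $S^1=\mathbb{R}/2\pi\mathbb{Z}$ with parameter $\theta$; a prime denotes $\partial_\theta$. $\mathrm{Imm}(S^1,\mathbb{R}^2)=\{c\in C^\infty(S^1,\mathbb{R}^2): c'(\theta)\neq 0 \text{ for all }\theta\}$, with $T_c\mathrm{Imm}(S^1,\mathbb{R}^2)\cong C^\infty(S^1,\mathbb{R}^2)$; Riemannian metrics on it are smooth and possibly weak. For a curve $c$: $D_s=\frac{1}{|c'|}\partial_\theta$ (also written $D_c$ to emphasize the dependence on $c$), $ds=|c'|\,d\theta$, $v=c'/|c'|$, and the curvature is $\kappa=\langle D_sv,Jv\rangle$, where $J$ is rotation by $\pi/2$; $\kappa_i$ is the curvature of $c_i$. $\|u\|_{L^2(d\theta)}^2=\int_{S^1}|u|^2\,d\theta$, and $L^2(S^1,\mathbb{R})$ carries this norm. The geodesic distance is $\mathrm{dist}^G(c_1,c_2)=\inf_c\mathrm{Len}^G(c)$, the infimum over smooth paths $c:[0,1]\to\mathrm{Imm}(S^1,\mathbb{R}^2)$ from $c_1$ to $c_2$ of $\mathrm{Len}^G(c)=\int_0^1\sqrt{G_{c}(c_t,c_t)}\,dt$ (it is $+\infty$ if there is no such path). A metric ball is a set $\{c:\mathrm{dist}^G(c_0,c)<N\}$. *)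

theory Defs
  imports "HOL-Analysis.Analysis"
begin

text \<open>
  \<open>C_infinity S f\<close>: the map \<open>f\<close> is infinitely often differentiable on \<open>S\<close>.  Read coinductively, \<open>f\<close> has
  a derivative at every point of \<open>S\<close> and all its directional derivatives are again in the class.
  Derivatives are taken within \<open>S\<close>, so that on \<open>{0..1} \<times> UNIV\<close> they are one-sided in the first variable
  at the two boundary lines.  The notion is meant for sets, such as this strip or a whole space, on
  which the derivative within \<open>S\<close> is unique.
\<close>

coinductive C_infinity :: "'a::euclidean_space set \<Rightarrow> ('a \<Rightarrow> 'b::real_normed_vector) \<Rightarrow> bool"
  for S :: "'a set"
  where
    "\<lbrakk>\<And>x. x \<in> S \<Longrightarrow> (f has_derivative f' x) (at x within S);
      \<And>v. C_infinity S (\<lambda>x. f' x v)\<rbrakk> \<Longrightarrow> C_infinity S f"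

text \<open>
  Maps on \<open>\<real>/2\<pi>\<int>\<close> are maps on \<open>\<real>\<close> with period \<open>2\<pi>\<close>.
\<close>

definition periodic_2pi :: "(real \<Rightarrow> 'a) \<Rightarrow> bool" where
  "periodic_2pi f \<longleftrightarrow> (\<forall>\<theta>. f (\<theta> + 2 * pi) = f \<theta>)"

definition smooth_circle :: "(real \<Rightarrow> real^2) set" where
  "smooth_circle = {h. C_infinity UNIV h \<and> periodic_2pi h}"

definition dtheta :: "(real \<Rightarrow> 'a::real_normed_vector) \<Rightarrow> real \<Rightarrow> 'a" where
  "dtheta f \<theta> = vector_derivative f (at \<theta>)"

definition Imm :: "(real \<Rightarrow> real^2) set" where
  "Imm = {c \<in> smooth_circle. \<forall>\<theta>. dtheta c \<theta> \<noteq> 0}"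

definition speed :: "(real \<Rightarrow> real^2) \<Rightarrow> real \<Rightarrow> real" where
  "speed c \<theta> = norm (dtheta c \<theta>)"

definition arc_deriv :: "(real \<Rightarrow> real^2) \<Rightarrow> (real \<Rightarrow> 'a::real_normed_vector) \<Rightarrow> real \<Rightarrow> 'a" where
  "arc_deriv c f \<theta> = (1 / speed c \<theta>) *\<^sub>R dtheta f \<theta>"

definition unit_tangent :: "(real \<Rightarrow> real^2) \<Rightarrow> real \<Rightarrow> real^2" where
  "unit_tangent c \<theta> = (1 / speed c \<theta>) *\<^sub>R dtheta c \<theta>"

definition rot90 :: "real^2 \<Rightarrow> real^2" where
  "rot90 x = vector [- (x $ 2), x $ 1]"

definition curvature :: "(real \<Rightarrow> real^2) \<Rightarrow> real \<Rightarrow> real" where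
  "curvature c \<theta> = arc_deriv c (unit_tangent c) \<theta> \<bullet> rot90 (unit_tangent c \<theta>)"

definition arc_integral :: "(real \<Rightarrow> real^2) \<Rightarrow> (real \<Rightarrow> real) \<Rightarrow> real" where
  "arc_integral c f = integral {0..2 * pi} (\<lambda>\<theta>. f \<theta> * speed c \<theta>)"

text \<open>
  A smooth path \<open>T \<rightarrow> C\<^sup>\<infinity>(S\<^sup>1, \<real>\<^sup>2)\<close> is a family that is jointly smooth on \<open>T \<times> S\<^sup>1\<close>
  (exponential law for the Frechet space \<open>C\<^sup>\<infinity>(S\<^sup>1, \<real>\<^sup>2)\<close>).
\<close>

definition smooth_path :: "real set \<Rightarrow> (real \<Rightarrow> real \<Rightarrow> real^2) \<Rightarrow> bool" where
  "smooth_path T c \<longleftrightarrow>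
     C_infinity (T \<times> UNIV) (\<lambda>(t, \<theta>). c t \<theta>) \<and> (\<forall>t\<in>T. periodic_2pi (c t))"

text \<open>
  \<open>G c h k\<close> is the inner product of \<open>h\<close> and \<open>k\<close> in the tangent space at \<open>c\<close>, and only its values for
  \<open>c \<in> Imm\<close> and \<open>h, k \<in> smooth_circle\<close> matter.  The metric may be weak: nothing is required of the
  topology that \<open>G c\<close> induces.  Smoothness is that of convenient calculus: \<open>G\<close> maps smooth curves in
  \<open>Imm \<times> C\<^sup>\<infinity> \<times> C\<^sup>\<infinity>\<close> to smooth curves in \<open>\<real>\<close>, which on Frechet manifolds agrees with the other
  usual notions.
\<close>

definition riemannian_metric ::
  "((real \<Rightarrow> real^2) \<Rightarrow> (real \<Rightarrow> real^2) \<Rightarrow> (real \<Rightarrow> real^2) \<Rightarrow> real) \<Rightarrow> bool" where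
  "riemannian_metric G \<longleftrightarrow>
     (\<forall>c\<in>Imm. \<forall>h\<in>smooth_circle. \<forall>k\<in>smooth_circle. G c h k = G c k h) \<and>
     (\<forall>c\<in>Imm. \<forall>h\<in>smooth_circle. \<forall>k\<in>smooth_circle. \<forall>m\<in>smooth_circle. \<forall>a b.
        G c (\<lambda>\<theta>. a *\<^sub>R h \<theta> + b *\<^sub>R k \<theta>) m = a * G c h m + b * G c k m) \<and>
     (\<forall>c\<in>Imm. \<forall>h\<in>smooth_circle. h \<noteq> (\<lambda>\<theta>. 0) \<longrightarrow> G c h h > 0) \<and>
     (\<forall>c h k. smooth_path UNIV c \<and> (\<forall>t. c t \<in> Imm) \<and> smooth_path UNIV h \<and> smooth_path UNIV k \<longrightarrow>
        C_infinity UNIV (\<lambda>t. G (c t) (h t) (k t)))"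

definition path_velocity :: "(real \<Rightarrow> real \<Rightarrow> real^2) \<Rightarrow> real \<Rightarrow> real \<Rightarrow> real^2" where
  "path_velocity c t \<theta> = vector_derivative (\<lambda>s. c s \<theta>) (at t within {0..1})"

definition path_len ::
  "((real \<Rightarrow> real^2) \<Rightarrow> (real \<Rightarrow> real^2) \<Rightarrow> (real \<Rightarrow> real^2) \<Rightarrow> real) \<Rightarrow>
   (real \<Rightarrow> real \<Rightarrow> real^2) \<Rightarrow> ennreal" where
  "path_len G c =
     (\<integral>\<^sup>+t\<in>{0..1}. ennreal (sqrt (G (c t) (path_velocity c t) (path_velocity c t))) \<partial>lborel)"

definition Imm_paths :: "(real \<Rightarrow> real^2) \<Rightarrow> (real \<Rightarrow> real^2) \<Rightarrow> (real \<Rightarrow> real \<Rightarrow> real^2) set" where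
  "Imm_paths c1 c2 =
     {c. smooth_path {0..1} c \<and> (\<forall>t\<in>{0..1}. c t \<in> Imm) \<and> c 0 = c1 \<and> c 1 = c2}"

definition geodesic_dist ::
  "((real \<Rightarrow> real^2) \<Rightarrow> (real \<Rightarrow> real^2) \<Rightarrow> (real \<Rightarrow> real^2) \<Rightarrow> real) \<Rightarrow>
   (real \<Rightarrow> real^2) \<Rightarrow> (real \<Rightarrow> real^2) \<Rightarrow> ennreal" where
  "geodesic_dist G c1 c2 = (INF c\<in>Imm_paths c1 c2. path_len G c)"

definition metric_ball ::
  "((real \<Rightarrow> real^2) \<Rightarrow> (real \<Rightarrow> real^2) \<Rightarrow> (real \<Rightarrow> real^2) \<Rightarrow> real) \<Rightarrow>
   (real \<Rightarrow> real^2) \<Rightarrow> real \<Rightarrow> (real \<Rightarrow> real^2) set" where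
  "metric_ball G c0 N = {c \<in> Imm. geodesic_dist G c0 c < ennreal N}"

text \<open>
  Elements of \<open>L\<^sup>2(S\<^sup>1, \<real>)\<close> are represented by square-integrable functions, without passing to
  classes modulo null sets; \<open>L2_norm\<close> is thus a seminorm on them.
\<close>

definition L2_circle :: "(real \<Rightarrow> real) set" where
  "L2_circle = {u. periodic_2pi u \<and> u \<in> borel_measurable (lebesgue_on {0..2 * pi}) \<and>
     integrable (lebesgue_on {0..2 * pi}) (\<lambda>\<theta>. \<bar>u \<theta>\<bar>\<^sup>2)}"

definition L2_norm :: "(real \<Rightarrow> real) \<Rightarrow> real" where
  "L2_norm u = sqrt (integral\<^sup>L (lebesgue_on {0..2 * pi}) (\<lambda>\<theta>. \<bar>u \<theta>\<bar>\<^sup>2))"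

definition L2_dist :: "(real \<Rightarrow> real) \<Rightarrow> (real \<Rightarrow> real) \<Rightarrow> real" where
  "L2_dist u w = L2_norm (\<lambda>\<theta>. u \<theta> - w \<theta>)"

definition maps_to_L2_continuously ::
  "((real \<Rightarrow> real^2) \<Rightarrow> (real \<Rightarrow> real^2) \<Rightarrow> (real \<Rightarrow> real^2) \<Rightarrow> real) \<Rightarrow>
   ((real \<Rightarrow> real^2) \<Rightarrow> real \<Rightarrow> real) \<Rightarrow> bool" where
  "maps_to_L2_continuously G F \<longleftrightarrow>
     (\<forall>c\<in>Imm. F c \<in> L2_circle) \<and>
     (\<forall>c\<in>Imm. \<forall>\<epsilon>>0. \<exists>\<delta>>0. \<forall>c'\<in>Imm.
        geodesic_dist G c c' < ennreal \<delta> \<longrightarrow> L2_dist (F c) (F c') < \<epsilon>)"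

definition L2_lipschitz_on_set ::
  "((real \<Rightarrow> real^2) \<Rightarrow> (real \<Rightarrow> real^2) \<Rightarrow> (real \<Rightarrow> real^2) \<Rightarrow> real) \<Rightarrow>
   (real \<Rightarrow> real^2) set \<Rightarrow> ((real \<Rightarrow> real^2) \<Rightarrow> real \<Rightarrow> real) \<Rightarrow> bool" where
  "L2_lipschitz_on_set G B F \<longleftrightarrow>
     (\<exists>L\<ge>0. \<forall>c1\<in>B. \<forall>c2\<in>B.
        ennreal (L2_dist (F c1) (F c2)) \<le> ennreal L * geodesic_dist G c1 c2)"

definition curvature_map :: "nat \<Rightarrow> (real \<Rightarrow> real^2) \<Rightarrow> real \<Rightarrow> real" where
  "curvature_map k c \<theta> = (arc_deriv c ^^ k) (curvature c) \<theta> * sqrt (speed c \<theta>)"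

definition log_speed_map :: "nat \<Rightarrow> (real \<Rightarrow> real^2) \<Rightarrow> real \<Rightarrow> real" where
  "log_speed_map k c \<theta> =
     (arc_deriv c ^^ (k + 1)) (\<lambda>\<phi>. ln (speed c \<phi>)) \<theta> * sqrt (speed c \<theta>)"

end

theory Submission
  imports Defs
begin

text \<open>
  Let \<open>c\<close> be a path with velocity \<open>h\<close> and \<open>E\<^sup>2 = \<integral> |h|\<^sup>2 + |D\<^sub>s\<^sup>n h|\<^sup>2 ds\<close>, so that the integral of \<open>E\<close> is at
  most \<open>sqrt A\<close> times the length of the path.  The squared \<open>L\<^sup>2(ds)\<close> norms of \<open>D\<^sub>s\<^sup>i h\<close> form a convex sequence in \<open>i\<close>,
  hence they are at most \<open>E\<^sup>2\<close>, and for \<open>1 \<le> i < n\<close> the function \<open>D\<^sub>s\<^sup>i h\<close> has mean zero, hence is bounded by \<open>E\<close> times the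
  root of the length of the curve.  The latter and \<open>ln |c'|\<close> are therefore controlled along the path.  Writing
  \<open>\<partial>\<^sub>\<theta>\<^sup>j h\<close> as a combination of the \<open>D\<^sub>s\<^sup>i h\<close> with \<open>i \<le> j\<close>, whose coefficients are polynomials in lower derivatives of \<open>c\<close>
  except for that of \<open>D\<^sub>s h\<close>, which is affine in \<open>\<partial>\<^sub>\<theta>\<^sup>j c\<close>, Gronwall's inequality at each \<open>\<theta>\<close> bounds
  \<open>\<partial>\<^sub>\<theta>\<^sup>j c\<close> inductively: uniformly for \<open>j < n\<close>, and in \<open>L\<^sup>2(d\<theta>)\<close> for \<open>j = n\<close> by Minkowski's inequality.  The changes of these
  derivatives along the path are then linear in the length.  The functions of the theorem are polynomial in powers of \<open>|c'|\<close>
  and derivatives of \<open>c\<close>, and affine in those of order \<open>n\<close>, so they inherit the Lipschitz estimate.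
\<close>

section \<open>Smooth maps and paths\<close>

text \<open>The obstacle is the loss of pointwise control at order \<open>n\<close>: there only
  \<open>L^2\<close> bounds are available, and a product of two factors of order \<open>n\<close>
  would leave \<open>L^2\<close>. Hence affine dependence on the highest derivative is kept as a
  notion of its own next to polynomial dependence, and every estimate of order \<open>n\<close> has
  bounded coefficients. The range \<open>k \<le> n - 2\<close> has the same origin:
  \<open>D_s^k \<kappa>\<close> and \<open>D_s^(k+1) ln |c'|\<close> contain derivatives of
  \<open>c\<close> up to order \<open>k + 2\<close>. A circle threatens because the bounds on
  \<open>D_s^i h\<close> contain the length of the moving curve. It is avoided since the growth of
  the length is estimated by Cauchy-Schwarz alone, with no information on the speed. A lower bound
  on the speed, which makes all coefficients bounded, is then a consequence. A path between two
  curves of a ball may leave the ball, and the infimum over paths need not be attained. Therefore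
  all constants depend only on bounds for the start curve and on an upper bound for the integral of
  \<open>E\<close>.\<close>

lemma C_infinityE:
  assumes "C_infinity S f"
  obtains f' where "\<And>x. x \<in> S \<Longrightarrow> (f has_derivative f' x) (at x within S)"
    and "\<And>v. C_infinity S (\<lambda>x. f' x v)"
  using assms
proof (cases rule: C_infinity.cases)
  case (1 f')
  then show thesis using that by blast
qed

text \<open>A derivative within \<open>S\<close> sees only the values on \<open>S\<close>. This
  allows families such as \<open>dtheta (f t)\<close>, which are arbitrary for \<open>t\<close>
  outside the parameter set, to be compared with components of a total derivative.\<close>

lemma C_infinity_cong:
  assumes "C_infinity S f" "\<And>x. x \<in> S \<Longrightarrow> g x = f x"
  shows "C_infinity S g"
  using assms(1)
proof (rule C_infinityE)
  fix f' assume f': "\<And>x. x \<in> S \<Longrightarrow> (f has_derivative f' x) (at x within S)"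
    "\<And>v. C_infinity S (\<lambda>x. f' x v)"
  show ?thesis
    by (rule C_infinity.intros[of S g f'])
       (use f' assms(2) has_derivative_transform in \<open>blast+\<close>)
qed

lemma C_infinity_continuous_on: "C_infinity S f \<Longrightarrow> continuous_on S f"
  by (erule C_infinityE) (auto simp: continuous_on_eq_continuous_within intro: has_derivative_continuous)

lemma C_infinity_has_dtheta:
  assumes "C_infinity UNIV f"
  shows "(f has_vector_derivative dtheta f \<theta>) (at \<theta>)"
proof -
  have "f differentiable (at \<theta>)"
    using assms by (rule C_infinityE) (auto intro: differentiableI)
  then show ?thesis by (simp add: dtheta_def vector_derivative_works)
qed

lemma C_infinity_dtheta:
  assumes "C_infinity UNIV f"
  shows "C_infinity UNIV (dtheta f)"
  using assms
proof (rule C_infinityE)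
  fix f' assume f': "\<And>x. x \<in> UNIV \<Longrightarrow> (f has_derivative f' x) (at x within UNIV)"
    "\<And>v. C_infinity UNIV (\<lambda>x. f' x v)"
  have "f' x = (\<lambda>r. r *\<^sub>R dtheta f x)" for x
    using C_infinity_has_dtheta[OF assms, of x] f'(1)[of x]
    by (auto simp: has_vector_derivative_def intro: has_derivative_unique)
  with f'(2)[of 1] show ?thesis by simp
qed

lemma C_infinity_dtheta_funpow: "C_infinity UNIV f \<Longrightarrow> C_infinity UNIV ((dtheta ^^ i) f)"
  by (induction i) (auto intro: C_infinity_dtheta)

lemma has_dtheta_funpow:
  assumes "C_infinity UNIV f"
  shows "((dtheta ^^ i) f has_vector_derivative (dtheta ^^ Suc i) f \<theta>) (at \<theta>)"
  using C_infinity_has_dtheta[OF C_infinity_dtheta_funpow[OF assms]] by simp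

lemma dtheta_eqI: "(\<And>\<theta>. (f has_vector_derivative g \<theta>) (at \<theta>)) \<Longrightarrow> dtheta f = g"
  by (rule ext) (simp add: dtheta_def vector_derivative_at)

text \<open>Translation by the period shows that exactly the same vectors are derivatives at both
  points. The choice hidden in \<open>vector_derivative\<close> then yields the same value at both,
  for any periodic function.\<close>

lemma periodic_2pi_dtheta:
  assumes "periodic_2pi f" shows "periodic_2pi (dtheta f)"
proof -
  have "dtheta f (\<theta> + 2 * pi) = dtheta f \<theta>" for \<theta>
  proof -
    have "(f has_vector_derivative d) (at (\<theta> + 2 * pi)) \<longleftrightarrow> (f has_vector_derivative d) (at \<theta>)" for d
    proof -
      have "f \<circ> (\<lambda>x. x + 2 * pi) = f" using assms by (auto simp: periodic_2pi_def)
      moreover have "f \<circ> (\<lambda>x. x - 2 * pi) = f"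
        using assms unfolding periodic_2pi_def
        by (auto simp: fun_eq_iff) (metis diff_add_cancel)
      moreover have "((\<lambda>x. x + 2 * pi) has_vector_derivative 1) (at \<theta>)"
        "((\<lambda>x. x - 2 * pi) has_vector_derivative 1) (at (\<theta> + 2 * pi))"
        by (auto simp: has_real_derivative_iff_has_vector_derivative[symmetric] intro!: derivative_eq_intros)
      ultimately show ?thesis
        using vector_diff_chain_at[of "\<lambda>x. x + 2*pi" 1 \<theta> f d]
              vector_diff_chain_at[of "\<lambda>x. x - 2*pi" 1 "\<theta> + 2*pi" f d]
        by auto
    qed
    then show ?thesis by (simp add: dtheta_def vector_derivative_def)
  qed
  then show ?thesis by (simp add: periodic_2pi_def)
qed

lemma smooth_circle_dtheta: "f \<in> smooth_circle \<Longrightarrow> (dtheta ^^ i) f \<in> smooth_circle"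
  by (induction i) (auto simp: smooth_circle_def periodic_2pi_dtheta C_infinity_dtheta)

text \<open>Coinduction works because the derivative of a slice in direction \<open>v\<close> is the
  slice of the derivative in direction \<open>(0, v)\<close>, which is again in the class.\<close>

lemma C_infinity_slice:
  assumes "C_infinity (T \<times> UNIV) f" "t \<in> T"
  shows "C_infinity UNIV (\<lambda>\<theta>. f (t, \<theta>))"
  using assms(1)
proof (coinduction arbitrary: f rule: C_infinity.coinduct)
  case C_infinity
  then obtain f' where f': "\<And>x. x \<in> T \<times> UNIV \<Longrightarrow> (f has_derivative f' x) (at x within T \<times> UNIV)"
    "\<And>v. C_infinity (T \<times> UNIV) (\<lambda>x. f' x v)"
    using C_infinityE by blast
  have "((\<lambda>\<theta>. f (t, \<theta>)) has_derivative (\<lambda>v. f' (t, \<theta>) (0, v))) (at \<theta>)" for \<theta>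
  proof -
    have "((\<lambda>\<theta>. (t, \<theta>)) has_derivative (\<lambda>v. (0, v))) (at \<theta>)"
      by (auto intro!: derivative_eq_intros)
    moreover have "(f has_derivative f' (t, \<theta>)) (at (t, \<theta>) within range (\<lambda>\<theta>. (t, \<theta>)))"
      by (rule has_derivative_subset[OF f'(1)]) (use assms(2) in auto)
    ultimately show ?thesis
      using diff_chain_within[of "\<lambda>\<theta>. (t, \<theta>)" "\<lambda>v. (0,v)" \<theta> UNIV f "f' (t, \<theta>)"]
      by (simp add: o_def)
  qed
  then show ?case
    using f'(2) by (intro exI[of _ "\<lambda>\<theta>. f (t, \<theta>)"] exI[of _ "\<lambda>\<theta> v. f' (t, \<theta>) (0, v)"]) auto
qed

lemma C_infinity_dtheta_slice:
  assumes "C_infinity (T \<times> UNIV) (\<lambda>(t, \<theta>). f t \<theta>)"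
  shows "C_infinity (T \<times> UNIV) (\<lambda>(t, \<theta>). dtheta (f t) \<theta>)"
  using assms
proof (rule C_infinityE)
  fix f' assume f': "\<And>x. x \<in> T \<times> UNIV \<Longrightarrow> ((\<lambda>(t, \<theta>). f t \<theta>) has_derivative f' x) (at x within T \<times> UNIV)"
    "\<And>v. C_infinity (T \<times> UNIV) (\<lambda>x. f' x v)"
  have "dtheta (f t) \<theta> = f' (t, \<theta>) (0, 1)" if "t \<in> T" for t \<theta>
  proof -
    have "((\<lambda>\<theta>. (t, \<theta>)) has_vector_derivative (0, 1)) (at \<theta>)"
      by (auto intro!: derivative_eq_intros simp: has_vector_derivative_def)
    moreover have "((\<lambda>(t, \<theta>). f t \<theta>) has_derivative f' (t, \<theta>)) (at (t, \<theta>) within range (\<lambda>\<theta>. (t, \<theta>)))"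
      by (rule has_derivative_subset[OF f'(1)]) (use that in auto)
    ultimately have "((\<lambda>(t, \<theta>). f t \<theta>) \<circ> (\<lambda>\<theta>. (t, \<theta>)) has_vector_derivative f' (t, \<theta>) (0, 1)) (at \<theta>)"
      using vector_derivative_diff_chain_within[of "\<lambda>\<theta>. (t, \<theta>)" "(0, 1)" \<theta> UNIV "\<lambda>(t, \<theta>). f t \<theta>" "f' (t, \<theta>)"]
      by simp
    then show ?thesis by (simp add: o_def dtheta_def vector_derivative_at)
  qed
  then show ?thesis by (intro C_infinity_cong[OF f'(2)[of "(0, 1)"]]) auto
qed

lemma C_infinity_dtheta_funpow_slice:
  assumes "C_infinity (T \<times> UNIV) (\<lambda>(t, \<theta>). f t \<theta>)"
  shows "C_infinity (T \<times> UNIV) (\<lambda>(t, \<theta>). (dtheta ^^ i) (f t) \<theta>)"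
  by (induction i) (use assms C_infinity_dtheta_slice in auto)

text \<open>The velocity is the total derivative in direction \<open>(1, 0)\<close>, so it inherits
  joint smoothness on the strip, including the two boundary lines.\<close>

lemma smooth_path_velocity:
  assumes "smooth_path {0..1} c"
  shows "smooth_path {0..1} (path_velocity c)"
    and "\<And>t \<theta>. t \<in> {0..1} \<Longrightarrow>
      ((\<lambda>s. c s \<theta>) has_vector_derivative path_velocity c t \<theta>) (at t within {0..1})"
proof -
  let ?S = "{0..1::real} \<times> (UNIV :: real set)"
  have "C_infinity ?S (\<lambda>(t, \<theta>). c t \<theta>)" using assms by (simp add: smooth_path_def)
  then obtain f' where f': "\<And>x. x \<in> ?S \<Longrightarrow> ((\<lambda>(t, \<theta>). c t \<theta>) has_derivative f' x) (at x within ?S)"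
    "\<And>v. C_infinity ?S (\<lambda>x. f' x v)"
    using C_infinityE by blast
  have d: "((\<lambda>s. c s \<theta>) has_vector_derivative f' (t, \<theta>) (1, 0)) (at t within {0..1})" if "t \<in> {0..1}" for t \<theta>
  proof -
    have "((\<lambda>t. (t, \<theta>)) has_vector_derivative (1, 0)) (at t within {0..1})"
      by (auto intro!: derivative_eq_intros simp: has_vector_derivative_def)
    moreover have "((\<lambda>(t, \<theta>). c t \<theta>) has_derivative f' (t, \<theta>)) (at (t, \<theta>) within (\<lambda>t. (t, \<theta>)) ` {0..1})"
      by (rule has_derivative_subset[OF f'(1)]) (use that in auto)
    ultimately show ?thesis
      using vector_derivative_diff_chain_within[of "\<lambda>t. (t, \<theta>)" "(1, 0)" t "{0..1}" "\<lambda>(t, \<theta>). c t \<theta>" "f' (t, \<theta>)"]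
      by (simp add: o_def)
  qed
  have v: "path_velocity c t \<theta> = f' (t, \<theta>) (1, 0)" if "t \<in> {0..1}" for t \<theta>
    unfolding path_velocity_def
    using vector_derivative_within_cbox[of 0 1 t] d[OF that] that by auto
  show "((\<lambda>s. c s \<theta>) has_vector_derivative path_velocity c t \<theta>) (at t within {0..1})"
    if "t \<in> {0..1}" for t \<theta> using d[OF that] v[OF that] by simp
  \<comment> \<open>For \<open>s\<close> in \<open>{0..1}\<close> the values at
    \<open>\<theta>\<close> and \<open>\<theta> + 2 * pi\<close> agree, so both velocities are
    derivatives of one function within a nondegenerate interval, where derivatives are
    unique.\<close>
  have "periodic_2pi (path_velocity c t)" if "t \<in> {0..1}" for t
    unfolding periodic_2pi_def
  proof
    fix \<theta>
    have "((\<lambda>s. c s \<theta>) has_vector_derivative path_velocity c t (\<theta> + 2 * pi)) (at t within {0..1})"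
      by (rule has_vector_derivative_transform[OF that _ d[OF that, of "\<theta> + 2*pi", folded v[OF that]]])
         (use assms in \<open>auto simp: smooth_path_def periodic_2pi_def\<close>)
    then show "path_velocity c t (\<theta> + 2 * pi) = path_velocity c t \<theta>"
      unfolding v[OF that, of \<theta>] using d[OF that, of \<theta>] that
      by (metis cbox_interval atLeastAtMost_iff vector_derivative_unique_within_closed_interval zero_less_one)
  qed
  moreover have "C_infinity ?S (\<lambda>(t, \<theta>). path_velocity c t \<theta>)"
    by (rule C_infinity_cong[OF f'(2)[of "(1, 0)"]]) (auto simp: v)
  ultimately show "smooth_path {0..1} (path_velocity c)"
    by (simp add: smooth_path_def)
qed

lemma smooth_path_smooth_circle:
  "smooth_path T c \<Longrightarrow> t \<in> T \<Longrightarrow> c t \<in> smooth_circle"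
  using C_infinity_slice[of T "\<lambda>(t, \<theta>). c t \<theta>" t] by (simp add: smooth_path_def smooth_circle_def)

lemma smooth_path_continuous_on:
  "smooth_path T c \<Longrightarrow> continuous_on (T \<times> UNIV) (\<lambda>(t, \<theta>). (dtheta ^^ i) (c t) \<theta>)"
  unfolding smooth_path_def by (blast intro: C_infinity_continuous_on C_infinity_dtheta_funpow_slice)

section \<open>Polynomials in the jet of a curve\<close>

definition inv_sqrt_speed :: "(real \<Rightarrow> real^2) \<Rightarrow> real \<Rightarrow> real" where
  "inv_sqrt_speed c \<theta> = 1 / sqrt (speed c \<theta>)"

text \<open>
  Since \<open>|c'| = s\<^sup>2 |c'|\<^sup>2\<close> and \<open>|c'| powr (1/2) = s\<^sup>3 |c'|\<^sup>2\<close> for \<open>s = inv_sqrt_speed c\<close>, all quantities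
  of the theorem are polynomials in \<open>s\<close> and the components of the derivatives of \<open>c\<close>.
\<close>

inductive jet_poly :: "nat \<Rightarrow> ((real \<Rightarrow> real^2) \<Rightarrow> real \<Rightarrow> real) \<Rightarrow> bool" for m where
  jet_const: "jet_poly m (\<lambda>c \<theta>. a)"
| jet_comp: "1 \<le> i \<Longrightarrow> i \<le> m \<Longrightarrow> jet_poly m (\<lambda>c \<theta>. (dtheta ^^ i) c \<theta> $ e)"
| jet_speed: "1 \<le> m \<Longrightarrow> jet_poly m inv_sqrt_speed"
| jet_add: "jet_poly m f \<Longrightarrow> jet_poly m g \<Longrightarrow> jet_poly m (\<lambda>c \<theta>. f c \<theta> + g c \<theta>)"
| jet_mult: "jet_poly m f \<Longrightarrow> jet_poly m g \<Longrightarrow> jet_poly m (\<lambda>c \<theta>. f c \<theta> * g c \<theta>)"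

text \<open>Polynomial in the jet of order \<open>m\<close> and affine in the derivatives of order
  \<open>Suc m\<close>: a product must have a \<open>jet_poly\<close> factor, so two derivatives of
  top order never meet. This is the dependence that survives when the top derivative is merely in
  \<open>L^2\<close>.\<close>

inductive affine_jet :: "nat \<Rightarrow> ((real \<Rightarrow> real^2) \<Rightarrow> real \<Rightarrow> real) \<Rightarrow> bool" for m where
  affine_poly: "jet_poly m f \<Longrightarrow> affine_jet m f"
| affine_top: "affine_jet m (\<lambda>c \<theta>. (dtheta ^^ Suc m) c \<theta> $ e)"
| affine_add: "affine_jet m f \<Longrightarrow> affine_jet m g \<Longrightarrow> affine_jet m (\<lambda>c \<theta>. f c \<theta> + g c \<theta>)"
| affine_mult: "jet_poly m f \<Longrightarrow> affine_jet m g \<Longrightarrow> affine_jet m (\<lambda>c \<theta>. f c \<theta> * g c \<theta>)"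

lemma jet_poly_mono: "jet_poly m f \<Longrightarrow> m \<le> m' \<Longrightarrow> jet_poly m' f"
  by (induction rule: jet_poly.induct) (auto intro: jet_poly.intros)

lemma affine_jet_imp_jet_poly: "affine_jet m f \<Longrightarrow> jet_poly (Suc m) f"
proof (induction rule: affine_jet.induct)
  case (affine_poly f)
  then show ?case by (rule jet_poly_mono) simp
next
  case (affine_top e)
  show ?case by (rule jet_comp) auto
next
  case (affine_add f g)
  then show ?case by (intro jet_add)
next
  case (affine_mult f g)
  then show ?case by (intro jet_mult) (auto intro: jet_poly_mono)
qed

text \<open>If \<open>m < m'\<close>, the top order \<open>Suc m\<close> is at most
  \<open>m'\<close>, and the function is simply polynomial there.\<close>

lemma affine_jet_mono: "affine_jet m f \<Longrightarrow> m \<le> m' \<Longrightarrow> affine_jet m' f"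
  by (cases "m = m'") (auto intro!: affine_poly jet_poly_mono[OF affine_jet_imp_jet_poly, of m f m'])

lemma jet_power: "jet_poly m f \<Longrightarrow> jet_poly m (\<lambda>c \<theta>. f c \<theta> ^ k)"
  by (induction k) (auto intro: jet_poly.intros)

lemma jet_inner:
  assumes "1 \<le> i" "i \<le> m" "1 \<le> j" "j \<le> m"
  shows "jet_poly m (\<lambda>c \<theta>. (dtheta ^^ i) c \<theta> \<bullet> (dtheta ^^ j) c \<theta>)"
  using assms by (auto simp: inner_vec_def sum_2 intro!: jet_poly.intros)

lemma affine_inner_top:
  assumes "1 \<le> i" "i \<le> m"
  shows "affine_jet m (\<lambda>c \<theta>. (dtheta ^^ i) c \<theta> \<bullet> (dtheta ^^ Suc m) c \<theta>)"
  unfolding inner_vec_def sum_2 inner_real_def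
  by (intro affine_add affine_mult affine_top jet_comp assms)

lemma ImmD:
  assumes "c \<in> Imm"
  shows "C_infinity UNIV c" "periodic_2pi c" "0 < speed c \<theta>" "0 < inv_sqrt_speed c \<theta>"
    "speed c \<theta> = (dtheta c \<theta> \<bullet> dtheta c \<theta>) * (inv_sqrt_speed c \<theta>)^2"
    "inv_sqrt_speed c \<theta> ^ 2 = 1 / speed c \<theta>"
    "sqrt (speed c \<theta>) = (dtheta c \<theta> \<bullet> dtheta c \<theta>) * (inv_sqrt_speed c \<theta>)^3"
proof -
  show "C_infinity UNIV c" "periodic_2pi c" using assms by (auto simp: Imm_def smooth_circle_def)
  show p: "0 < speed c \<theta>" using assms by (auto simp: Imm_def speed_def)
  then show "0 < inv_sqrt_speed c \<theta>" "inv_sqrt_speed c \<theta> ^ 2 = 1 / speed c \<theta>"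
    by (auto simp: inv_sqrt_speed_def power_divide)
  then show "speed c \<theta> = (dtheta c \<theta> \<bullet> dtheta c \<theta>) * (inv_sqrt_speed c \<theta>)^2"
    using p by (simp add: speed_def dot_square_norm power2_eq_square)
  have "sqrt (speed c \<theta>) ^ 4 = ((sqrt (speed c \<theta>))\<^sup>2)\<^sup>2" by (simp flip: power_mult)
  then have "(dtheta c \<theta> \<bullet> dtheta c \<theta>) = sqrt (speed c \<theta>) ^ 4"
    using p by (simp add: dot_square_norm speed_def)
  then show "sqrt (speed c \<theta>) = (dtheta c \<theta> \<bullet> dtheta c \<theta>) * (inv_sqrt_speed c \<theta>)^3"
    using p by (simp add: inv_sqrt_speed_def field_simps eval_nat_numeral)
qed

lemma has_real_derivative_comp:
  assumes "c \<in> Imm"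
  shows "((\<lambda>\<theta>. (dtheta ^^ i) c \<theta> $ e) has_real_derivative (dtheta ^^ Suc i) c \<theta> $ e) (at \<theta>)"
  unfolding has_real_derivative_iff_has_vector_derivative
  by (rule bounded_linear.has_vector_derivative[OF bounded_linear_vec_nth has_dtheta_funpow])
     (use assms ImmD(1) in auto)

lemma has_real_derivative_speed:
  assumes "c \<in> Imm"
  shows "(speed c has_real_derivative (dtheta c \<theta> \<bullet> dtheta (dtheta c) \<theta>) / speed c \<theta>) (at \<theta>)"
proof -
  note p = ImmD(3)[OF assms, of \<theta>]
  have d: "(dtheta c has_derivative (\<lambda>r. r *\<^sub>R dtheta (dtheta c) \<theta>)) (at \<theta>)"
    using has_dtheta_funpow[OF ImmD(1)[OF assms], of 1 \<theta>] by (simp add: has_vector_derivative_def)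
  have "(speed c has_derivative (\<lambda>r. r *\<^sub>R dtheta (dtheta c) \<theta> \<bullet> sgn (dtheta c \<theta>))) (at \<theta>)"
    unfolding speed_def[abs_def]
    using has_derivative_compose[OF d has_derivative_norm[of "dtheta c \<theta>"]] p
    by (simp add: speed_def)
  then show ?thesis
    unfolding has_field_derivative_def
    by (rule back_subst[of "\<lambda>f. (speed c has_derivative f) (at \<theta>)"])
       (auto simp: sgn_div_norm speed_def fun_eq_iff inner_commute field_simps)
qed

text \<open>The derivative of \<open>|c'|^(-1/2)\<close> contains \<open>|c'|^(-5/2)\<close>, a
  fifth power of \<open>inv_sqrt_speed\<close>; this is why adjoining this one function gives an
  algebra that is closed under differentiation.\<close>

lemma has_real_derivative_inv_sqrt_speed:
  assumes "c \<in> Imm"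
  shows "(inv_sqrt_speed c has_real_derivative
    - (1/2) * inv_sqrt_speed c \<theta> ^ 5 * ((dtheta ^^ 1) c \<theta> \<bullet> (dtheta ^^ 2) c \<theta>)) (at \<theta>)"
proof -
  note p = ImmD(3)[OF assms, of \<theta>]
  show ?thesis
    unfolding inv_sqrt_speed_def[abs_def]
    by (rule DERIV_cong[OF DERIV_divide[OF DERIV_const
          DERIV_chain2[OF DERIV_real_sqrt[OF p] has_real_derivative_speed[OF assms]]]])
       (use p in \<open>auto simp: field_simps eval_nat_numeral\<close>)
qed

text \<open>The Leibniz rule raises the order of one factor at a time, so differentiation turns a
  polynomial of order \<open>m\<close> into a function that is affine in order
  \<open>Suc m\<close>.\<close>

lemma jet_poly_deriv:
  assumes "jet_poly m f" "1 \<le> m"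
  shows "\<exists>g. affine_jet m g \<and> (\<forall>c\<in>Imm. \<forall>\<theta>. (f c has_real_derivative g c \<theta>) (at \<theta>))"
  using assms(1)
proof (induction rule: jet_poly.induct)
  case (jet_const a)
  show ?case by (rule exI[of _ "\<lambda>c \<theta>. 0"]) (auto intro: affine_poly jet_poly.jet_const)
next
  case (jet_comp i e)
  have "affine_jet m (\<lambda>c \<theta>. (dtheta ^^ Suc i) c \<theta> $ e)"
  proof (cases "i = m")
    case True
    then show ?thesis using affine_top[of m e] by simp
  next
    case False
    then show ?thesis using jet_comp by (intro affine_poly jet_poly.jet_comp) auto
  qed
  then show ?case using has_real_derivative_comp by blast
next
  case jet_speed
  have "affine_jet m (\<lambda>c \<theta>. (- (1/2) * inv_sqrt_speed c \<theta> ^ 5) * ((dtheta ^^ 1) c \<theta> \<bullet> (dtheta ^^ 2) c \<theta>))"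
  proof (rule affine_mult)
    show "jet_poly m (\<lambda>c \<theta>. - (1/2) * inv_sqrt_speed c \<theta> ^ 5)"
      by (intro jet_mult jet_poly.jet_const jet_power jet_poly.jet_speed assms)
    show "affine_jet m (\<lambda>c \<theta>. (dtheta ^^ 1) c \<theta> \<bullet> (dtheta ^^ 2) c \<theta>)"
    proof (cases "m = 1")
      case True
      then show ?thesis using affine_inner_top[of 1 m] by (simp add: numeral_2_eq_2)
    next
      case False
      then show ?thesis using assms(2) by (intro affine_poly jet_inner) auto
    qed
  qed
  then show ?case using has_real_derivative_inv_sqrt_speed by blast
next
  case (jet_add f g)
  then obtain f' g' where "affine_jet m f'" "affine_jet m g'"
    "\<forall>c\<in>Imm. \<forall>\<theta>. (f c has_real_derivative f' c \<theta>) (at \<theta>)"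
    "\<forall>c\<in>Imm. \<forall>\<theta>. (g c has_real_derivative g' c \<theta>) (at \<theta>)" by blast
  then show ?case
    by (intro exI[of _ "\<lambda>c \<theta>. f' c \<theta> + g' c \<theta>"]) (auto intro!: affine_add derivative_eq_intros)
next
  case (jet_mult f g)
  then obtain f' g' where "affine_jet m f'" "affine_jet m g'"
    "\<forall>c\<in>Imm. \<forall>\<theta>. (f c has_real_derivative f' c \<theta>) (at \<theta>)"
    "\<forall>c\<in>Imm. \<forall>\<theta>. (g c has_real_derivative g' c \<theta>) (at \<theta>)" by blast
  with jet_mult show ?case
    by (intro exI[of _ "\<lambda>c \<theta>. g c \<theta> * f' c \<theta> + f c \<theta> * g' c \<theta>"])
       (auto intro!: affine_add affine_mult derivative_eq_intros)
qed

lemma jet_poly_continuous_on: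
  assumes "jet_poly m f" "smooth_path T c" "\<And>t. t \<in> T \<Longrightarrow> c t \<in> Imm"
  shows "continuous_on (T \<times> UNIV) (\<lambda>(t, \<theta>). f (c t) \<theta>)"
  using assms(1)
proof (induction rule: jet_poly.induct)
  case (jet_comp i e)
  show ?case
    using continuous_on_component[OF smooth_path_continuous_on[OF assms(2), of i], of e]
    by (simp add: case_prod_unfold)
next
  case jet_speed
  have "continuous_on (T \<times> UNIV) (\<lambda>x. dtheta (c (fst x)) (snd x))"
    using smooth_path_continuous_on[OF assms(2), of 1] by (simp add: case_prod_unfold)
  then show ?case
    unfolding inv_sqrt_speed_def speed_def case_prod_unfold
    using ImmD(3)[OF assms(3)]
    by (intro continuous_intros) (auto simp: speed_def Imm_def dest!: assms(3))
qed (auto simp: case_prod_unfold intro!: continuous_intros)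

lemma jet_poly_periodic:
  assumes "jet_poly m f" "c \<in> Imm"
  shows "periodic_2pi (f c)"
  using assms(1)
proof (induction rule: jet_poly.induct)
  case (jet_comp i e)
  then show ?case
    using smooth_circle_dtheta[of c i] assms(2)
    by (auto simp: periodic_2pi_def smooth_circle_def Imm_def)
next
  case jet_speed
  then show ?case
    using smooth_circle_dtheta[of c 1] assms(2)
    by (auto simp: periodic_2pi_def smooth_circle_def Imm_def inv_sqrt_speed_def speed_def)
qed (auto simp: periodic_2pi_def)

section \<open>Bounds and Lipschitz estimates for functions of the jet\<close>

text \<open>A compact set of jets at one point, kept away from the singularity
  \<open>c' = 0\<close>. Order \<open>0\<close> is left out, as no quantity under study depends on
  the position of the curve.\<close>

definition jet_bound :: "nat \<Rightarrow> real \<Rightarrow> (real \<Rightarrow> real^2) \<Rightarrow> real \<Rightarrow> bool" where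
  "jet_bound m K c \<theta> \<longleftrightarrow> 1 / K \<le> speed c \<theta> \<and> (\<forall>i\<in>{1..m}. norm ((dtheta ^^ i) c \<theta>) \<le> K)"

text \<open>With \<open>a\<close> and \<open>b\<close> the roots of the two speeds,
  \<open>1 / a - 1 / b = (b^2 - a^2) / (a * b * (a + b))\<close>. The numerator is a difference of
  speeds, and the three reciprocal factors are at most \<open>sqrt K\<close> each.\<close>

lemma inv_sqrt_speed_bounds:
  assumes "K > 0" "1 / K \<le> speed c \<theta>" "1 / K \<le> speed d \<theta>" "norm (dtheta c \<theta> - dtheta d \<theta>) \<le> \<delta>"
  shows "\<bar>inv_sqrt_speed c \<theta>\<bar> \<le> sqrt K" "\<bar>inv_sqrt_speed c \<theta> - inv_sqrt_speed d \<theta>\<bar> \<le> (sqrt K)^3 * \<delta>"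
proof -
  have sc: "1 / sqrt K \<le> sqrt (speed c \<theta>)" and sd: "1 / sqrt K \<le> sqrt (speed d \<theta>)"
    using real_sqrt_le_mono[OF assms(2)] real_sqrt_le_mono[OF assms(3)] by (auto simp: real_sqrt_divide)
  have k: "0 < sqrt K" using assms(1) by simp
  have pc: "0 < sqrt (speed c \<theta>)" and pd: "0 < sqrt (speed d \<theta>)"
    using less_le_trans[OF _ sc, of 0] less_le_trans[OF _ sd, of 0] k by simp_all
  have ic: "inv_sqrt_speed c \<theta> \<le> sqrt K" "0 < inv_sqrt_speed c \<theta>" 
   and id: "inv_sqrt_speed d \<theta> \<le> sqrt K" "0 < inv_sqrt_speed d \<theta>"
    using sc sd pc pd k by (auto simp: inv_sqrt_speed_def field_simps)
  show "\<bar>inv_sqrt_speed c \<theta>\<bar> \<le> sqrt K" using ic by simp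
  let ?a = "sqrt (speed c \<theta>)" and ?b = "sqrt (speed d \<theta>)"
  have eq: "inv_sqrt_speed c \<theta> - inv_sqrt_speed d \<theta> = (speed d \<theta> - speed c \<theta>) * (1 / ?a * (1/?b) * (1 / (?a + ?b)))"
  proof -
    have "1 / a - 1 / b = (b^2 - a^2) * (1 / a * (1 / b) * (1 / (a + b)))" if "0 < a" "0 < b" for a b :: real
      using that add_pos_pos[OF that] by (simp add: divide_simps) (simp add: algebra_simps power2_eq_square)
    from this[OF pc pd] show ?thesis using pc pd by (simp add: inv_sqrt_speed_def)
  qed
  have "1 / ?a \<le> sqrt K" "1 / ?b \<le> sqrt K" using ic id by (auto simp: inv_sqrt_speed_def)
  moreover have "1 / (?a + ?b) \<le> 1 / ?a"
    using pc pd by (intro divide_left_mono mult_pos_pos add_pos_pos) auto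
  ultimately have "1 / ?a * (1/?b) * (1 / (?a + ?b)) \<le> sqrt K * sqrt K * sqrt K"
    using pc pd k by (intro mult_mono) auto
  moreover have "\<bar>speed d \<theta> - speed c \<theta>\<bar> \<le> \<delta>"
    using norm_triangle_ineq3[of "dtheta d \<theta>" "dtheta c \<theta>"] assms(4)
    by (simp add: speed_def norm_minus_commute)
  ultimately have "\<bar>speed d \<theta> - speed c \<theta>\<bar> * (1 / ?a * (1/?b) * (1 / (?a + ?b))) \<le> \<delta> * (sqrt K * sqrt K * sqrt K)"
    by - (rule mult_mono, use pc pd in auto)
  then show "\<bar>inv_sqrt_speed c \<theta> - inv_sqrt_speed d \<theta>\<bar> \<le> (sqrt K)^3 * \<delta>"
    unfolding eq abs_mult using pc pd by (simp add: power3_eq_cube mult.commute)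
qed

lemma abs_mult_diff_le:
  fixes a b c d :: real
  assumes "\<bar>a\<bar> \<le> A" "\<bar>b\<bar> \<le> B" "\<bar>c - a\<bar> \<le> x" "\<bar>d - b\<bar> \<le> y" "\<bar>c\<bar> \<le> A"
  shows "\<bar>c * d - a * b\<bar> \<le> A * y + B * x"
proof -
  have "c * d - a * b = c * (d - b) + b * (c - a)" by (simp add: algebra_simps)
  also have "\<bar>\<dots>\<bar> \<le> \<bar>c\<bar> * \<bar>d - b\<bar> + \<bar>b\<bar> * \<bar>c - a\<bar>"
    by (metis abs_mult abs_triangle_ineq)
  also have "\<dots> \<le> A * y + B * x" using assms by (intro add_mono mult_mono) auto
  finally show ?thesis .
qed

text \<open>Boundedness and the Lipschitz estimate are proved in one induction, since the Lipschitz
  estimate of a product uses the bounds of both factors.\<close>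

lemma jet_poly_bounds:
  assumes "jet_poly m f" "K > 0"
  obtains C where "C \<ge> 0"
    "\<And>c \<theta>. jet_bound m K c \<theta> \<Longrightarrow> \<bar>f c \<theta>\<bar> \<le> C"
    "\<And>c d \<theta> \<delta>. jet_bound m K c \<theta> \<Longrightarrow> jet_bound m K d \<theta> \<Longrightarrow> 0 \<le> \<delta> \<Longrightarrow>
       (\<forall>i\<in>{1..m}. norm ((dtheta ^^ i) c \<theta> - (dtheta ^^ i) d \<theta>) \<le> \<delta>) \<Longrightarrow> \<bar>f c \<theta> - f d \<theta>\<bar> \<le> C * \<delta>"
proof -
  have "\<exists>C\<ge>0. (\<forall>c \<theta>. jet_bound m K c \<theta> \<longrightarrow> \<bar>f c \<theta>\<bar> \<le> C) \<and>
    (\<forall>c d \<theta> \<delta>. jet_bound m K c \<theta> \<and> jet_bound m K d \<theta> \<and> 0 \<le> \<delta> \<and>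
       (\<forall>i\<in>{1..m}. norm ((dtheta ^^ i) c \<theta> - (dtheta ^^ i) d \<theta>) \<le> \<delta>) \<longrightarrow> \<bar>f c \<theta> - f d \<theta>\<bar> \<le> C * \<delta>)"
    using assms(1)
  proof (induction rule: jet_poly.induct)
    case (jet_const a)
    show ?case by (rule exI[of _ "\<bar>a\<bar>"]) auto
  next
    case (jet_comp i e)
    have "\<bar>(dtheta ^^ i) c \<theta> $ e\<bar> \<le> 1 + K" if "jet_bound m K c \<theta>" for c \<theta>
      using component_le_norm_cart[of "(dtheta ^^ i) c \<theta>" e] that jet_comp
      by (auto simp: jet_bound_def dest!: bspec[of _ _ i])
    moreover have "\<bar>(dtheta ^^ i) c \<theta> $ e - (dtheta ^^ i) d \<theta> $ e\<bar> \<le> (1 + K) * \<delta>"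
      if "0 \<le> \<delta>" "\<forall>i\<in>{1..m}. norm ((dtheta ^^ i) c \<theta> - (dtheta ^^ i) d \<theta>) \<le> \<delta>" for c d \<theta> \<delta>
    proof -
      have "\<bar>(dtheta ^^ i) c \<theta> $ e - (dtheta ^^ i) d \<theta> $ e\<bar> \<le> \<delta>"
        using component_le_norm_cart[of "(dtheta ^^ i) c \<theta> - (dtheta ^^ i) d \<theta>" e] that jet_comp
        by (auto dest!: bspec[of _ _ i])
      also have "\<delta> \<le> (1 + K) * \<delta>" using that(1) assms(2) by (simp add: algebra_simps)
      finally show ?thesis .
    qed
    ultimately show ?case using assms(2) by (intro exI[of _ "1 + K"]) auto
  next
    case jet_speed
    have 1: "\<bar>inv_sqrt_speed c \<theta>\<bar> \<le> sqrt K + (sqrt K)^3" if "jet_bound m K c \<theta>" for c \<theta>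
      using inv_sqrt_speed_bounds(1)[of K c \<theta> c 0] that assms(2)
      by (simp add: jet_bound_def add_increasing2)
    have 2: "\<bar>inv_sqrt_speed c \<theta> - inv_sqrt_speed d \<theta>\<bar> \<le> (sqrt K + (sqrt K)^3) * \<delta>"
      if "jet_bound m K c \<theta>" "jet_bound m K d \<theta>" "0 \<le> \<delta>"
        "\<forall>i\<in>{1..m}. norm ((dtheta ^^ i) c \<theta> - (dtheta ^^ i) d \<theta>) \<le> \<delta>" for c d \<theta> \<delta>
    proof -
      have "norm (dtheta c \<theta> - dtheta d \<theta>) \<le> \<delta>" using that(4) jet_speed by (auto dest!: bspec[of _ _ 1])
      then have "\<bar>inv_sqrt_speed c \<theta> - inv_sqrt_speed d \<theta>\<bar> \<le> (sqrt K)^3 * \<delta>"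
        using inv_sqrt_speed_bounds(2)[of K c \<theta> d \<delta>] that assms(2) by (simp add: jet_bound_def)
      also have "\<dots> \<le> (sqrt K + (sqrt K)^3) * \<delta>" using that(3) assms(2) by (simp add: algebra_simps)
      finally show ?thesis .
    qed
    show ?case using 1 2 assms(2) by (intro exI[of _ "sqrt K + (sqrt K)^3"]) auto
  next
    case (jet_add f g)
    then obtain A B where AB: "A \<ge> 0" "B \<ge> 0" "\<forall>c \<theta>. jet_bound m K c \<theta> \<longrightarrow> \<bar>f c \<theta>\<bar> \<le> A"
      "\<forall>c \<theta>. jet_bound m K c \<theta> \<longrightarrow> \<bar>g c \<theta>\<bar> \<le> B"
      "\<forall>c d \<theta> \<delta>. jet_bound m K c \<theta> \<and> jet_bound m K d \<theta> \<and> 0 \<le> \<delta> \<and>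
       (\<forall>i\<in>{1..m}. norm ((dtheta ^^ i) c \<theta> - (dtheta ^^ i) d \<theta>) \<le> \<delta>) \<longrightarrow> \<bar>f c \<theta> - f d \<theta>\<bar> \<le> A * \<delta>"
      "\<forall>c d \<theta> \<delta>. jet_bound m K c \<theta> \<and> jet_bound m K d \<theta> \<and> 0 \<le> \<delta> \<and>
       (\<forall>i\<in>{1..m}. norm ((dtheta ^^ i) c \<theta> - (dtheta ^^ i) d \<theta>) \<le> \<delta>) \<longrightarrow> \<bar>g c \<theta> - g d \<theta>\<bar> \<le> B * \<delta>"
      by blast
    show ?case
    proof (intro exI[of _ "A + B"] conjI allI impI)
      fix c \<theta> assume "jet_bound m K c \<theta>"
      with AB(3,4) have "\<bar>f c \<theta>\<bar> \<le> A" "\<bar>g c \<theta>\<bar> \<le> B" by auto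
      then show "\<bar>f c \<theta> + g c \<theta>\<bar> \<le> A + B" by linarith
    next
      fix c d \<theta> \<delta> assume "jet_bound m K c \<theta> \<and> jet_bound m K d \<theta> \<and> 0 \<le> \<delta> \<and>
       (\<forall>i\<in>{1..m}. norm ((dtheta ^^ i) c \<theta> - (dtheta ^^ i) d \<theta>) \<le> \<delta>)"
      with AB(5,6) have "\<bar>f c \<theta> - f d \<theta>\<bar> \<le> A * \<delta>" "\<bar>g c \<theta> - g d \<theta>\<bar> \<le> B * \<delta>" by blast+
      then show "\<bar>f c \<theta> + g c \<theta> - (f d \<theta> + g d \<theta>)\<bar> \<le> (A + B) * \<delta>" unfolding distrib_right by linarith
    qed (use AB in auto)
  next
    case (jet_mult f g)
    then obtain A B where AB: "A \<ge> 0" "B \<ge> 0" "\<forall>c \<theta>. jet_bound m K c \<theta> \<longrightarrow> \<bar>f c \<theta>\<bar> \<le> A"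
      "\<forall>c \<theta>. jet_bound m K c \<theta> \<longrightarrow> \<bar>g c \<theta>\<bar> \<le> B"
      "\<forall>c d \<theta> \<delta>. jet_bound m K c \<theta> \<and> jet_bound m K d \<theta> \<and> 0 \<le> \<delta> \<and>
       (\<forall>i\<in>{1..m}. norm ((dtheta ^^ i) c \<theta> - (dtheta ^^ i) d \<theta>) \<le> \<delta>) \<longrightarrow> \<bar>f c \<theta> - f d \<theta>\<bar> \<le> A * \<delta>"
      "\<forall>c d \<theta> \<delta>. jet_bound m K c \<theta> \<and> jet_bound m K d \<theta> \<and> 0 \<le> \<delta> \<and>
       (\<forall>i\<in>{1..m}. norm ((dtheta ^^ i) c \<theta> - (dtheta ^^ i) d \<theta>) \<le> \<delta>) \<longrightarrow> \<bar>g c \<theta> - g d \<theta>\<bar> \<le> B * \<delta>"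
      by blast
    \<comment> \<open>\<open>A * B\<close> bounds the product, while a difference of products
      contributes \<open>A * B * \<delta>\<close> twice.\<close>
    show ?case
    proof (intro exI[of _ "2 * A * B"] conjI allI impI)
      fix c \<theta> assume "jet_bound m K c \<theta>"
      with AB(3,4) have "\<bar>f c \<theta>\<bar> \<le> A" "\<bar>g c \<theta>\<bar> \<le> B" by auto
      then have "\<bar>f c \<theta> * g c \<theta>\<bar> \<le> A * B" unfolding abs_mult using AB by (intro mult_mono) auto
      then show "\<bar>f c \<theta> * g c \<theta>\<bar> \<le> 2 * A * B" using mult_nonneg_nonneg[OF AB(1,2)] by linarith
    next
      fix c d \<theta> \<delta> assume *: "jet_bound m K c \<theta> \<and> jet_bound m K d \<theta> \<and> 0 \<le> \<delta> \<and>
       (\<forall>i\<in>{1..m}. norm ((dtheta ^^ i) c \<theta> - (dtheta ^^ i) d \<theta>) \<le> \<delta>)"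
      with AB(5,6) have "\<bar>f c \<theta> - f d \<theta>\<bar> \<le> A * \<delta>" "\<bar>g c \<theta> - g d \<theta>\<bar> \<le> B * \<delta>" by blast+
      with * AB(3,4) have "\<bar>f c \<theta> * g c \<theta> - f d \<theta> * g d \<theta>\<bar> \<le> A * (B * \<delta>) + B * (A * \<delta>)"
        by (intro abs_mult_diff_le) auto
      then show "\<bar>f c \<theta> * g c \<theta> - f d \<theta> * g d \<theta>\<bar> \<le> 2 * A * B * \<delta>" by (simp add: algebra_simps)
    qed (use AB in auto)
  qed
  then show ?thesis using that by blast
qed

text \<open>The asymmetry is deliberate: the top derivative of \<open>d\<close> alone is multiplied
  by \<open>\<delta>\<close>, and that of \<open>c\<close> enters only through the difference. With
  \<open>d\<close> the start of a path and \<open>c\<close> its end, this asks for an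
  \<open>L^2\<close> bound on the top derivative of the start curve only.\<close>

lemma affine_jet_bounds:
  assumes "affine_jet m f" "K > 0"
  obtains C where "C \<ge> 0"
    "\<And>c \<theta>. jet_bound m K c \<theta> \<Longrightarrow> \<bar>f c \<theta>\<bar> \<le> C * (1 + norm ((dtheta ^^ Suc m) c \<theta>))"
    "\<And>c d \<theta> \<delta>. jet_bound m K c \<theta> \<Longrightarrow> jet_bound m K d \<theta> \<Longrightarrow> 0 \<le> \<delta> \<Longrightarrow>
       (\<forall>i\<in>{1..m}. norm ((dtheta ^^ i) c \<theta> - (dtheta ^^ i) d \<theta>) \<le> \<delta>) \<Longrightarrow>
       \<bar>f c \<theta> - f d \<theta>\<bar> \<le> C * (\<delta> * (1 + norm ((dtheta ^^ Suc m) d \<theta>)) +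
         norm ((dtheta ^^ Suc m) c \<theta> - (dtheta ^^ Suc m) d \<theta>))"
proof -
  let ?top = "\<lambda>c \<theta>. norm ((dtheta ^^ Suc m) c \<theta>)"
  let ?dtop = "\<lambda>c d \<theta>. norm ((dtheta ^^ Suc m) c \<theta> - (dtheta ^^ Suc m) d \<theta>)"
  let ?close = "\<lambda>c d \<theta> \<delta>. jet_bound m K c \<theta> \<and> jet_bound m K d \<theta> \<and> 0 \<le> \<delta> \<and>
       (\<forall>i\<in>{1..m}. norm ((dtheta ^^ i) c \<theta> - (dtheta ^^ i) d \<theta>) \<le> \<delta>)"
  have "\<exists>C\<ge>0. (\<forall>c \<theta>. jet_bound m K c \<theta> \<longrightarrow> \<bar>f c \<theta>\<bar> \<le> C * (1 + ?top c \<theta>)) \<and>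
    (\<forall>c d \<theta> \<delta>. ?close c d \<theta> \<delta> \<longrightarrow> \<bar>f c \<theta> - f d \<theta>\<bar> \<le> C * (\<delta> * (1 + ?top d \<theta>) + ?dtop c d \<theta>))"
    using assms(1)
  proof (induction rule: affine_jet.induct)
    case (affine_poly f)
    obtain C where C: "C \<ge> 0" "\<And>c \<theta>. jet_bound m K c \<theta> \<Longrightarrow> \<bar>f c \<theta>\<bar> \<le> C"
      "\<And>c d \<theta> \<delta>. ?close c d \<theta> \<delta> \<Longrightarrow> \<bar>f c \<theta> - f d \<theta>\<bar> \<le> C * \<delta>"
      by (rule jet_poly_bounds[OF affine_poly assms(2)]) blast
    show ?case
    proof (intro exI[of _ C] conjI allI impI)
      fix c \<theta> assume "jet_bound m K c \<theta>"
      from C(2)[OF this] show "\<bar>f c \<theta>\<bar> \<le> C * (1 + ?top c \<theta>)"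
        using mult_nonneg_nonneg[OF C(1) norm_ge_zero, of "(dtheta ^^ Suc m) c \<theta>"]
        unfolding distrib_left by linarith
    next
      fix c d \<theta> \<delta> assume *: "?close c d \<theta> \<delta>"
      have "C * \<delta> \<le> C * (\<delta> * (1 + ?top d \<theta>) + ?dtop c d \<theta>)"
        using * C(1) by (intro mult_left_mono) (auto simp del: funpow.simps simp: distrib_left)
      with C(3)[OF *] show "\<bar>f c \<theta> - f d \<theta>\<bar> \<le> C * (\<delta> * (1 + ?top d \<theta>) + ?dtop c d \<theta>)" by linarith
    qed (rule C)
  next
    case (affine_top e)
    show ?case
    proof (intro exI[of _ 1] conjI allI impI)
      fix c :: "real \<Rightarrow> real^2" and \<theta>
      show "\<bar>(dtheta ^^ Suc m) c \<theta> $ e\<bar> \<le> 1 * (1 + ?top c \<theta>)"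
        using component_le_norm_cart[of "(dtheta ^^ Suc m) c \<theta>" e] by (simp del: funpow.simps)
    next
      fix c d \<theta> \<delta> assume *: "?close c d \<theta> \<delta>"
      have "0 \<le> \<delta> * (1 + ?top d \<theta>)" using * by (simp del: funpow.simps)
      then show "\<bar>(dtheta ^^ Suc m) c \<theta> $ e - (dtheta ^^ Suc m) d \<theta> $ e\<bar> \<le> 1 * (\<delta> * (1 + ?top d \<theta>) + ?dtop c d \<theta>)"
        using component_le_norm_cart[of "(dtheta ^^ Suc m) c \<theta> - (dtheta ^^ Suc m) d \<theta>" e]
        by (simp del: funpow.simps)
    qed simp
  next
    case (affine_add f g)
    then obtain A B where AB: "A \<ge> 0" "B \<ge> 0"
      "\<forall>c \<theta>. jet_bound m K c \<theta> \<longrightarrow> \<bar>f c \<theta>\<bar> \<le> A * (1 + ?top c \<theta>)"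
      "\<forall>c \<theta>. jet_bound m K c \<theta> \<longrightarrow> \<bar>g c \<theta>\<bar> \<le> B * (1 + ?top c \<theta>)"
      "\<forall>c d \<theta> \<delta>. ?close c d \<theta> \<delta> \<longrightarrow> \<bar>f c \<theta> - f d \<theta>\<bar> \<le> A * (\<delta> * (1 + ?top d \<theta>) + ?dtop c d \<theta>)"
      "\<forall>c d \<theta> \<delta>. ?close c d \<theta> \<delta> \<longrightarrow> \<bar>g c \<theta> - g d \<theta>\<bar> \<le> B * (\<delta> * (1 + ?top d \<theta>) + ?dtop c d \<theta>)"
      by blast
    show ?case
    proof (intro exI[of _ "A + B"] conjI allI impI)
      fix c \<theta> assume "jet_bound m K c \<theta>"
      with AB(3,4) have "\<bar>f c \<theta>\<bar> \<le> A * (1 + ?top c \<theta>)" "\<bar>g c \<theta>\<bar> \<le> B * (1 + ?top c \<theta>)" by blast+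
      then show "\<bar>f c \<theta> + g c \<theta>\<bar> \<le> (A + B) * (1 + ?top c \<theta>)"
        unfolding distrib_right[of A B] by linarith
    next
      fix c d \<theta> \<delta> assume "?close c d \<theta> \<delta>"
      with AB(5,6) have "\<bar>f c \<theta> - f d \<theta>\<bar> \<le> A * (\<delta> * (1 + ?top d \<theta>) + ?dtop c d \<theta>)"
        "\<bar>g c \<theta> - g d \<theta>\<bar> \<le> B * (\<delta> * (1 + ?top d \<theta>) + ?dtop c d \<theta>)" by blast+
      then show "\<bar>f c \<theta> + g c \<theta> - (f d \<theta> + g d \<theta>)\<bar> \<le> (A + B) * (\<delta> * (1 + ?top d \<theta>) + ?dtop c d \<theta>)"
        unfolding distrib_right[of A B] by linarith
    qed (use AB in auto)
  next
    case (affine_mult f g)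
    obtain A where A: "A \<ge> 0" "\<And>c \<theta>. jet_bound m K c \<theta> \<Longrightarrow> \<bar>f c \<theta>\<bar> \<le> A"
      "\<And>c d \<theta> \<delta>. ?close c d \<theta> \<delta> \<Longrightarrow> \<bar>f c \<theta> - f d \<theta>\<bar> \<le> A * \<delta>"
      by (rule jet_poly_bounds[OF affine_mult(1) assms(2)]) blast
    from affine_mult obtain B where B: "B \<ge> 0"
      "\<forall>c \<theta>. jet_bound m K c \<theta> \<longrightarrow> \<bar>g c \<theta>\<bar> \<le> B * (1 + ?top c \<theta>)"
      "\<forall>c d \<theta> \<delta>. ?close c d \<theta> \<delta> \<longrightarrow> \<bar>g c \<theta> - g d \<theta>\<bar> \<le> B * (\<delta> * (1 + ?top d \<theta>) + ?dtop c d \<theta>)"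
      by blast
    show ?case
    proof (intro exI[of _ "2 * A * B"] conjI allI impI)
      fix c \<theta> assume "jet_bound m K c \<theta>"
      with A(2) B(2) have "\<bar>f c \<theta>\<bar> \<le> A" "\<bar>g c \<theta>\<bar> \<le> B * (1 + ?top c \<theta>)" by blast+
      then have "\<bar>f c \<theta> * g c \<theta>\<bar> \<le> A * (B * (1 + ?top c \<theta>))" unfolding abs_mult using A by (intro mult_mono) auto
      also have "\<dots> \<le> 2 * A * B * (1 + ?top c \<theta>)" using A(1) B(1) by (simp add: algebra_simps del: funpow.simps)
      finally show "\<bar>f c \<theta> * g c \<theta>\<bar> \<le> 2 * A * B * (1 + ?top c \<theta>)" .
    next
      fix c d \<theta> \<delta> assume *: "?close c d \<theta> \<delta>"
      \<comment> \<open>The product difference is split so that the increment of \<open>f\<close>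
        multiplies \<open>g\<close> at \<open>d\<close>, never \<open>g\<close> at
        \<open>c\<close>.\<close>
      let ?R = "\<delta> * (1 + ?top d \<theta>) + ?dtop c d \<theta>"
      have "\<bar>f c \<theta> * g c \<theta> - f d \<theta> * g d \<theta>\<bar> \<le> A * (B * ?R) + (B * (1 + ?top d \<theta>)) * (A * \<delta>)"
        using * A B by (intro abs_mult_diff_le) blast+
      also have "\<dots> = A * B * ?R + A * B * (\<delta> * (1 + ?top d \<theta>))" by (simp add: algebra_simps del: funpow.simps)
      also have "\<dots> \<le> A * B * ?R + A * B * ?R"
        using A(1) B(1) by (intro add_left_mono mult_left_mono) (auto simp del: funpow.simps)
      finally show "\<bar>f c \<theta> * g c \<theta> - f d \<theta> * g d \<theta>\<bar> \<le> 2 * A * B * ?R" by (simp add: algebra_simps del: funpow.simps)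
    qed (use A B in auto)
  qed
  then show ?thesis using that by blast
qed

section \<open>Curvature and logarithmic speed as affine functions of the jet\<close>

lemma jet_inv_speed_mult:
  assumes "affine_jet m f" "1 \<le> m"
  shows "affine_jet m (\<lambda>c \<theta>. inv_sqrt_speed c \<theta> ^ k * f c \<theta>)"
  by (intro affine_mult jet_power jet_speed assms)

text \<open>On immersions the exponent \<open>2\<close> gives the speed and the exponent
  \<open>3\<close> its square root.\<close>

lemma jet_poly_speed: "1 \<le> m \<Longrightarrow> jet_poly m (\<lambda>c \<theta>. (dtheta c \<theta> \<bullet> dtheta c \<theta>) * inv_sqrt_speed c \<theta> ^ k)"
  using jet_mult[OF jet_inner[of 1 m 1] jet_power[OF jet_speed, of m k]] by simp

lemma arc_deriv_affine_jet:
  assumes "jet_poly m f" "1 \<le> m"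
  shows "\<exists>g. affine_jet m g \<and> (\<forall>c\<in>Imm. arc_deriv c (f c) = g c)"
proof -
  obtain g where g: "affine_jet m g" "\<And>c \<theta>. c \<in> Imm \<Longrightarrow> (f c has_real_derivative g c \<theta>) (at \<theta>)"
    using jet_poly_deriv[OF assms] by blast
  have "arc_deriv c (f c) \<theta> = inv_sqrt_speed c \<theta> ^ 2 * g c \<theta>" if "c \<in> Imm" for c \<theta>
    using dtheta_eqI[OF g(2)[OF that, unfolded has_real_derivative_iff_has_vector_derivative]]
    by (simp add: arc_deriv_def ImmD(6)[OF that])
  then show ?thesis using jet_inv_speed_mult[OF g(1) assms(2), of 2] by blast
qed

text \<open>Both quantities of the theorem start as functions affine in \<open>c''\<close>, and each
  arc length derivative raises the order by one. After \<open>k\<close> steps the top order is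
  \<open>k + 2\<close>, which is \<open>affine_jet (Suc k)\<close>.\<close>

lemma arc_deriv_funpow_affine_jet:
  assumes "affine_jet 1 q" "\<And>c. c \<in> Imm \<Longrightarrow> f c = q c"
  shows "\<exists>g. affine_jet (Suc k) g \<and> (\<forall>c\<in>Imm. (arc_deriv c ^^ k) (f c) = g c)"
proof (induction k)
  case 0
  then show ?case using assms by auto
next
  case (Suc k)
  then obtain g where g: "affine_jet (Suc k) g" "\<And>c. c \<in> Imm \<Longrightarrow> (arc_deriv c ^^ k) (f c) = g c" by blast
  then show ?case
    using arc_deriv_affine_jet[OF affine_jet_imp_jet_poly[OF g(1)]] by fastforce
qed

text \<open>The tangential coefficient is left unspecified because the curvature pairs this vector
  with the rotated tangent, which annihilates multiples of \<open>c'\<close>.\<close>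

lemma dtheta_unit_tangent:
  assumes "c \<in> Imm"
  shows "\<exists>a. dtheta (unit_tangent c) \<theta> = inv_sqrt_speed c \<theta> ^ 2 *\<^sub>R dtheta (dtheta c) \<theta> + a *\<^sub>R dtheta c \<theta>"
proof -
  have 1: "unit_tangent c = (\<lambda>\<theta>. inv_sqrt_speed c \<theta> ^ 2 *\<^sub>R dtheta c \<theta>)"
    by (rule ext) (simp add: unit_tangent_def ImmD(6)[OF assms])
  have "((\<lambda>\<theta>. inv_sqrt_speed c \<theta> ^ 2 *\<^sub>R dtheta c \<theta>) has_vector_derivative
      inv_sqrt_speed c \<theta> ^ 2 *\<^sub>R dtheta (dtheta c) \<theta> +
      (2 * inv_sqrt_speed c \<theta> * (- (1/2) * inv_sqrt_speed c \<theta> ^ 5 * ((dtheta ^^ 1) c \<theta> \<bullet> (dtheta ^^ 2) c \<theta>))) *\<^sub>R dtheta c \<theta>)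
      (at \<theta>)" for \<theta>
    by (rule has_vector_derivative_scaleR)
       (use has_dtheta_funpow[OF ImmD(1)[OF assms], of 1 \<theta>]
          DERIV_power[OF has_real_derivative_inv_sqrt_speed[OF assms, of \<theta>], of 2] in \<open>auto simp: algebra_simps\<close>)
  from fun_cong[OF dtheta_eqI[OF this], of \<theta>] show ?thesis unfolding 1 by blast
qed

text \<open>This is the classical \<open>det (c', c'') / |c'|^3\<close>, as
  \<open>inv_sqrt_speed ^ 6\<close> is \<open>|c'|^(-3)\<close>. The coefficient \<open>- 1\<close>
  and the exponent \<open>Suc 1\<close> are written out so that the closure rules of
  \<open>affine_jet\<close> match the formula.\<close>

lemma curvature_jet:
  assumes "c \<in> Imm"
  shows "curvature c \<theta> = inv_sqrt_speed c \<theta> ^ 6 *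
    ((dtheta ^^ 1) c \<theta> $ 1 * (dtheta ^^ Suc 1) c \<theta> $ 2 + (- 1) * (dtheta ^^ 1) c \<theta> $ 2 * (dtheta ^^ Suc 1) c \<theta> $ 1)"
proof -
  obtain a where a: "dtheta (unit_tangent c) \<theta> = inv_sqrt_speed c \<theta> ^ 2 *\<^sub>R dtheta (dtheta c) \<theta> + a *\<^sub>R dtheta c \<theta>"
    using dtheta_unit_tangent[OF assms] by blast
  have u: "unit_tangent c \<theta> = inv_sqrt_speed c \<theta> ^ 2 *\<^sub>R dtheta c \<theta>"
    by (simp add: unit_tangent_def ImmD(6)[OF assms])
  have rot: "rot90 (r *\<^sub>R x) = r *\<^sub>R rot90 x" "y \<bullet> rot90 x = x $ 1 * y $ 2 - x $ 2 * y $ 1" for r x y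
    by (auto simp: rot90_def vec_eq_iff forall_2 inner_vec_def sum_2)
  show ?thesis
    unfolding curvature_def arc_deriv_def a u ImmD(6)[OF assms, symmetric] rot
    by (simp add: inner_add_left rot) (simp add: algebra_simps eval_nat_numeral)
qed

text \<open>The order \<open>Suc m\<close> does not depend on \<open>k\<close>, so that all
  \<open>k \<le> m\<close> can be treated with the same top derivative; the weight
  \<open>sqrt (speed c \<theta>)\<close> is a polynomial factor of order \<open>1\<close>.\<close>

lemma curvature_map_jet:
  assumes "k \<le> m"
  shows "\<exists>F. affine_jet (Suc m) F \<and> (\<forall>c\<in>Imm. curvature_map k c = F c)"
proof -
  have "affine_jet 1 (\<lambda>c \<theta>. inv_sqrt_speed c \<theta> ^ 6 *
    ((dtheta ^^ 1) c \<theta> $ 1 * (dtheta ^^ Suc 1) c \<theta> $ 2 + (- 1) * (dtheta ^^ 1) c \<theta> $ 2 * (dtheta ^^ Suc 1) c \<theta> $ 1))"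
    by (intro jet_inv_speed_mult affine_add affine_mult jet_mult jet_const jet_comp affine_top) auto
  from arc_deriv_funpow_affine_jet[OF this, of curvature k] curvature_jet
  obtain g where g: "affine_jet (Suc k) g" "\<And>c. c \<in> Imm \<Longrightarrow> (arc_deriv c ^^ k) (curvature c) = g c" by blast
  have "affine_jet (Suc m) (\<lambda>c \<theta>. (dtheta c \<theta> \<bullet> dtheta c \<theta>) * inv_sqrt_speed c \<theta> ^ 3 * g c \<theta>)"
    using assms by (intro affine_mult jet_poly_speed affine_jet_mono[OF g(1)]) auto
  moreover have "curvature_map k c = (\<lambda>\<theta>. (dtheta c \<theta> \<bullet> dtheta c \<theta>) * inv_sqrt_speed c \<theta> ^ 3 * g c \<theta>)" if "c \<in> Imm" for c
    by (rule ext) (simp add: curvature_map_def g(2)[OF that] flip: ImmD(7)[OF that])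
  ultimately show ?thesis by blast
qed

text \<open>One arc length derivative removes the logarithm: \<open>D_s ln |c'|\<close> equals
  \<open>(c' \<bullet> c'') / |c'|^3\<close>. The remaining \<open>k\<close> derivatives are treated
  as for the curvature.\<close>

lemma log_speed_map_jet:
  assumes "k \<le> m"
  shows "\<exists>F. affine_jet (Suc m) F \<and> (\<forall>c\<in>Imm. log_speed_map k c = F c)"
proof -
  have a: "affine_jet 1 (\<lambda>c \<theta>. inv_sqrt_speed c \<theta> ^ 6 * ((dtheta ^^ 1) c \<theta> \<bullet> (dtheta ^^ Suc 1) c \<theta>))"
    by (intro jet_inv_speed_mult affine_inner_top) auto
  have ln: "arc_deriv c (\<lambda>\<phi>. ln (speed c \<phi>)) \<theta> = inv_sqrt_speed c \<theta> ^ 6 * ((dtheta ^^ 1) c \<theta> \<bullet> (dtheta ^^ Suc 1) c \<theta>)"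
    if c: "c \<in> Imm" for c \<theta>
  proof -
    have "((\<lambda>\<phi>. ln (speed c \<phi>)) has_real_derivative
        inverse (speed c \<theta>) * ((dtheta c \<theta> \<bullet> dtheta (dtheta c) \<theta>) / speed c \<theta>)) (at \<theta>)" for \<theta>
      by (rule DERIV_chain2[OF DERIV_ln has_real_derivative_speed[OF c]]) (rule ImmD(3)[OF c])
    from dtheta_eqI[OF this[unfolded has_real_derivative_iff_has_vector_derivative]]
    have "arc_deriv c (\<lambda>\<phi>. ln (speed c \<phi>)) \<theta> = (1 / speed c \<theta>) ^ 3 * (dtheta c \<theta> \<bullet> dtheta (dtheta c) \<theta>)"
      by (simp add: arc_deriv_def field_simps eval_nat_numeral)
    then show ?thesis by (simp flip: ImmD(6)[OF c] power_mult)
  qed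
  from arc_deriv_funpow_affine_jet[OF a, of "\<lambda>c. arc_deriv c (\<lambda>\<phi>. ln (speed c \<phi>))" k] ln
  obtain g where g: "affine_jet (Suc k) g"
    "\<And>c. c \<in> Imm \<Longrightarrow> (arc_deriv c ^^ k) (arc_deriv c (\<lambda>\<phi>. ln (speed c \<phi>))) = g c" by blast
  have "affine_jet (Suc m) (\<lambda>c \<theta>. (dtheta c \<theta> \<bullet> dtheta c \<theta>) * inv_sqrt_speed c \<theta> ^ 3 * g c \<theta>)"
    using assms by (intro affine_mult jet_poly_speed affine_jet_mono[OF g(1)]) auto
  moreover have "log_speed_map k c = (\<lambda>\<theta>. (dtheta c \<theta> \<bullet> dtheta c \<theta>) * inv_sqrt_speed c \<theta> ^ 3 * g c \<theta>)" if "c \<in> Imm" for c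
    by (rule ext) (simp add: log_speed_map_def funpow_swap1 g(2)[OF that] flip: ImmD(7)[OF that])
  ultimately show ?thesis by blast
qed

section \<open>Arc length derivatives of tangent fields\<close>

text \<open>Linear differential operators in \<open>h\<close> whose coefficients are jet polynomials
  of \<open>c\<close>. They serve qualitative purposes, namely differentiability and joint
  continuity of \<open>D_s^i h\<close>, so the orders of operator and coefficients are not
  recorded.\<close>

inductive jet_operator :: "((real \<Rightarrow> real^2) \<Rightarrow> (real \<Rightarrow> real^2) \<Rightarrow> real \<Rightarrow> real^2) \<Rightarrow> bool" where
  operator_deriv: "jet_operator (\<lambda>c h. (dtheta ^^ i) h)"
| operator_scale: "jet_poly m f \<Longrightarrow> jet_operator u \<Longrightarrow> jet_operator (\<lambda>c h \<theta>. f c \<theta> *\<^sub>R u c h \<theta>)"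
| operator_add: "jet_operator u \<Longrightarrow> jet_operator w \<Longrightarrow> jet_operator (\<lambda>c h \<theta>. u c h \<theta> + w c h \<theta>)"

lemma jet_operator_deriv:
  assumes "jet_operator u"
  shows "\<exists>u'. jet_operator u' \<and>
    (\<forall>c\<in>Imm. \<forall>h\<in>smooth_circle. \<forall>\<theta>. (u c h has_vector_derivative u' c h \<theta>) (at \<theta>))"
  using assms
proof (induction rule: jet_operator.induct)
  case (operator_deriv i)
  show ?case
    by (rule exI[of _ "\<lambda>c. dtheta ^^ Suc i"])
       (auto simp: smooth_circle_def has_dtheta_funpow simp del: funpow.simps intro: jet_operator.operator_deriv)
next
  case (operator_scale m f u)
  then obtain u' where u': "jet_operator u'"
    "\<forall>c\<in>Imm. \<forall>h\<in>smooth_circle. \<forall>\<theta>. (u c h has_vector_derivative u' c h \<theta>) (at \<theta>)" by blast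
  have "jet_poly (Suc m) f" using operator_scale(1) by (rule jet_poly_mono) simp
  then obtain f' where f': "affine_jet (Suc m) f'"
    "\<forall>c\<in>Imm. \<forall>\<theta>. (f c has_real_derivative f' c \<theta>) (at \<theta>)" using jet_poly_deriv[of "Suc m" f] by auto
  show ?case
  proof (rule exI[of _ "\<lambda>c h \<theta>. f c \<theta> *\<^sub>R u' c h \<theta> + f' c \<theta> *\<^sub>R u c h \<theta>"], intro conjI ballI allI)
    show "jet_operator (\<lambda>c h \<theta>. f c \<theta> *\<^sub>R u' c h \<theta> + f' c \<theta> *\<^sub>R u c h \<theta>)"
      using operator_scale u' affine_jet_imp_jet_poly[OF f'(1)]
      by (intro operator_add jet_operator.operator_scale)
    fix c h \<theta> assume "c \<in> Imm" "h \<in> smooth_circle"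
    then show "((\<lambda>\<theta>. f c \<theta> *\<^sub>R u c h \<theta>) has_vector_derivative f c \<theta> *\<^sub>R u' c h \<theta> + f' c \<theta> *\<^sub>R u c h \<theta>) (at \<theta>)"
      using f' u' by (intro has_vector_derivative_scaleR) auto
  qed
next
  case (operator_add u w)
  then obtain u' w' where "jet_operator u'" "jet_operator w'"
    "\<forall>c\<in>Imm. \<forall>h\<in>smooth_circle. \<forall>\<theta>. (u c h has_vector_derivative u' c h \<theta>) (at \<theta>)"
    "\<forall>c\<in>Imm. \<forall>h\<in>smooth_circle. \<forall>\<theta>. (w c h has_vector_derivative w' c h \<theta>) (at \<theta>)" by blast
  then show ?case
    by (intro exI[of _ "\<lambda>c h \<theta>. u' c h \<theta> + w' c h \<theta>"])
       (auto intro!: jet_operator.operator_add has_vector_derivative_add)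
qed

text \<open>\<open>arc_deriv\<close> is built from the total function
  \<open>vector_derivative\<close>; identifying its iterates with such operators is what guarantees
  that each iterate really has a derivative.\<close>

lemma arc_deriv_jet_operator:
  "\<exists>u. jet_operator u \<and> (\<forall>c\<in>Imm. \<forall>h\<in>smooth_circle. (arc_deriv c ^^ i) h = u c h)"
proof (induction i)
  case 0
  show ?case using operator_deriv[of 0] by (intro exI[of _ "\<lambda>c h. h"]) simp
next
  case (Suc i)
  then obtain u where u: "jet_operator u" "\<And>c h. c \<in> Imm \<Longrightarrow> h \<in> smooth_circle \<Longrightarrow> (arc_deriv c ^^ i) h = u c h"
    by blast
  obtain u' where u': "jet_operator u'"
    "\<And>c h \<theta>. c \<in> Imm \<Longrightarrow> h \<in> smooth_circle \<Longrightarrow> (u c h has_vector_derivative u' c h \<theta>) (at \<theta>)"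
    using jet_operator_deriv[OF u(1)] by blast
  have "jet_operator (\<lambda>c h \<theta>. (inv_sqrt_speed c \<theta> ^ 2) *\<^sub>R u' c h \<theta>)"
    by (intro operator_scale[where m = 1] jet_power jet_speed u') simp
  moreover have "(arc_deriv c ^^ Suc i) h = (\<lambda>\<theta>. (inv_sqrt_speed c \<theta> ^ 2) *\<^sub>R u' c h \<theta>)"
    if "c \<in> Imm" "h \<in> smooth_circle" for c h
    using u'(2)[OF that, THEN dtheta_eqI]
    by (auto simp: u(2)[OF that] arc_deriv_def ImmD(6)[OF that(1)])
  ultimately show ?case by blast
qed

lemma has_vector_derivative_arc_deriv:
  assumes "c \<in> Imm" "h \<in> smooth_circle"
  shows "((arc_deriv c ^^ i) h has_vector_derivative speed c \<theta> *\<^sub>R (arc_deriv c ^^ Suc i) h \<theta>) (at \<theta>)"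
proof -
  obtain u where u: "jet_operator u" "(arc_deriv c ^^ i) h = u c h"
    using arc_deriv_jet_operator[of i] assms by blast
  obtain u' where u': "\<And>\<theta>. (u c h has_vector_derivative u' c h \<theta>) (at \<theta>)"
    using jet_operator_deriv[OF u(1)] assms by blast
  have "speed c \<theta> *\<^sub>R (arc_deriv c ^^ Suc i) h \<theta> = u' c h \<theta>"
    using ImmD(3)[OF assms(1), of \<theta>] dtheta_eqI[OF u'] by (simp add: u(2) arc_deriv_def)
  with u u' show ?thesis by simp
qed

lemma arc_deriv_continuous_on:
  assumes "smooth_path T c" "smooth_path T h" "\<And>t. t \<in> T \<Longrightarrow> c t \<in> Imm"
  shows "continuous_on (T \<times> UNIV) (\<lambda>(t, \<theta>). (arc_deriv (c t) ^^ i) (h t) \<theta>)"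
proof -
  have "continuous_on (T \<times> UNIV) (\<lambda>(t, \<theta>). u (c t) (h t) \<theta>)" if "jet_operator u" for u
    using that
  proof (induction rule: jet_operator.induct)
    case (operator_deriv i)
    show ?case using smooth_path_continuous_on[OF assms(2)] .
  next
    case (operator_scale m f u)
    then show ?case using jet_poly_continuous_on[OF _ assms(1,3)]
      by (auto simp: case_prod_unfold intro!: continuous_intros)
  qed (auto simp: case_prod_unfold intro!: continuous_intros)
  moreover obtain u where "jet_operator u" "\<And>c h. c \<in> Imm \<Longrightarrow> h \<in> smooth_circle \<Longrightarrow> (arc_deriv c ^^ i) h = u c h"
    using arc_deriv_jet_operator[of i] by blast
  ultimately show ?thesis
    using assms smooth_path_smooth_circle[OF assms(2)]
    by (subst continuous_on_cong[OF refl, of _ _ "\<lambda>(t, \<theta>). u (c t) (h t) \<theta>"]) auto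
qed

lemma arc_deriv_periodic:
  assumes "c \<in> Imm" "periodic_2pi h"
  shows "periodic_2pi ((arc_deriv c ^^ i) h)"
proof (induction i)
  case (Suc i)
  then show ?case
    using periodic_2pi_dtheta[OF Suc] periodic_2pi_dtheta[OF ImmD(2)[OF assms(1)]]
    by (simp add: periodic_2pi_def arc_deriv_def speed_def)
qed (simp add: assms)

text \<open>Differentiating the expansion of order \<open>m\<close> either raises an index, at the
  price of a factor \<open>|c'|\<close>, or differentiates a coefficient. Only the coefficient of
  \<open>D_s h\<close> is differentiated at every step starting from \<open>|c'|\<close>, so it
  alone reaches the derivative of \<open>c\<close> of order \<open>Suc m\<close>, and it does so
  affinely. At \<open>m = 0\<close> it is \<open>|c'|\<close> itself, a polynomial of order
  \<open>1\<close>; the affine form holds from \<open>m = 1\<close> on.\<close>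

lemma dtheta_funpow_arc_deriv:
  "\<exists>p. jet_poly (Suc m) (p 1) \<and> (1 \<le> m \<longrightarrow> affine_jet m (p 1)) \<and>
    (\<forall>i\<in>{2..Suc m}. jet_poly (max 1 m) (p i)) \<and>
    (\<forall>c\<in>Imm. \<forall>h\<in>smooth_circle. \<forall>\<theta>.
      (dtheta ^^ Suc m) h \<theta> = (\<Sum>i=1..Suc m. p i c \<theta> *\<^sub>R (arc_deriv c ^^ i) h \<theta>))"
proof (induction m)
  case 0
  have "dtheta h \<theta> = ((dtheta c \<theta> \<bullet> dtheta c \<theta>) * inv_sqrt_speed c \<theta> ^ 2) *\<^sub>R arc_deriv c h \<theta>"
    if "c \<in> Imm" for c h \<theta>
    unfolding ImmD(5)[OF that, symmetric] using ImmD(3)[OF that, of \<theta>] by (simp add: arc_deriv_def)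
  then show ?case
    by (intro exI[of _ "\<lambda>i c \<theta>. (dtheta c \<theta> \<bullet> dtheta c \<theta>) * inv_sqrt_speed c \<theta> ^ 2"]) (auto simp: jet_poly_speed)
next
  case (Suc m)
  then obtain p where p: "jet_poly (Suc m) (p 1)" "\<And>i. i \<in> {2..Suc m} \<Longrightarrow> jet_poly (max 1 m) (p i)"
    "\<And>c h \<theta>. c \<in> Imm \<Longrightarrow> h \<in> smooth_circle \<Longrightarrow>
      (dtheta ^^ Suc m) h \<theta> = (\<Sum>i=1..Suc m. p i c \<theta> *\<^sub>R (arc_deriv c ^^ i) h \<theta>)" by blast
  have "\<exists>q. (if i = 1 then affine_jet (Suc m) q else jet_poly (Suc m) q) \<and>
      (\<forall>c\<in>Imm. \<forall>\<theta>. (p i c has_real_derivative q c \<theta>) (at \<theta>))"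
    (is "\<exists>q. ?Q i q") if "i \<in> {1..Suc m}" for i
  proof (cases "i = 1")
    case True
    then show ?thesis using jet_poly_deriv[OF p(1)] by auto
  next
    case False
    then have "max 1 m = m" "jet_poly m (p i)" using that p(2)[of i] by (auto simp: max_def split: if_splits)
    then show ?thesis using jet_poly_deriv[of m "p i"] False affine_jet_imp_jet_poly by fastforce
  qed
  then have "\<forall>i\<in>{1..Suc m}. \<exists>q. ?Q i q" by blast
  from bchoice[OF this] obtain q where "\<forall>i\<in>{1..Suc m}. ?Q i (q i)" ..
  then have q: "\<And>i. i \<in> {1..Suc m} \<Longrightarrow> (if i = 1 then affine_jet (Suc m) (q i) else jet_poly (Suc m) (q i))"
    "\<And>i c \<theta>. i \<in> {1..Suc m} \<Longrightarrow> c \<in> Imm \<Longrightarrow> (p i c has_real_derivative q i c \<theta>) (at \<theta>)"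
    by blast+
  \<comment> \<open>\<open>?g\<close> is the speed. In \<open>r i\<close> the term
    \<open>q i\<close> comes from the differentiated coefficient and \<open>p (i - 1)\<close> times
    the speed from the raised index; the lowest index lacks the second and the highest lacks the
    first.\<close>
  let ?g = "\<lambda>c \<theta>. (dtheta c \<theta> \<bullet> dtheta c \<theta>) * inv_sqrt_speed c \<theta> ^ 2"
  define r where "r = (\<lambda>i. if i = 1 then q 1 else if i \<le> Suc m then (\<lambda>c \<theta>. q i c \<theta> + p (i - 1) c \<theta> * ?g c \<theta>)
     else (\<lambda>c \<theta>. p (i - 1) c \<theta> * ?g c \<theta>))"
  have pj: "jet_poly (Suc m) (p i)" if "i \<in> {1..Suc m}" for i
    using p(1) p(2)[of i, THEN jet_poly_mono, of "Suc m"] that by (cases "i = 1") auto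
  have r1: "affine_jet (Suc m) (r 1)" using q(1)[of 1] by (simp add: r_def)
  have r2: "jet_poly (Suc m) (r i)" if "i \<in> {2..Suc (Suc m)}" for i
  proof -
    have "jet_poly (Suc m) (\<lambda>c \<theta>. p (i - 1) c \<theta> * ?g c \<theta>)"
      using that by (intro jet_mult[of _ _ ?g] pj jet_poly_speed) auto
    moreover have "jet_poly (Suc m) (q i)" if "i \<le> Suc m" using that \<open>i \<in> _\<close> q(1)[of i] by auto
    ultimately show ?thesis using that by (auto simp: r_def intro: jet_add)
  qed
  have "(dtheta ^^ Suc (Suc m)) h \<theta> = (\<Sum>i=1..Suc (Suc m). r i c \<theta> *\<^sub>R (arc_deriv c ^^ i) h \<theta>)"
    if c: "c \<in> Imm" and h: "h \<in> smooth_circle" for c h \<theta>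
  proof -
    let ?D = "\<lambda>i. (arc_deriv c ^^ i) h"
    have "((\<lambda>\<theta>. \<Sum>i=1..Suc m. p i c \<theta> *\<^sub>R ?D i \<theta>) has_vector_derivative
        (\<Sum>i=1..Suc m. p i c \<theta> *\<^sub>R (speed c \<theta> *\<^sub>R ?D (Suc i) \<theta>) + q i c \<theta> *\<^sub>R ?D i \<theta>)) (at \<theta>)" for \<theta>
      by (intro has_vector_derivative_sum has_vector_derivative_scaleR
           has_vector_derivative_arc_deriv[OF c h] q(2) c)
    then have "dtheta ((dtheta ^^ Suc m) h) \<theta> =
        (\<Sum>i=1..Suc m. p i c \<theta> *\<^sub>R (speed c \<theta> *\<^sub>R ?D (Suc i) \<theta>) + q i c \<theta> *\<^sub>R ?D i \<theta>)"
      unfolding p(3)[OF c h, THEN ext] by (subst dtheta_eqI) auto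
    also have "\<dots> = (\<Sum>i=1..Suc m. p i c \<theta> *\<^sub>R (speed c \<theta> *\<^sub>R ?D (Suc i) \<theta>)) + (\<Sum>i=1..Suc m. q i c \<theta> *\<^sub>R ?D i \<theta>)"
      by (rule sum.distrib)
    \<comment> \<open>An index shift and padding by zero terms bring both sums to the range
      \<open>1..Suc (Suc m)\<close>, where they add up to the three cases of
      \<open>r\<close>.\<close>
    also have "(\<Sum>i=1..Suc m. p i c \<theta> *\<^sub>R (speed c \<theta> *\<^sub>R ?D (Suc i) \<theta>)) =
        (\<Sum>i=Suc 1..Suc (Suc m). p (i - 1) c \<theta> *\<^sub>R (speed c \<theta> *\<^sub>R ?D i \<theta>))"
      unfolding sum.shift_bounds_cl_Suc_ivl by simp
    also have "\<dots> = (\<Sum>i=1..Suc (Suc m). if i = 1 then 0 else p (i - 1) c \<theta> *\<^sub>R (speed c \<theta> *\<^sub>R ?D i \<theta>))"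
      by (rule sum.mono_neutral_cong_left) auto
    also have "(\<Sum>i=1..Suc m. q i c \<theta> *\<^sub>R ?D i \<theta>) = (\<Sum>i=1..Suc (Suc m). if i \<le> Suc m then q i c \<theta> *\<^sub>R ?D i \<theta> else 0)"
      by (rule sum.mono_neutral_cong_left) auto
    also have "(\<Sum>i=1..Suc (Suc m). if i = 1 then 0 else p (i - 1) c \<theta> *\<^sub>R (speed c \<theta> *\<^sub>R ?D i \<theta>)) + \<dots> =
        (\<Sum>i=1..Suc (Suc m). r i c \<theta> *\<^sub>R ?D i \<theta>)"
      unfolding sum.distrib[symmetric]
      by (rule sum.cong) (auto simp: r_def algebra_simps ImmD(5)[OF c, of \<theta>])
    finally show ?thesis by simp
  qed
  then show ?case
    using r1 r2 affine_jet_imp_jet_poly[OF r1] by (intro exI[of _ r]) (auto simp del: funpow.simps sum.cl_ivl_Suc)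
qed

text \<open>The lower derivatives of \<open>h\<close> share a pointwise bound \<open>e\<close>, but
  the one of order \<open>Suc m\<close> is kept apart, since at order \<open>n\<close> no pointwise
  bound exists. The factor with the top derivative of \<open>c\<close> stems from the affine
  coefficient of \<open>D_s h\<close>.\<close>

lemma norm_dtheta_funpow_le:
  assumes "1 \<le> m" "K > 0"
  obtains C where "C \<ge> 0"
    "\<And>c h \<theta> e. c \<in> Imm \<Longrightarrow> h \<in> smooth_circle \<Longrightarrow> jet_bound m K c \<theta> \<Longrightarrow>
      (\<forall>i\<in>{1..m}. norm ((arc_deriv c ^^ i) h \<theta>) \<le> e) \<Longrightarrow>
      norm ((dtheta ^^ Suc m) h \<theta>) \<le>
        C * (e * (1 + norm ((dtheta ^^ Suc m) c \<theta>)) + norm ((arc_deriv c ^^ Suc m) h \<theta>))"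
proof -
  have "max 1 m = m" using assms(1) by simp
  with dtheta_funpow_arc_deriv[of m] assms(1)
  obtain p where p: "affine_jet m (p 1)" "\<And>i. i \<in> {2..Suc m} \<Longrightarrow> jet_poly m (p i)"
    "\<And>c h \<theta>. c \<in> Imm \<Longrightarrow> h \<in> smooth_circle \<Longrightarrow>
      (dtheta ^^ Suc m) h \<theta> = (\<Sum>i=1..Suc m. p i c \<theta> *\<^sub>R (arc_deriv c ^^ i) h \<theta>)"
    unfolding \<open>max 1 m = m\<close> by blast
  let ?R = "\<lambda>c h \<theta> e. e * (1 + norm ((dtheta ^^ Suc m) c \<theta>)) + norm ((arc_deriv c ^^ Suc m) h \<theta>)"
  let ?P = "\<lambda>c h \<theta> e. c \<in> Imm \<and> h \<in> smooth_circle \<and> jet_bound m K c \<theta> \<and>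
      (\<forall>i\<in>{1..m}. norm ((arc_deriv c ^^ i) h \<theta>) \<le> e)"
  have "\<exists>C\<ge>0. \<forall>c h \<theta> e. ?P c h \<theta> e \<longrightarrow> norm (p i c \<theta> *\<^sub>R (arc_deriv c ^^ i) h \<theta>) \<le> C * ?R c h \<theta> e"
    (is "\<exists>C. ?Q i C") if i: "i \<in> {1..Suc m}" for i
  proof (cases "i = 1")
    case True
    obtain C where C: "C \<ge> 0" "\<And>c \<theta>. jet_bound m K c \<theta> \<Longrightarrow> \<bar>p 1 c \<theta>\<bar> \<le> C * (1 + norm ((dtheta ^^ Suc m) c \<theta>))"
      by (rule affine_jet_bounds[OF p(1) assms(2)], rule that; assumption)
    show ?thesis
    proof (intro exI[of _ C] conjI allI impI)
      fix c h \<theta> e assume *: "?P c h \<theta> e"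
      then have "norm ((arc_deriv c ^^ 1) h \<theta>) \<le> e" using assms(1) by (auto dest!: bspec[of _ _ 1])
      then have "norm (p i c \<theta> *\<^sub>R (arc_deriv c ^^ i) h \<theta>) \<le> C * (1 + norm ((dtheta ^^ Suc m) c \<theta>)) * e"
        using C(2)[of c \<theta>] * unfolding True norm_scaleR
        by (intro mult_mono) (auto intro!: mult_nonneg_nonneg C simp del: funpow.simps)
      also have "\<dots> \<le> C * ?R c h \<theta> e"
        using C(1) by (simp add: algebra_simps del: funpow.simps)
      finally show "norm (p i c \<theta> *\<^sub>R (arc_deriv c ^^ i) h \<theta>) \<le> C * ?R c h \<theta> e" .
    qed (rule C)
  next
    case False
    then have pi: "jet_poly m (p i)" using i p(2)[of i] by auto
    obtain C where C: "C \<ge> 0" "\<And>c \<theta>. jet_bound m K c \<theta> \<Longrightarrow> \<bar>p i c \<theta>\<bar> \<le> C"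
      by (rule jet_poly_bounds[OF pi assms(2)], rule that; assumption)
    show ?thesis
    proof (intro exI[of _ C] conjI allI impI)
      fix c h \<theta> e assume *: "?P c h \<theta> e"
      have "norm ((arc_deriv c ^^ 1) h \<theta>) \<le> e" using assms(1) * by (auto dest!: bspec[of _ _ 1])
      then have "0 \<le> e" using norm_ge_zero order_trans by blast
      then have R: "norm ((arc_deriv c ^^ Suc m) h \<theta>) \<le> ?R c h \<theta> e" "e \<le> ?R c h \<theta> e"
        by (auto simp: distrib_left simp del: funpow.simps)
      have "norm ((arc_deriv c ^^ i) h \<theta>) \<le> ?R c h \<theta> e"
      proof (cases "i = Suc m")
        case True
        then show ?thesis using R(1) by simp
      next
        case False
        then have "norm ((arc_deriv c ^^ i) h \<theta>) \<le> e" using * i by auto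
        then show ?thesis using R(2) by linarith
      qed
      then show "norm (p i c \<theta> *\<^sub>R (arc_deriv c ^^ i) h \<theta>) \<le> C * ?R c h \<theta> e"
        using C * unfolding norm_scaleR by (intro mult_mono) auto
    qed (rule C)
  qed
  then have "\<forall>i\<in>{1..Suc m}. \<exists>C. ?Q i C" by blast
  from bchoice[OF this] obtain C where "\<forall>i\<in>{1..Suc m}. ?Q i (C i)" ..
  then have C: "\<And>i. i \<in> {1..Suc m} \<Longrightarrow> C i \<ge> 0"
    "\<And>i c h \<theta> e. i \<in> {1..Suc m} \<Longrightarrow> ?P c h \<theta> e \<Longrightarrow> norm (p i c \<theta> *\<^sub>R (arc_deriv c ^^ i) h \<theta>) \<le> C i * ?R c h \<theta> e"
    by blast+
  show ?thesis
  proof (rule that[of "\<Sum>i=1..Suc m. C i"])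
    show "(\<Sum>i=1..Suc m. C i) \<ge> 0" using C(1) by (rule sum_nonneg)
    fix c h \<theta> e assume *: "c \<in> Imm" "h \<in> smooth_circle" "jet_bound m K c \<theta>"
      "\<forall>i\<in>{1..m}. norm ((arc_deriv c ^^ i) h \<theta>) \<le> e"
    show "norm ((dtheta ^^ Suc m) h \<theta>) \<le> (\<Sum>i=1..Suc m. C i) * ?R c h \<theta> e"
      unfolding p(3)[OF *(1,2)] sum_distrib_right
      by (rule sum_norm_le) (rule C(2), use * in auto)
  qed
qed

section \<open>Integral inequalities\<close>

text \<open>The right side of the hypothesis, multiplied by \<open>exp\<close> of minus the integral
  of \<open>e\<close>, is nonincreasing.\<close>

lemma gronwall:
  fixes y e :: "real \<Rightarrow> real"
  assumes y: "continuous_on {0..1} y" and e: "continuous_on {0..1} e" "\<And>t. t \<in> {0..1} \<Longrightarrow> 0 \<le> e t"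
    and a: "0 \<le> a"
    and le: "\<And>t. t \<in> {0..1} \<Longrightarrow> y t \<le> a + integral {0..t} (\<lambda>s. e s * y s)"
    and t: "t \<in> {0..1}"
  shows "y t \<le> a * exp (integral {0..1} e)"
proof -
  let ?R = "\<lambda>t. a + integral {0..t} (\<lambda>s. e s * y s)"
  let ?P = "\<lambda>t. integral {0..t} e"
  \<comment> \<open>The sign makes the derivative \<open>?Z'\<close> nonnegative, so monotonicity
    follows by integrating it.\<close>
  let ?Z = "\<lambda>t. - (?R t * exp (- ?P t))"
  let ?Z' = "\<lambda>t. e t * (?R t - y t) * exp (- ?P t)"
  have d: "(?Z has_real_derivative ?Z' t) (at t within {0..1})" if "t \<in> {0..1}" for t
  proof -
    have 1: "(?R has_real_derivative e t * y t) (at t within {0..1})"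
      by (rule DERIV_cong[OF DERIV_add[OF DERIV_const integral_has_real_derivative[OF _ that]]])
         (auto intro!: continuous_intros y e)
    have 2: "(?P has_real_derivative e t) (at t within {0..1})"
      by (rule integral_has_real_derivative[OF e(1) that])
    show ?thesis
      by (rule DERIV_cong[OF DERIV_minus[OF DERIV_mult[OF 1 DERIV_chain2[OF DERIV_exp DERIV_minus[OF 2]]]]])
         (simp add: algebra_simps)
  qed
  have "(?Z' has_integral (?Z t - ?Z 0)) {0..t}"
    using t by (intro fundamental_theorem_of_calculus)
      (auto simp flip: has_real_derivative_iff_has_vector_derivative intro!: DERIV_subset[OF d])
  then have "0 \<le> ?Z t - ?Z 0"
    by (rule has_integral_nonneg) (use t e(2) le in \<open>auto intro!: mult_nonneg_nonneg\<close>)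
  then have "?R t * exp (- ?P t) \<le> a" by simp
  then have "?R t * exp (- ?P t) * exp (?P t) \<le> a * exp (?P t)" by (rule mult_right_mono) simp
  then have "?R t \<le> a * exp (?P t)" by (simp add: mult.assoc flip: exp_add)
  also have "?P t \<le> integral {0..1} e"
    by (rule integral_subset_le)
       (use t e in \<open>auto intro!: integrable_continuous_real intro: continuous_on_subset\<close>)
  then have "a * exp (?P t) \<le> a * exp (integral {0..1} e)" using a by (intro mult_left_mono) auto
  finally show ?thesis using le[OF t] by linarith
qed

text \<open>The quadratic polynomial in \<open>r\<close> given by the integral of
  \<open>(f - r * g)^2\<close> is nonnegative; it is evaluated at its minimum \<open>?H / ?G\<close>
  unless \<open>?G\<close> vanishes.\<close>

lemma Cauchy_Schwarz_integral:
  fixes f g :: "real \<Rightarrow> real"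
  assumes f: "continuous_on {a..b} f" and g: "continuous_on {a..b} g"
  shows "(integral {a..b} (\<lambda>x. f x * g x))\<^sup>2 \<le> integral {a..b} (\<lambda>x. (f x)\<^sup>2) * integral {a..b} (\<lambda>x. (g x)\<^sup>2)"
proof -
  let ?I = "integral {a..b}"
  let ?F = "?I (\<lambda>x. (f x)\<^sup>2)" and ?G = "?I (\<lambda>x. (g x)\<^sup>2)" and ?H = "?I (\<lambda>x. f x * g x)"
  have ineq: "0 \<le> ?F - 2 * r * ?H + r\<^sup>2 * ?G" for r
  proof -
    have "0 \<le> ?I (\<lambda>x. (f x - r * g x)\<^sup>2)" by (rule integral_nonneg) (auto intro!: integrable_continuous_real continuous_intros f g)
    also have "(\<lambda>x. (f x - r * g x)\<^sup>2) = (\<lambda>x. (f x)\<^sup>2 - 2 * r * (f x * g x) + r\<^sup>2 * (g x)\<^sup>2)"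
      by (simp add: power2_eq_square algebra_simps fun_eq_iff)
    also have "?I \<dots> = ?F - 2 * r * ?H + r\<^sup>2 * ?G"
      by (subst integral_add, (auto intro!: integrable_continuous_real continuous_intros f g)[2])
         (subst integral_diff, auto intro!: integrable_continuous_real continuous_intros f g)
    finally show ?thesis .
  qed
  have "0 \<le> ?G" by (rule integral_nonneg) (auto intro!: integrable_continuous_real continuous_intros g)
  show ?thesis
  proof (cases "?G = 0")
    case True
    have "?H = 0"
    proof (rule ccontr)
      assume "?H \<noteq> 0"
      \<comment> \<open>Without the quadratic term the polynomial is affine in \<open>r\<close>, and
        this \<open>r\<close> gives it the value \<open>- 1\<close>.\<close>
      then show False using ineq[of "(?F + 1) / (2 * ?H)"] True by (simp add: field_simps)
    qed
    then show ?thesis using True by simp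
  next
    case False
    with \<open>0 \<le> ?G\<close> have "0 < ?G" by simp
    then show ?thesis using ineq[of "?H / ?G"] by (simp add: field_simps power2_eq_square)
  qed
qed

text \<open>Cauchy-Schwarz with weight \<open>e\<close> bounds the squared inner integral by the
  integral of \<open>q^2 / e\<close> times that of \<open>e\<close>. After exchanging the integrals,
  the hypothesis turns the first factor into the integral of \<open>e\<close> as well.\<close>

lemma Minkowski_integral:
  fixes q :: "real \<Rightarrow> real \<Rightarrow> real" and e :: "real \<Rightarrow> real"
  assumes q: "continuous_on ({0..1} \<times> {a..b}) (\<lambda>(s, x). q s x)"
    and e: "continuous_on {0..1} e" "\<And>s. s \<in> {0..1} \<Longrightarrow> 0 \<le> e s"
    and le: "\<And>s. s \<in> {0..1} \<Longrightarrow> integral {a..b} (\<lambda>x. (q s x)\<^sup>2) \<le> (e s)\<^sup>2"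
  shows "integral {a..b} (\<lambda>x. (integral {0..1} (\<lambda>s. q s x))\<^sup>2) \<le> (integral {0..1} e)\<^sup>2"
    (is "?X \<le> _")
proof -
  let ?I = "integral {0..1} e"
  have qs: "continuous_on ({a..b} \<times> {0..1}) (\<lambda>(x, s). q s x)"
    using continuous_on_compose2[OF q continuous_on_swap, of "{a..b} \<times> {0..1}"]
    by (simp add: case_prod_unfold prod.swap_def image_subset_iff)
  have qx: "continuous_on {0..1} (\<lambda>s. q s x)" if "x \<in> {a..b}" for x
    using continuous_on_compose2[OF q, of "{0..1}" "\<lambda>s. (s, x)"] that
    by (simp add: image_subset_iff continuous_on_Pair)
  have q1: "continuous_on {a..b} (q s)" if "s \<in> {0..1}" for s
    using continuous_on_compose2[OF q, of "{a..b}" "\<lambda>x. (s, x)"] that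
    by (simp add: image_subset_iff continuous_on_Pair)
  have Iq: "continuous_on {a..b} (\<lambda>x. integral {0..1} (\<lambda>s. q s x))"
    using integral_continuous_on_param[of "{a..b}" 0 1 "\<lambda>x s. q s x"] qs by simp
  \<comment> \<open>The weight may vanish, so \<open>e + \<epsilon>\<close> is used in its place and
    \<open>\<epsilon>\<close> is removed at the end.\<close>
  have eps: "?X \<le> (?I + \<epsilon>)\<^sup>2" if \<epsilon>: "0 < \<epsilon>" for \<epsilon>
  proof -
    have pos: "0 < e s + \<epsilon>" if "s \<in> {0..1}" for s using e(2)[OF that] \<epsilon> by simp
    have Ie: "integral {0..1} (\<lambda>s. e s + \<epsilon>) = ?I + \<epsilon>"
      using e(1) by (subst integral_add) (auto intro!: integrable_continuous_real)
    have "0 \<le> ?I" by (rule integral_nonneg) (use e in \<open>auto intro!: integrable_continuous_real\<close>)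
    have cont2: "continuous_on ({a..b} \<times> {0..1}) (\<lambda>(x, s). (q s x)\<^sup>2 / (e s + \<epsilon>))"
      unfolding case_prod_unfold
      by (intro continuous_intros qs[unfolded case_prod_unfold] continuous_on_compose2[OF e(1) continuous_on_snd])
         (auto dest: pos)
    have point: "(integral {0..1} (\<lambda>s. q s x))\<^sup>2 \<le> integral {0..1} (\<lambda>s. (q s x)\<^sup>2 / (e s + \<epsilon>)) * (?I + \<epsilon>)"
      if x: "x \<in> {a..b}" for x
    proof -
      have "integral {0..1} (\<lambda>s. q s x) = integral {0..1} (\<lambda>s. q s x / sqrt (e s + \<epsilon>) * sqrt (e s + \<epsilon>))"
        using pos by (intro integral_cong) (auto simp: less_imp_neq[symmetric])
      also have "\<dots>\<^sup>2 \<le> integral {0..1} (\<lambda>s. (q s x / sqrt (e s + \<epsilon>))\<^sup>2) * integral {0..1} (\<lambda>s. (sqrt (e s + \<epsilon>))\<^sup>2)"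
        using pos by (intro Cauchy_Schwarz_integral continuous_intros qx x e) (auto simp: less_imp_neq[symmetric])
      also have "integral {0..1} (\<lambda>s. (q s x / sqrt (e s + \<epsilon>))\<^sup>2) = integral {0..1} (\<lambda>s. (q s x)\<^sup>2 / (e s + \<epsilon>))"
        using pos by (intro integral_cong) (auto simp: power_divide less_imp_le)
      also have "integral {0..1} (\<lambda>s. (sqrt (e s + \<epsilon>))\<^sup>2) = integral {0..1} (\<lambda>s. e s + \<epsilon>)"
        using pos by (intro integral_cong) (auto simp: less_imp_le)
      finally show ?thesis unfolding Ie .
    qed
    have "continuous_on {a..b} (\<lambda>x. integral {0..1} (\<lambda>s. (q s x)\<^sup>2 / (e s + \<epsilon>)))"
      using integral_continuous_on_param[of "{a..b}" 0 1 "\<lambda>x s. (q s x)\<^sup>2 / (e s + \<epsilon>)"] cont2 by simp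
    then have "?X \<le> integral {a..b} (\<lambda>x. integral {0..1} (\<lambda>s. (q s x)\<^sup>2 / (e s + \<epsilon>)) * (?I + \<epsilon>))"
      by (intro integral_le point integrable_continuous_real continuous_intros Iq) auto
    also have "\<dots> = integral {a..b} (\<lambda>x. integral {0..1} (\<lambda>s. (q s x)\<^sup>2 / (e s + \<epsilon>))) * (?I + \<epsilon>)"
      by simp
    also have "integral {a..b} (\<lambda>x. integral {0..1} (\<lambda>s. (q s x)\<^sup>2 / (e s + \<epsilon>))) =
        integral {0..1} (\<lambda>s. integral {a..b} (\<lambda>x. (q s x)\<^sup>2 / (e s + \<epsilon>)))"
      using integral_swap_continuous[of a 0 b 1 "\<lambda>x s. (q s x)\<^sup>2 / (e s + \<epsilon>)"] cont2
      by (simp add: cbox_Pair_eq)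
    also have "\<dots> \<le> integral {0..1} (\<lambda>s. e s + \<epsilon>)"
    proof (rule integral_le)
      have "continuous_on ({0..1} \<times> {a..b}) (\<lambda>(s, x). (q s x)\<^sup>2 / (e s + \<epsilon>))"
        unfolding case_prod_unfold
        by (intro continuous_intros q[unfolded case_prod_unfold] continuous_on_compose2[OF e(1) continuous_on_fst])
           (auto dest: pos)
      then show "(\<lambda>s. integral {a..b} (\<lambda>x. (q s x)\<^sup>2 / (e s + \<epsilon>))) integrable_on {0..1}"
        using integral_continuous_on_param[of "{0..1}" a b "\<lambda>s x. (q s x)\<^sup>2 / (e s + \<epsilon>)"]
        by (auto intro!: integrable_continuous_real)
      show "(\<lambda>s. e s + \<epsilon>) integrable_on {0..1}" by (intro integrable_continuous_real continuous_intros e)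
      fix s :: real assume s: "s \<in> {0..1}"
      have "integral {a..b} (\<lambda>x. (q s x)\<^sup>2 / (e s + \<epsilon>)) = integral {a..b} (\<lambda>x. (q s x)\<^sup>2) / (e s + \<epsilon>)"
        by simp
      also have "\<dots> \<le> (e s + \<epsilon>)\<^sup>2 / (e s + \<epsilon>)"
      proof (rule divide_right_mono)
        have "(e s)\<^sup>2 \<le> (e s + \<epsilon>)\<^sup>2" using e(2)[OF s] \<epsilon> by (intro power_mono) auto
        then show "integral {a..b} (\<lambda>x. (q s x)\<^sup>2) \<le> (e s + \<epsilon>)\<^sup>2" using le[OF s] by linarith
      qed (use pos[OF s] in simp)
      also have "\<dots> = e s + \<epsilon>" by (simp add: power2_eq_square)
      finally show "integral {a..b} (\<lambda>x. (q s x)\<^sup>2 / (e s + \<epsilon>)) \<le> e s + \<epsilon>" .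
    qed
    finally show ?thesis using \<open>0 \<le> ?I\<close> \<epsilon> by (simp add: Ie power2_eq_square mult_right_mono)
  qed
  have I0: "0 \<le> ?I" by (rule integral_nonneg) (use e in \<open>auto intro!: integrable_continuous_real\<close>)
  have "sqrt ?X \<le> ?I"
  proof (rule field_le_epsilon)
    fix \<epsilon> :: real assume "0 < \<epsilon>"
    then show "sqrt ?X \<le> ?I + \<epsilon>" using eps[of \<epsilon>] I0 by (intro real_le_lsqrt) auto
  qed
  then show ?thesis using I0 by (metis real_sqrt_le_iff real_sqrt_unique)
qed

text \<open>The increments are nondecreasing. A nonnegative increment at \<open>i\<close> makes the
  sequence nondecreasing from \<open>i\<close> to \<open>n\<close>, a negative one makes it
  decreasing from \<open>0\<close> to \<open>i\<close>.\<close>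

lemma convex_seq_le:
  fixes a :: "nat \<Rightarrow> real"
  assumes "\<And>i. a (Suc i) \<le> (a i + a (Suc (Suc i))) / 2" "i \<le> n"
  shows "a i \<le> max (a 0) (a n)"
proof -
  define b where "b = (\<lambda>i. a (Suc i) - a i)"
  have b: "b i \<le> b j" if "i \<le> j" for i j
    using that by (rule lift_Suc_mono_le[rotated]) (use assms(1) in \<open>force simp: b_def field_simps\<close>)
  show ?thesis
  proof (cases "0 \<le> b i")
    case True
    have "a i \<le> a (i + k)" for k
    proof (induction k)
      case (Suc k)
      then show ?case using b[of i "i + k"] True by (simp add: b_def)
    qed simp
    from this[of "n - i"] show ?thesis using assms(2) by simp
  next
    case False
    have "a i \<le> a (i - k)" if "k \<le> i" for k
      using that
    proof (induction k)
      case (Suc k)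
      then have "Suc (i - Suc k) = i - k" by simp
      then show ?case using Suc b[of "i - Suc k" i] False by (simp add: b_def)
    qed simp
    from this[of i] show ?thesis by simp
  qed
qed

section \<open>Energies of the arc length derivatives\<close>

definition curve_length :: "(real \<Rightarrow> real^2) \<Rightarrow> real" where
  "curve_length c = integral {0..2 * pi} (speed c)"

definition arc_energy :: "(real \<Rightarrow> real^2) \<Rightarrow> (real \<Rightarrow> real^2) \<Rightarrow> nat \<Rightarrow> real" where
  "arc_energy c h i = integral {0..2 * pi} (\<lambda>\<theta>. (norm ((arc_deriv c ^^ i) h \<theta>))\<^sup>2 * speed c \<theta>)"

definition sobolev_norm :: "nat \<Rightarrow> (real \<Rightarrow> real^2) \<Rightarrow> (real \<Rightarrow> real^2) \<Rightarrow> real" where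
  "sobolev_norm n c h = sqrt (arc_energy c h 0 + arc_energy c h n)"

lemma continuous_on_speed: "c \<in> Imm \<Longrightarrow> continuous_on S (speed c)"
  by (rule DERIV_continuous_on) (rule has_field_derivative_at_within[OF has_real_derivative_speed])

lemma continuous_on_arc_deriv:
  "c \<in> Imm \<Longrightarrow> h \<in> smooth_circle \<Longrightarrow> continuous_on S ((arc_deriv c ^^ i) h)"
  by (meson continuous_at_imp_continuous_on has_vector_derivative_arc_deriv has_vector_derivative_continuous)

lemma arc_energy_nonneg:
  assumes "c \<in> Imm" "h \<in> smooth_circle"
  shows "0 \<le> arc_energy c h i"
  unfolding arc_energy_def
  by (intro integral_nonneg integrable_continuous_real continuous_intros continuous_on_speed
      continuous_on_arc_deriv assms) (simp add: speed_def)

lemma sobolev_norm_squared: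
  assumes "c \<in> Imm" "h \<in> smooth_circle"
  shows "(sobolev_norm n c h)\<^sup>2 =
    arc_integral c (\<lambda>\<theta>. (norm (h \<theta>))\<^sup>2 + (norm ((arc_deriv c ^^ n) h \<theta>))\<^sup>2)"
proof -
  have "arc_integral c (\<lambda>\<theta>. (norm (h \<theta>))\<^sup>2 + (norm ((arc_deriv c ^^ n) h \<theta>))\<^sup>2) =
      arc_energy c h 0 + arc_energy c h n"
    unfolding arc_energy_def arc_integral_def distrib_right funpow_0
    by (intro integral_add integrable_continuous_real continuous_intros continuous_on_speed
        continuous_on_arc_deriv[OF assms] continuous_on_arc_deriv[OF assms, of _ 0, simplified] assms)
  then show ?thesis
    unfolding sobolev_norm_def using arc_energy_nonneg[OF assms] by (simp add: add_nonneg_nonneg)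
qed

lemma curve_length_pos:
  assumes "c \<in> Imm"
  shows "0 < curve_length c"
proof -
  have "integral {0..2 * pi} (\<lambda>_. 0) < integral {0..2 * pi} (speed c)"
    by (rule integral_less_real) (use continuous_on_speed[OF assms] ImmD(3)[OF assms] in \<open>auto simp: not_le\<close>)
  then show ?thesis by (simp add: curve_length_def)
qed

text \<open>Cauchy-Schwarz with the weight distributed as a root of the speed on each factor. For
  \<open>i = Suc j\<close> the left side is the total variation of \<open>D_s^j h\<close>.\<close>

lemma integral_norm_arc_deriv_le:
  assumes "c \<in> Imm" "h \<in> smooth_circle"
  shows "integral {0..2 * pi} (\<lambda>\<theta>. speed c \<theta> * norm ((arc_deriv c ^^ i) h \<theta>)) \<le> sqrt (curve_length c * arc_energy c h i)"
proof -
  note cont = continuous_on_speed[OF assms(1)] continuous_on_arc_deriv[OF assms]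
  have p: "0 \<le> speed c \<theta>" for \<theta> by (simp add: speed_def)
  have "integral {0..2 * pi} (\<lambda>\<theta>. speed c \<theta> * norm ((arc_deriv c ^^ i) h \<theta>)) =
      integral {0..2 * pi} (\<lambda>\<theta>. sqrt (speed c \<theta>) * (sqrt (speed c \<theta>) * norm ((arc_deriv c ^^ i) h \<theta>)))"
    using p by (simp flip: mult.assoc)
  also have "\<dots> \<le> sqrt (integral {0..2 * pi} (\<lambda>\<theta>. (sqrt (speed c \<theta>))\<^sup>2) *
      integral {0..2 * pi} (\<lambda>\<theta>. (sqrt (speed c \<theta>) * norm ((arc_deriv c ^^ i) h \<theta>))\<^sup>2))"
    by (intro real_le_rsqrt Cauchy_Schwarz_integral continuous_intros cont)
  finally show ?thesis
    using p by (simp add: curve_length_def arc_energy_def power_mult_distrib mult.commute)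
qed

lemma integral_arc_deriv_eq:
  assumes "c \<in> Imm" "h \<in> smooth_circle" "a \<le> b"
  shows "((\<lambda>\<theta>. speed c \<theta> *\<^sub>R (arc_deriv c ^^ Suc i) h \<theta>) has_integral
    (arc_deriv c ^^ i) h b - (arc_deriv c ^^ i) h a) {a..b}"
  using assms(3)
  by (rule fundamental_theorem_of_calculus)
     (rule has_vector_derivative_at_within[OF has_vector_derivative_arc_deriv[OF assms(1,2)]])

text \<open>Integration by parts, followed by Young's inequality.\<close>

lemma arc_energy_convex:
  assumes "c \<in> Imm" "h \<in> smooth_circle"
  shows "arc_energy c h (Suc i) \<le> (arc_energy c h i + arc_energy c h (Suc (Suc i))) / 2"
proof -
  let ?D = "\<lambda>i. (arc_deriv c ^^ i) h"
  let ?g = "speed c"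
  note cont = continuous_on_speed[OF assms(1)] continuous_on_arc_deriv[OF assms]
  have p: "0 \<le> ?g \<theta>" for \<theta> by (simp add: speed_def)
  let ?F' = "\<lambda>\<theta>. ?D i \<theta> \<bullet> (?g \<theta> *\<^sub>R ?D (Suc (Suc i)) \<theta>) + (?g \<theta> *\<^sub>R ?D (Suc i) \<theta>) \<bullet> ?D (Suc i) \<theta>"
  have "(?F' has_integral (?D i (2 * pi) \<bullet> ?D (Suc i) (2 * pi) - ?D i 0 \<bullet> ?D (Suc i) 0)) {0..2 * pi}"
  proof (rule fundamental_theorem_of_calculus)
    fix \<theta>
    have "((\<lambda>\<theta>. ?D i \<theta> \<bullet> ?D (Suc i) \<theta>) has_vector_derivative ?F' \<theta>) (at \<theta>)"
      by (rule bounded_bilinear.has_vector_derivative[OF bounded_bilinear_inner])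
         (rule has_vector_derivative_arc_deriv[OF assms])+
    then show "((\<lambda>\<theta>. ?D i \<theta> \<bullet> ?D (Suc i) \<theta>) has_vector_derivative ?F' \<theta>) (at \<theta> within {0..2 * pi})"
      by (rule has_vector_derivative_at_within)
  qed simp
  moreover have "?D j (2 * pi) = ?D j 0" for j
    using arc_deriv_periodic[OF assms(1), of h j] assms(2)
    by (auto simp: smooth_circle_def periodic_2pi_def dest: spec[of _ 0])
  ultimately have "integral {0..2 * pi} ?F' = 0" by (simp only: integral_unique diff_self)
  moreover have "integral {0..2 * pi} (\<lambda>\<theta>. (norm (?D (Suc i) \<theta>))\<^sup>2 * ?g \<theta> -
      ((norm (?D i \<theta>))\<^sup>2 * ?g \<theta> + (norm (?D (Suc (Suc i)) \<theta>))\<^sup>2 * ?g \<theta>) / 2) \<le> integral {0..2 * pi} ?F'"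
  proof (intro integral_le integrable_continuous_real continuous_intros cont)
    fix \<theta>
    have "- (x \<bullet> y) \<le> ((norm x)\<^sup>2 + (norm y)\<^sup>2) / 2" for x y :: "real^2"
      using zero_le_power2[of "norm (x + y)"]
      by (simp add: power2_norm_eq_inner inner_add_left inner_add_right inner_commute)
    from mult_right_mono[OF this p, of "?D i \<theta>" "?D (Suc (Suc i)) \<theta>" \<theta>]
    show "(norm (?D (Suc i) \<theta>))\<^sup>2 * ?g \<theta> -
      ((norm (?D i \<theta>))\<^sup>2 * ?g \<theta> + (norm (?D (Suc (Suc i)) \<theta>))\<^sup>2 * ?g \<theta>) / 2 \<le> ?F' \<theta>"
      by (auto simp: algebra_simps add_divide_distrib power2_norm_eq_inner simp del: funpow.simps)
  qed auto
  moreover have "integral {0..2 * pi} (\<lambda>\<theta>. (norm (?D (Suc i) \<theta>))\<^sup>2 * ?g \<theta> -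
      ((norm (?D i \<theta>))\<^sup>2 * ?g \<theta> + (norm (?D (Suc (Suc i)) \<theta>))\<^sup>2 * ?g \<theta>) / 2) =
      arc_energy c h (Suc i) - (arc_energy c h i + arc_energy c h (Suc (Suc i))) / 2"
    unfolding arc_energy_def
    by (subst integral_diff, (intro integrable_continuous_real continuous_intros cont; simp)+)
       (subst integral_divide, subst integral_add,
        (intro integrable_continuous_real continuous_intros cont; simp)+, rule refl)
  ultimately show ?thesis by linarith
qed

lemma arc_energy_le:
  assumes "c \<in> Imm" "h \<in> smooth_circle" "i \<le> n"
  shows "arc_energy c h i \<le> (sobolev_norm n c h)\<^sup>2"
proof -
  have "arc_energy c h i \<le> max (arc_energy c h 0) (arc_energy c h n)"
    using assms(3) by (rule convex_seq_le[of "arc_energy c h", OF arc_energy_convex[OF assms(1,2)]])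
  then show ?thesis
    using arc_energy_nonneg[OF assms(1,2), of 0] arc_energy_nonneg[OF assms(1,2), of n]
    by (auto simp: sobolev_norm_def max_def split: if_splits)
qed

lemma sobolev_norm_nonneg:
  "c \<in> Imm \<Longrightarrow> h \<in> smooth_circle \<Longrightarrow> 0 \<le> sobolev_norm n c h"
  by (simp add: sobolev_norm_def arc_energy_nonneg)

lemma sqrt_arc_energy_le:
  assumes "c \<in> Imm" "h \<in> smooth_circle" "i \<le> n"
  shows "sqrt (curve_length c * arc_energy c h i) \<le> sqrt (curve_length c) * sobolev_norm n c h"
  using arc_energy_le[OF assms] sobolev_norm_nonneg[OF assms(1,2)] curve_length_pos[OF assms(1)]
  by (simp add: real_sqrt_mult real_le_lsqrt)

text \<open>An arc length derivative has mean zero, hence it is bounded by its total variation.\<close>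

lemma norm_arc_deriv_le:
  assumes c: "c \<in> Imm" and h: "h \<in> smooth_circle" and \<theta>: "\<theta> \<in> {0..2 * pi}" and i: "1 \<le> i" "i < n"
  shows "norm ((arc_deriv c ^^ i) h \<theta>) \<le> sqrt (curve_length c) * sobolev_norm n c h"
proof -
  let ?D = "\<lambda>i. (arc_deriv c ^^ i) h"
  let ?g = "speed c"
  note cont = continuous_on_speed[OF c] continuous_on_arc_deriv[OF c h]
  have p: "0 \<le> ?g \<theta>" for \<theta> by (simp add: speed_def)
  define M where "M = integral {0..2 * pi} (\<lambda>\<theta>. ?g \<theta> * norm (?D (Suc i) \<theta>))"
  have M: "norm (?D i b - ?D i a) \<le> M" if "0 \<le> a" "a \<le> b" "b \<le> 2 * pi" for a b
  proof -
    have "?D i b - ?D i a = integral {a..b} (\<lambda>\<theta>. ?g \<theta> *\<^sub>R ?D (Suc i) \<theta>)"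
      using integral_arc_deriv_eq[OF c h that(2), of i, THEN integral_unique] by simp
    also have "norm \<dots> \<le> integral {a..b} (\<lambda>\<theta>. ?g \<theta> * norm (?D (Suc i) \<theta>))"
      by (intro integral_norm_bound_integral integrable_continuous_real continuous_intros cont)
         (simp add: p del: funpow.simps)
    also have "\<dots> \<le> M"
      unfolding M_def
      by (intro integral_subset_le integrable_continuous_real continuous_intros cont)
         (use that p in \<open>auto simp del: funpow.simps\<close>)
    finally show ?thesis .
  qed
  have M': "norm (?D i \<theta> - ?D i \<phi>) \<le> M" if "\<phi> \<in> {0..2 * pi}" for \<phi>
    using M[of \<phi> \<theta>] M[of \<theta> \<phi>] that \<theta> by (cases "\<phi> \<le> \<theta>") (auto simp: norm_minus_commute)
  obtain k where k: "i = Suc k" using i(1) by (cases i) auto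
  have "?D k (2 * pi) = ?D k 0"
    using arc_deriv_periodic[OF c, of h k] h
    by (auto simp: smooth_circle_def periodic_2pi_def dest: spec[of _ 0])
  then have mean: "integral {0..2 * pi} (\<lambda>\<phi>. ?g \<phi> *\<^sub>R ?D i \<phi>) = 0"
    using integral_arc_deriv_eq[OF c h, of 0 "2 * pi" k, THEN integral_unique] by (simp add: k)
  have "curve_length c *\<^sub>R ?D i \<theta> = integral {0..2 * pi} (\<lambda>\<phi>. ?g \<phi> *\<^sub>R ?D i \<theta>)"
    unfolding curve_length_def
    using integrable_integral[OF integrable_continuous_real[OF cont(1)], THEN has_integral_scaleR_left, THEN integral_unique] by metis
  also have "\<dots> = integral {0..2 * pi} (\<lambda>\<phi>. ?g \<phi> *\<^sub>R (?D i \<theta> - ?D i \<phi>))"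
    unfolding scaleR_diff_right
    by (subst integral_diff) (auto intro!: integrable_continuous_real continuous_intros cont simp: mean simp del: funpow.simps)
  also have "norm \<dots> \<le> integral {0..2 * pi} (\<lambda>\<phi>. ?g \<phi> * M)"
    by (intro integral_norm_bound_integral integrable_continuous_real continuous_intros cont)
       (use M' p in \<open>auto intro!: mult_left_mono\<close>)
  also have "\<dots> = curve_length c * M" by (simp add: curve_length_def)
  finally have "norm (?D i \<theta>) \<le> M"
    using curve_length_pos[OF c] by simp
  also have "\<dots> \<le> sqrt (curve_length c * arc_energy c h (Suc i))"
    unfolding M_def by (rule integral_norm_arc_deriv_le[OF c h])
  also have "\<dots> \<le> sqrt (curve_length c) * sobolev_norm n c h"
    using i by (intro sqrt_arc_energy_le c h) simp
  finally show ?thesis .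
qed

section \<open>Estimates along a path\<close>

definition Imm_path :: "(real \<Rightarrow> real \<Rightarrow> real^2) \<Rightarrow> bool" where
  "Imm_path c \<longleftrightarrow> smooth_path {0..1} c \<and> (\<forall>t\<in>{0..1}. c t \<in> Imm)"

definition path_speed :: "nat \<Rightarrow> (real \<Rightarrow> real \<Rightarrow> real^2) \<Rightarrow> real \<Rightarrow> real" where
  "path_speed n c t = sobolev_norm n (c t) (path_velocity c t)"

text \<open>Joint continuity on the closed strip is needed in three forms: on rectangles for
  integrals over the circle, on lines for Gronwall, and with exchanged variables for integrals over
  \<open>t\<close> that depend on \<open>\<theta>\<close>.\<close>

lemma continuous_on_strip:
  assumes "continuous_on ({0..1} \<times> UNIV) (\<lambda>(t, \<theta>). f t \<theta>)"
  shows "continuous_on ({0..1} \<times> S) (\<lambda>(t, \<theta>). f t \<theta>)"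
    and "T \<subseteq> {0..1} \<Longrightarrow> continuous_on T (\<lambda>t. f t \<theta>)"
    and "T \<subseteq> {0..1} \<Longrightarrow> continuous_on (S \<times> T) (\<lambda>(\<theta>, t). f t \<theta>)"
proof -
  show "continuous_on ({0..1} \<times> S) (\<lambda>(t, \<theta>). f t \<theta>)"
    by (rule continuous_on_subset[OF assms]) auto
  show "continuous_on T (\<lambda>t. f t \<theta>)" if "T \<subseteq> {0..1}"
    using continuous_on_compose2[OF assms, of T "\<lambda>t. (t, \<theta>)"] that
    by (auto simp: image_subset_iff continuous_on_Pair subset_eq)
  show "continuous_on (S \<times> T) (\<lambda>(\<theta>, t). f t \<theta>)" if "T \<subseteq> {0..1}"
  proof -
    have sw: "(\<lambda>x. (snd x, fst x)) ` (S \<times> T) \<subseteq> {0..1} \<times> UNIV" using that by auto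
    show ?thesis
      using continuous_on_compose2[OF assms _ sw]
      by (simp add: case_prod_unfold continuous_on_Pair continuous_on_fst continuous_on_snd)
  qed
qed

context
  fixes c :: "real \<Rightarrow> real \<Rightarrow> real^2"
  assumes path: "Imm_path c"
begin

lemma path_ImmD:
  "smooth_path {0..1} c" "smooth_path {0..1} (path_velocity c)"
  "t \<in> {0..1} \<Longrightarrow> c t \<in> Imm" "t \<in> {0..1} \<Longrightarrow> path_velocity c t \<in> smooth_circle"
  using path smooth_path_velocity(1) smooth_path_smooth_circle unfolding Imm_path_def by blast+

lemma path_cont_arc_deriv:
  "continuous_on ({0..1} \<times> UNIV) (\<lambda>(t, \<theta>). (arc_deriv (c t) ^^ i) (path_velocity c t) \<theta>)"
  using arc_deriv_continuous_on[OF path_ImmD(1,2)] path_ImmD(3) .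

lemma path_cont_speed: "continuous_on ({0..1} \<times> UNIV) (\<lambda>(t, \<theta>). speed (c t) \<theta>)"
  using smooth_path_continuous_on[OF path_ImmD(1), of 1]
  by (auto simp: speed_def case_prod_unfold intro!: continuous_intros)

lemma path_cont_velocity:
  "continuous_on ({0..1} \<times> UNIV) (\<lambda>(t, \<theta>). (dtheta ^^ i) (path_velocity c t) \<theta>)"
  by (rule smooth_path_continuous_on[OF path_ImmD(2)])

lemma path_cont_deriv: "continuous_on ({0..1} \<times> UNIV) (\<lambda>(t, \<theta>). (dtheta ^^ i) (c t) \<theta>)"
  by (rule smooth_path_continuous_on[OF path_ImmD(1)])

lemma continuous_on_path_speed: "continuous_on {0..1} (path_speed n c)"
proof -
  have "continuous_on {0..1} (\<lambda>t. arc_energy (c t) (path_velocity c t) i)" for i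
  proof -
    have "continuous_on ({0..1} \<times> cbox 0 (2 * pi))
        (\<lambda>(t, \<theta>). (norm ((arc_deriv (c t) ^^ i) (path_velocity c t) \<theta>))\<^sup>2 * speed (c t) \<theta>)"
      using continuous_on_strip(1)[OF path_cont_arc_deriv] continuous_on_strip(1)[OF path_cont_speed]
      by (auto simp: case_prod_unfold intro!: continuous_intros)
    from integral_continuous_on_param[OF this] show ?thesis by (simp add: arc_energy_def)
  qed
  then show ?thesis unfolding path_speed_def sobolev_norm_def by (intro continuous_intros)
qed

lemma path_speed_nonneg: "t \<in> {0..1} \<Longrightarrow> 0 \<le> path_speed n c t"
  by (simp add: path_speed_def sobolev_norm_nonneg path_ImmD)

text \<open>The symmetry of mixed derivatives is obtained in integrated form: the fundamental
  theorem gives order \<open>0\<close>, and each further order follows by differentiating both sides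
  in \<open>\<theta>\<close> under the integral and comparing derivatives.\<close>

lemma dtheta_path_eq_integral:
  assumes "t \<in> {0..1}"
  shows "((\<lambda>s. (dtheta ^^ i) (path_velocity c s) \<theta>) has_integral
    ((dtheta ^^ i) (c t) \<theta> - (dtheta ^^ i) (c 0) \<theta>)) {0..t}"
proof -
  have sub: "{0..t} \<subseteq> {0..1}" using assms by auto
  have "(dtheta ^^ i) (c t) \<theta> - (dtheta ^^ i) (c 0) \<theta> =
      integral {0..t} (\<lambda>s. (dtheta ^^ i) (path_velocity c s) \<theta>)" for \<theta>
  proof (induction i arbitrary: \<theta>)
    case 0
    have "((\<lambda>s. path_velocity c s \<theta>) has_integral c t \<theta> - c 0 \<theta>) {0..t}"
      using assms sub
      by (intro fundamental_theorem_of_calculus)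
         (auto intro!: has_vector_derivative_within_subset[OF smooth_path_velocity(2)[OF path_ImmD(1)]])
    then show ?case by (simp add: integral_unique)
  next
    case (Suc i)
    have "((\<lambda>\<theta>. (dtheta ^^ i) (c t) \<theta> - (dtheta ^^ i) (c 0) \<theta>) has_vector_derivative
        (dtheta ^^ Suc i) (c t) \<theta> - (dtheta ^^ Suc i) (c 0) \<theta>) (at \<theta>)"
      using assms by (intro has_vector_derivative_diff has_dtheta_funpow ImmD path_ImmD) auto
    moreover have "((\<lambda>\<theta>. integral (cbox 0 t) (\<lambda>s. (dtheta ^^ i) (path_velocity c s) \<theta>)) has_vector_derivative
        integral (cbox 0 t) (\<lambda>s. (dtheta ^^ Suc i) (path_velocity c s) \<theta>)) (at \<theta> within UNIV)"
    proof (rule leibniz_rule_vector_derivative)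
      fix \<theta> s assume "s \<in> cbox 0 t"
      then have "path_velocity c s \<in> smooth_circle" using sub by (intro path_ImmD) auto
      then show "((dtheta ^^ i) (path_velocity c s) has_vector_derivative
          (dtheta ^^ Suc i) (path_velocity c s) \<theta>) (at \<theta> within UNIV)"
        by (simp only: has_dtheta_funpow smooth_circle_def mem_Collect_eq)
    next
      fix \<theta>
      show "(\<lambda>s. (dtheta ^^ i) (path_velocity c s) \<theta>) integrable_on cbox 0 t"
        using continuous_on_strip(2)[OF path_cont_velocity[of i] sub]
        by (auto intro: integrable_continuous_real)
    next
      show "continuous_on (UNIV \<times> cbox 0 t) (\<lambda>(\<theta>, s). (dtheta ^^ Suc i) (path_velocity c s) \<theta>)"
        using continuous_on_strip(3)[OF path_cont_velocity[of "Suc i"], of "cbox 0 t" UNIV] sub by (simp del: funpow.simps)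
    qed auto
    ultimately show ?case unfolding Suc by (auto dest: vector_derivative_unique_at simp del: funpow.simps)
  qed
  moreover have "(\<lambda>s. (dtheta ^^ i) (path_velocity c s) \<theta>) integrable_on {0..t}"
    by (intro integrable_continuous_real continuous_on_strip(2)[OF path_cont_velocity sub])
  ultimately show ?thesis by (simp add: has_integral_iff)
qed

lemma norm_dtheta_path_diff_le:
  assumes "t \<in> {0..1}" "b integrable_on {0..t}"
    "\<And>s. s \<in> {0..t} \<Longrightarrow> norm ((dtheta ^^ i) (path_velocity c s) \<theta>) \<le> b s"
  shows "norm ((dtheta ^^ i) (c t) \<theta> - (dtheta ^^ i) (c 0) \<theta>) \<le> integral {0..t} b"
  unfolding integral_unique[OF dtheta_path_eq_integral[OF assms(1)], symmetric]
  by (intro integral_norm_bound_integral assms has_integral_integrable[OF dtheta_path_eq_integral])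

text \<open>Gronwall's inequality for \<open>1 + |\<partial>_\<theta>^i c|\<close>, where the
  summand \<open>1\<close> makes the bound homogeneous. The forcing \<open>p\<close> enters only
  through its integral over the whole time interval; at top order that integral is later handled in
  \<open>L^2(d\<theta>)\<close>.\<close>

lemma dtheta_path_gronwall:
  assumes b: "\<And>t. t \<in> {0..1} \<Longrightarrow> norm ((dtheta ^^ i) (path_velocity c t) \<theta>) \<le>
      p t + e t * (1 + norm ((dtheta ^^ i) (c t) \<theta>))"
    and e: "continuous_on {0..1} e" "\<And>t. t \<in> {0..1} \<Longrightarrow> 0 \<le> e t"
    and p: "continuous_on {0..1} p" "\<And>t. t \<in> {0..1} \<Longrightarrow> 0 \<le> p t"
    and t: "t \<in> {0..1}"
  shows "1 + norm ((dtheta ^^ i) (c t) \<theta>) \<le>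
    (1 + norm ((dtheta ^^ i) (c 0) \<theta>) + integral {0..1} p) * exp (integral {0..1} e)"
proof -
  let ?y = "\<lambda>t. 1 + norm ((dtheta ^^ i) (c t) \<theta>)"
  have y: "continuous_on {0..1} ?y"
    by (intro continuous_intros continuous_on_strip(2)[OF path_cont_deriv]) auto
  have ip: "integral {0..t} p \<le> integral {0..1} p" if "t \<in> {0..1}" for t
    by (rule integral_subset_le)
       (use that p in \<open>auto intro!: integrable_continuous_real intro: continuous_on_subset\<close>)
  have ip0: "0 \<le> integral {0..1} p" by (intro integral_nonneg integrable_continuous_real p)
  show ?thesis
  proof (rule gronwall[OF y e _ _ t])
    show "0 \<le> 1 + norm ((dtheta ^^ i) (c 0) \<theta>) + integral {0..1} p" using ip0 by (simp add: add_nonneg_nonneg)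
    fix t :: real assume t: "t \<in> {0..1}"
    then have sub: "{0..t} \<subseteq> {0..1}" by auto
    have int: "p integrable_on {0..t}" "(\<lambda>s. e s * ?y s) integrable_on {0..t}"
      by (intro integrable_continuous_real continuous_intros continuous_on_subset[OF _ sub] p e y)+
    have "norm ((dtheta ^^ i) (c t) \<theta> - (dtheta ^^ i) (c 0) \<theta>) \<le> integral {0..t} (\<lambda>s. p s + e s * ?y s)"
      using t sub by (intro norm_dtheta_path_diff_le integrable_add int b) auto
    also have "\<dots> = integral {0..t} p + integral {0..t} (\<lambda>s. e s * ?y s)"
      by (rule integral_add[OF int])
    finally show "?y t \<le> 1 + norm ((dtheta ^^ i) (c 0) \<theta>) + integral {0..1} p + integral {0..t} (\<lambda>s. e s * ?y s)"
      using ip[OF t] norm_triangle_sub[of "(dtheta ^^ i) (c t) \<theta>" "(dtheta ^^ i) (c 0) \<theta>"] by linarith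
  qed
qed

text \<open>The growth of the length is at most the integral of
  \<open>|\<partial>_\<theta> h| d\<theta> = |D_s h| ds\<close>, which by Cauchy-Schwarz is at most
  the root of the length times the path speed. Everything is done in integrated form by exchanging
  the integrals over \<open>s\<close> and \<open>\<theta>\<close>.\<close>

lemma curve_length_path_le:
  assumes n: "1 \<le> n" and t: "t \<in> {0..1}"
  shows "curve_length (c t) \<le> (1 + curve_length (c 0)) * exp (integral {0..1} (path_speed n c))"
proof -
  let ?y = "\<lambda>t. 1 + curve_length (c t)"
  let ?h = "\<lambda>t. (dtheta ^^ 1) (path_velocity c t)"
  have y: "continuous_on {0..1} ?y"
    using integral_continuous_on_param[of "{0..1}" 0 "2 * pi" "\<lambda>t. speed (c t)"] continuous_on_strip(1)[OF path_cont_speed]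
    by (auto simp: curve_length_def[abs_def] intro!: continuous_intros)
  have l0: "0 \<le> curve_length (c 0)" using curve_length_pos path_ImmD(3)[of 0] by (simp add: less_imp_le)
  have "?y t \<le> (1 + curve_length (c 0)) * exp (integral {0..1} (path_speed n c))"
  proof (rule gronwall[OF y continuous_on_path_speed path_speed_nonneg _ _ t])
    show "0 \<le> 1 + curve_length (c 0)" using l0 by simp
    fix t :: real assume t: "t \<in> {0..1}"
    then have sub: "{0..t} \<subseteq> {0..1}" by auto
    have ch: "continuous_on ({0..t} \<times> {0..2 * pi}) (\<lambda>(s, \<theta>). norm (?h s \<theta>))"
      by (rule continuous_on_subset[of "{0..1} \<times> UNIV"])
         (use sub path_cont_velocity[of 1] in \<open>auto simp: case_prod_unfold intro!: continuous_intros simp del: funpow.simps\<close>)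
    have ch': "continuous_on ({0..2 * pi} \<times> {0..t}) (\<lambda>(\<theta>, s). norm (?h s \<theta>))"
      using continuous_on_strip(3)[OF path_cont_velocity[of 1] sub, of "{0..2 * pi}"]
      by (auto simp: case_prod_unfold intro!: continuous_intros)
    have c1: "continuous_on {0..2 * pi} (\<lambda>\<theta>. integral {0..t} (\<lambda>s. norm (?h s \<theta>)))"
      using integral_continuous_on_param[of "{0..2 * pi}" 0 t "\<lambda>\<theta> s. norm (?h s \<theta>)"] ch' by simp
    have c2: "continuous_on {0..t} (\<lambda>s. integral {0..2 * pi} (\<lambda>\<theta>. norm (?h s \<theta>)))"
      using integral_continuous_on_param[of "{0..t}" 0 "2 * pi" "\<lambda>s \<theta>. norm (?h s \<theta>)"] ch by simp
    have c0: "continuous_on {0..2 * pi} (speed (c s))" if "s \<in> {0..1}" for s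
      by (rule continuous_on_speed[OF path_ImmD(3)[OF that]])
    have point: "speed (c t) \<theta> \<le> speed (c 0) \<theta> + integral {0..t} (\<lambda>s. norm (?h s \<theta>))" for \<theta>
    proof -
      have "norm ((dtheta ^^ 1) (c t) \<theta> - (dtheta ^^ 1) (c 0) \<theta>) \<le> integral {0..t} (\<lambda>s. norm (?h s \<theta>))"
        by (rule norm_dtheta_path_diff_le[OF t])
           (auto intro!: integrable_continuous_real continuous_intros continuous_on_strip(2)[OF path_cont_velocity sub] simp del: funpow.simps)
      then show ?thesis
        using norm_triangle_sub[of "dtheta (c t) \<theta>" "dtheta (c 0) \<theta>"] by (simp add: speed_def)
    qed
    have "curve_length (c t) \<le> integral {0..2 * pi} (\<lambda>\<theta>. speed (c 0) \<theta> + integral {0..t} (\<lambda>s. norm (?h s \<theta>)))"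
      unfolding curve_length_def
      by (intro integral_le integrable_continuous_real continuous_intros c0 c1 point) (use t in auto)
    also have "\<dots> = curve_length (c 0) + integral {0..2 * pi} (\<lambda>\<theta>. integral {0..t} (\<lambda>s. norm (?h s \<theta>)))"
      unfolding curve_length_def
      by (intro integral_add integrable_continuous_real continuous_intros c0 c1) auto
    also have "integral {0..2 * pi} (\<lambda>\<theta>. integral {0..t} (\<lambda>s. norm (?h s \<theta>))) =
        integral {0..t} (\<lambda>s. integral {0..2 * pi} (\<lambda>\<theta>. norm (?h s \<theta>)))"
      using integral_swap_continuous[of 0 0 "2 * pi" t "\<lambda>\<theta> s. norm (?h s \<theta>)"] ch'
      by (simp add: cbox_Pair_eq)
    also have "\<dots> \<le> integral {0..t} (\<lambda>s. path_speed n c s * ?y s)"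
    proof (rule integral_le)
      show "(\<lambda>s. integral {0..2 * pi} (\<lambda>\<theta>. norm (?h s \<theta>))) integrable_on {0..t}"
        by (rule integrable_continuous_real[OF c2])
      show "(\<lambda>s. path_speed n c s * ?y s) integrable_on {0..t}"
        by (intro integrable_continuous_real continuous_on_mult continuous_on_subset[OF _ sub] y continuous_on_path_speed)
      fix s assume "s \<in> {0..t}"
      then have s: "s \<in> {0..1}" using sub by auto
      note I = path_ImmD(3)[OF s] path_ImmD(4)[OF s]
      have "integral {0..2 * pi} (\<lambda>\<theta>. norm (?h s \<theta>)) =
          integral {0..2 * pi} (\<lambda>\<theta>. speed (c s) \<theta> * norm ((arc_deriv (c s) ^^ 1) (path_velocity c s) \<theta>))"
        using ImmD(3)[OF I(1)] by (intro integral_cong) (simp add: arc_deriv_def less_imp_neq[symmetric] less_imp_le)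
      also have "\<dots> \<le> sqrt (curve_length (c s) * arc_energy (c s) (path_velocity c s) 1)"
        by (rule integral_norm_arc_deriv_le[OF I])
      also have "\<dots> \<le> sqrt (curve_length (c s)) * path_speed n c s"
        unfolding path_speed_def by (rule sqrt_arc_energy_le[OF I n])
      \<comment> \<open>The bound \<open>sqrt x \<le> 1 + x\<close> makes the inequality linear, as
        Gronwall requires.\<close>
      also have "\<dots> \<le> ?y s * path_speed n c s"
        using curve_length_pos[OF I(1)] path_speed_nonneg[OF s]
        by (intro mult_right_mono real_le_lsqrt) (auto simp: power2_eq_square algebra_simps)
      finally show "integral {0..2 * pi} (\<lambda>\<theta>. norm (?h s \<theta>)) \<le> path_speed n c s * ?y s"
        by (simp only: mult.commute)
    qed
    finally show "?y t \<le> 1 + curve_length (c 0) + integral {0..t} (\<lambda>s. path_speed n c s * ?y s)" by simp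
  qed
  then show ?thesis by simp
qed

text \<open>The time derivative of \<open>ln |c'|\<close> is
  \<open>(c' \<bullet> \<partial>_\<theta> h) / |c'|^2\<close>, whose absolute value is at most
  \<open>|D_s h|\<close>. Passing to the logarithm yields upper and lower bounds for the speed
  together.\<close>

lemma ln_speed_path_le:
  assumes t: "t \<in> {0..1}" and e: "continuous_on {0..1} e"
    and le: "\<And>s. s \<in> {0..1} \<Longrightarrow> norm (arc_deriv (c s) (path_velocity c s) \<theta>) \<le> e s"
  shows "\<bar>ln (speed (c t) \<theta>) - ln (speed (c 0) \<theta>)\<bar> \<le> integral {0..1} e"
proof -
  let ?h = "\<lambda>t. dtheta (path_velocity c t) \<theta>"
  let ?c' = "\<lambda>t. dtheta (c t) \<theta>"
  let ?d = "\<lambda>s. (?c' s \<bullet> ?h s) / (speed (c s) \<theta>)\<^sup>2"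
  have sub: "{0..t} \<subseteq> {0..1}" using t by auto
  have ch: "continuous_on {0..1} ?h" using continuous_on_strip(2)[OF path_cont_velocity[of 1], of "{0..1}"] by simp
  have cd: "continuous_on {0..1} ?c'" using continuous_on_strip(2)[OF path_cont_deriv[of 1], of "{0..1}"] by simp
  have cs: "continuous_on {0..1} (\<lambda>s. speed (c s) \<theta>)" unfolding speed_def by (intro continuous_intros cd)
  have pos: "0 < speed (c s) \<theta>" if "s \<in> {0..1}" for s by (rule ImmD(3)[OF path_ImmD(3)[OF that]])
  \<comment> \<open>The time derivative of \<open>c'\<close> is read off from its integral
    representation, so no further exchange of derivatives is involved.\<close>
  have d1: "(?c' has_vector_derivative ?h s) (at s within {0..1})" if s: "s \<in> {0..1}" for s
  proof (rule has_vector_derivative_transform[OF s])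
    show "((\<lambda>t. ?c' 0 + integral {0..t} ?h) has_vector_derivative ?h s) (at s within {0..1})"
      using has_vector_derivative_add[OF has_vector_derivative_const integral_has_vector_derivative[OF ch s]] by simp
    show "?c' t = ?c' 0 + integral {0..t} ?h" if "t \<in> {0..1}" for t
      using integral_unique[OF dtheta_path_eq_integral[OF that, of 1 \<theta>]] by simp
  qed
  have d2: "((\<lambda>s. ln (speed (c s) \<theta>)) has_vector_derivative ?d s) (at s within {0..1})" if s: "s \<in> {0..1}" for s
  proof -
    have "((\<lambda>s. norm (?c' s)) has_derivative (\<lambda>r. (r *\<^sub>R ?h s) \<bullet> sgn (?c' s))) (at s within {0..1})"
      using has_derivative_compose[OF d1[OF s, unfolded has_vector_derivative_def] has_derivative_norm[of "?c' s"]] pos[OF s]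
      by (auto simp: speed_def inner_commute)
    then have "((\<lambda>s. speed (c s) \<theta>) has_real_derivative (?c' s \<bullet> ?h s) / speed (c s) \<theta>) (at s within {0..1})"
      unfolding has_field_derivative_def speed_def
      by (rule back_subst[of "\<lambda>f. (_ has_derivative f) _"])
         (auto simp: sgn_div_norm fun_eq_iff inner_commute field_simps)
    from DERIV_chain2[OF DERIV_ln[OF pos[OF s]] this]
    show ?thesis unfolding has_real_derivative_iff_has_vector_derivative
      by (simp add: field_simps power2_eq_square)
  qed
  have int: "(?d has_integral ln (speed (c t) \<theta>) - ln (speed (c 0) \<theta>)) {0..t}"
    using t sub by (intro fundamental_theorem_of_calculus has_vector_derivative_within_subset[OF d2]) auto
  have "norm (integral {0..t} ?d) \<le> integral {0..t} e"
  proof (rule integral_norm_bound_integral)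
    show "?d integrable_on {0..t}" using int by (rule has_integral_integrable)
    show "e integrable_on {0..t}" by (intro integrable_continuous_real continuous_on_subset[OF e sub])
    fix s assume "s \<in> {0..t}"
    then have s: "s \<in> {0..1}" using sub by auto
    have "norm (?d s) \<le> (norm (?c' s) * norm (?h s)) / (speed (c s) \<theta>)\<^sup>2"
      using Cauchy_Schwarz_ineq2[of "?c' s" "?h s"] by (simp add: divide_right_mono)
    also have "\<dots> = norm (arc_deriv (c s) (path_velocity c s) \<theta>)"
      using pos[OF s] by (simp add: arc_deriv_def power2_eq_square flip: speed_def)
    finally show "norm (?d s) \<le> e s" using le[OF s] by simp
  qed
  also have "integral {0..t} e \<le> integral {0..1} e"
    by (rule integral_subset_le)
       (use sub e order_trans[OF norm_ge_zero le] in \<open>auto intro!: integrable_continuous_real intro: continuous_on_subset\<close>)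
  finally show ?thesis by (simp add: integral_unique[OF int])
qed

end

lemma jet_bound_mono: "jet_bound m K c \<theta> \<Longrightarrow> 0 < K \<Longrightarrow> K \<le> K' \<Longrightarrow> jet_bound m K' c \<theta>"
  unfolding jet_bound_def by (meson divide_left_mono order_trans zero_le_one mult_pos_pos less_le_trans)

lemma jet_bound_speed:
  "jet_bound m K c \<theta> \<Longrightarrow> 1 \<le> m \<Longrightarrow> 1 / K \<le> speed c \<theta> \<and> speed c \<theta> \<le> K"
  by (auto simp: jet_bound_def speed_def dest!: bspec[of _ _ 1])

section \<open>Uniform bounds on classes of paths\<close>

text \<open>The class over which the constants below are uniform: they may depend on
  \<open>n\<close>, \<open>K\<close> and \<open>L\<close>, but not on the path, the time or the
  point. Only the start curve is assumed to have bounded jets.\<close>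

definition bounded_paths :: "nat \<Rightarrow> real \<Rightarrow> real \<Rightarrow> (real \<Rightarrow> real \<Rightarrow> real^2) set" where
  "bounded_paths n K L = {c. Imm_path c \<and> (\<forall>\<theta>\<in>{0..2 * pi}. jet_bound (n - 1) K (c 0) \<theta>) \<and>
     integral {0..1} (path_speed n c) \<le> L}"

lemma integral_path_speed_nonneg: "Imm_path c \<Longrightarrow> 0 \<le> integral {0..1} (path_speed n c)"
  by (intro integral_nonneg integrable_continuous_real continuous_on_path_speed path_speed_nonneg)

lemma norm_arc_deriv_path_le:
  assumes n: "2 \<le> n" and K: "0 < K"
  obtains M where "0 \<le> M"
    "\<And>c t \<theta> i. c \<in> bounded_paths n K L \<Longrightarrow> t \<in> {0..1} \<Longrightarrow> \<theta> \<in> {0..2 * pi} \<Longrightarrow> 1 \<le> i \<Longrightarrow> i < n \<Longrightarrow>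
      norm ((arc_deriv (c t) ^^ i) (path_velocity c t) \<theta>) \<le> M * path_speed n c t"
\<comment> \<open>The start curve has speed at most \<open>K\<close>, hence length at most
  \<open>2 * pi * K\<close>; the rest is the growth bound of the length along the path.\<close>
proof (rule that[of "sqrt ((1 + K * (2 * pi)) * exp L)"])
  fix c i and t \<theta> :: real
  assume c: "c \<in> bounded_paths n K L" and t: "t \<in> {0..1}" and *: "\<theta> \<in> {0..2 * pi}" "1 \<le> i" "i < n"
  then have path: "Imm_path c" and I: "integral {0..1} (path_speed n c) \<le> L" by (auto simp: bounded_paths_def)
  have sp: "speed (c 0) \<theta> \<le> K" if "\<theta> \<in> {0..2 * pi}" for \<theta>
    using c that n jet_bound_speed[of "n - 1" K "c 0" \<theta>] by (auto simp: bounded_paths_def)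
  have "curve_length (c 0) \<le> integral {0..2 * pi} (\<lambda>_. K)"
    unfolding curve_length_def
    by (intro integral_le integrable_continuous_real continuous_intros continuous_on_speed sp path_ImmD(3)[OF path]) auto
  then have l0: "curve_length (c 0) \<le> K * (2 * pi)" by (simp add: mult.commute)
  have "curve_length (c t) \<le> (1 + curve_length (c 0)) * exp (integral {0..1} (path_speed n c))"
    using n by (intro curve_length_path_le[OF path _ t]) simp
  also have "\<dots> \<le> (1 + K * (2 * pi)) * exp L"
    using l0 K I by (intro mult_mono) (auto intro!: add_nonneg_nonneg)
  finally have l: "sqrt (curve_length (c t)) \<le> sqrt ((1 + K * (2 * pi)) * exp L)" by simp
  have "norm ((arc_deriv (c t) ^^ i) (path_velocity c t) \<theta>) \<le> sqrt (curve_length (c t)) * path_speed n c t"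
    unfolding path_speed_def using * by (intro norm_arc_deriv_le path_ImmD[OF path] t)
  also have "\<dots> \<le> sqrt ((1 + K * (2 * pi)) * exp L) * path_speed n c t"
    by (rule mult_right_mono[OF l path_speed_nonneg[OF path t]])
  finally show "norm ((arc_deriv (c t) ^^ i) (path_velocity c t) \<theta>) \<le> sqrt ((1 + K * (2 * pi)) * exp L) * path_speed n c t" .
qed (use K in \<open>auto intro!: mult_nonneg_nonneg add_nonneg_nonneg\<close>)

text \<open>Once the jet of order \<open>j\<close> is bounded, the velocity of
  \<open>\<partial>_\<theta>^(j+1) c\<close> is bounded linearly in this derivative itself, with a
  factor whose time integral is finite. Since \<open>Suc j < n\<close>, the remaining term
  \<open>D_s^(j+1) h\<close> still has a pointwise bound.\<close>

lemma jet_bound_path: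
  assumes n: "2 \<le> n" and K: "0 < K" and L: "0 \<le> L" and j: "1 \<le> j" "j < n"
  shows "\<exists>K'>0. \<forall>c\<in>bounded_paths n K L. \<forall>t\<in>{0..1}. \<forall>\<theta>\<in>{0..2 * pi}. jet_bound j K' (c t) \<theta>"
proof -
  obtain M where M: "0 \<le> M"
    "\<And>c t \<theta> i. c \<in> bounded_paths n K L \<Longrightarrow> t \<in> {0..1} \<Longrightarrow> \<theta> \<in> {0..2 * pi} \<Longrightarrow> 1 \<le> i \<Longrightarrow> i < n \<Longrightarrow>
      norm ((arc_deriv (c t) ^^ i) (path_velocity c t) \<theta>) \<le> M * path_speed n c t"
    by (rule norm_arc_deriv_path_le[OF n K, of L], rule that; assumption)
  show ?thesis
    using j
  proof (induction j rule: dec_induct)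
    case base
    \<comment> \<open>The logarithm of the speed changes by at most \<open>M * L\<close>, and
      initially the speed lies between \<open>1 / K\<close> and \<open>K\<close>.\<close>
    let ?K = "K * exp (M * L)"
    show ?case
    proof (intro exI[of _ ?K] conjI ballI)
      fix c and t \<theta> :: real assume c: "c \<in> bounded_paths n K L" and t: "t \<in> {0..1}" and \<theta>: "\<theta> \<in> {0..2 * pi::real}"
      then have path: "Imm_path c" and I: "integral {0..1} (path_speed n c) \<le> L"
        and b: "1 / K \<le> speed (c 0) \<theta>" "speed (c 0) \<theta> \<le> K"
        using n jet_bound_speed[of "n - 1" K "c 0" \<theta>] by (auto simp: bounded_paths_def)
      have pos: "0 < speed (c s) \<theta>" if "s \<in> {0..1}" for s by (rule ImmD(3)[OF path_ImmD(3)[OF path that]])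
      have "\<bar>ln (speed (c t) \<theta>) - ln (speed (c 0) \<theta>)\<bar> \<le> integral {0..1} (\<lambda>t. M * path_speed n c t)"
        using M(2)[OF c _ \<theta>, of _ 1] n
        by (intro ln_speed_path_le[OF path t] continuous_intros continuous_on_path_speed[OF path]) auto
      also have "\<dots> \<le> M * L" using mult_left_mono[OF I M(1)] by simp
      finally have d: "\<bar>ln (speed (c t) \<theta>) - ln (speed (c 0) \<theta>)\<bar> \<le> M * L" .
      define x where "x = ln (speed (c t) \<theta>) - ln (speed (c 0) \<theta>)"
      have eq: "speed (c t) \<theta> = speed (c 0) \<theta> * exp x"
        using pos[OF t] pos[of 0] by (simp add: exp_diff x_def)
      have u: "speed (c t) \<theta> \<le> ?K"
        unfolding eq using d b K by (intro mult_mono) (auto simp: x_def)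
      have l: "(1 / K) * exp (- (M * L)) \<le> speed (c t) \<theta>"
        unfolding eq using d b K pos[of 0] by (intro mult_mono) (auto simp: x_def)
      have "1 / ?K \<le> speed (c t) \<theta>" using l by (simp add: exp_minus field_simps)
      then show "jet_bound 1 ?K (c t) \<theta>" using u by (simp add: jet_bound_def speed_def)
    qed (use K in auto)
  next
    case (step j)
    then obtain K' where K': "K' > 0"
      "\<And>c t \<theta>. c \<in> bounded_paths n K L \<Longrightarrow> t \<in> {0..1} \<Longrightarrow> \<theta> \<in> {0..2 * pi} \<Longrightarrow> jet_bound j K' (c t) \<theta>" by auto
    obtain C where C: "C \<ge> 0"
      "\<And>c h \<theta> e. c \<in> Imm \<Longrightarrow> h \<in> smooth_circle \<Longrightarrow> jet_bound j K' c \<theta> \<Longrightarrow>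
        (\<forall>i\<in>{1..j}. norm ((arc_deriv c ^^ i) h \<theta>) \<le> e) \<Longrightarrow>
        norm ((dtheta ^^ Suc j) h \<theta>) \<le> C * (e * (1 + norm ((dtheta ^^ Suc j) c \<theta>)) + norm ((arc_deriv c ^^ Suc j) h \<theta>))"
      by (rule norm_dtheta_funpow_le[OF step(1) K'(1)], rule that; assumption)
    \<comment> \<open>The factor \<open>2\<close> arises because the term with
      \<open>D_s^(j+1) h\<close> is absorbed into the Gronwall term, using
      \<open>1 \<le> 1 + ?y\<close>.\<close>
    let ?B = "(1 + K) * exp (2 * C * M * L)"
    let ?K = "max K' ?B"
    show ?case
    proof (intro exI[of _ ?K] conjI ballI)
      fix c and t \<theta> :: real assume c: "c \<in> bounded_paths n K L" and t: "t \<in> {0..1}" and \<theta>: "\<theta> \<in> {0..2 * pi::real}"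
      then have path: "Imm_path c" and I: "integral {0..1} (path_speed n c) \<le> L"
        and b: "norm ((dtheta ^^ Suc j) (c 0) \<theta>) \<le> K"
        using step by (auto simp: bounded_paths_def jet_bound_def simp del: funpow.simps dest!: bspec[of _ _ \<theta>] bspec[of _ _ "Suc j"])
      have "1 + norm ((dtheta ^^ Suc j) (c t) \<theta>) \<le>
          (1 + norm ((dtheta ^^ Suc j) (c 0) \<theta>) + integral {0..1} (\<lambda>_::real. 0)) *
          exp (integral {0..1} (\<lambda>t. 2 * C * M * path_speed n c t))"
      proof (rule dtheta_path_gronwall[OF path _ _ _ _ _ t])
        fix t :: real assume t: "t \<in> {0..1}"
        let ?e = "M * path_speed n c t" and ?y = "norm ((dtheta ^^ Suc j) (c t) \<theta>)"
        have e0: "0 \<le> ?e" using M(1) path_speed_nonneg[OF path t] by simp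
        have "norm ((dtheta ^^ Suc j) (path_velocity c t) \<theta>) \<le>
            C * (?e * (1 + ?y) + norm ((arc_deriv (c t) ^^ Suc j) (path_velocity c t) \<theta>))"
          using step M(2)[OF c t \<theta>] by (intro C(2) path_ImmD[OF path] K'(2) c t \<theta>) auto
        also have "\<dots> \<le> C * (?e * (1 + ?y) + ?e * (1 + ?y))"
        proof (intro mult_left_mono add_left_mono C(1))
          have "norm ((arc_deriv (c t) ^^ Suc j) (path_velocity c t) \<theta>) \<le> ?e" using step by (intro M(2)[OF c t \<theta>]) auto
          also have "\<dots> \<le> ?e * (1 + ?y)" using e0 by (simp add: mult_le_cancel_left1)
          finally show "norm ((arc_deriv (c t) ^^ Suc j) (path_velocity c t) \<theta>) \<le> ?e * (1 + ?y)" .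
        qed
        finally show "norm ((dtheta ^^ Suc j) (path_velocity c t) \<theta>) \<le> 0 + 2 * C * M * path_speed n c t * (1 + ?y)"
          by (simp add: algebra_simps del: funpow.simps)
      qed (use M(1) C(1) path_speed_nonneg[OF path] in \<open>auto intro!: continuous_intros continuous_on_path_speed[OF path]\<close>)
      also have "\<dots> \<le> ?B"
        using b K M(1) C(1) mult_left_mono[OF I, of "2 * C * M"] by (intro mult_mono) auto
      finally have "norm ((dtheta ^^ Suc j) (c t) \<theta>) \<le> ?K" by linarith
      moreover have "jet_bound j ?K (c t) \<theta>"
        using jet_bound_mono[OF K'(2)[OF c t \<theta>] K'(1)] by simp
      ultimately show "jet_bound (Suc j) ?K (c t) \<theta>"
        unfolding jet_bound_def by (auto simp: le_Suc_eq simp del: funpow.simps)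
    qed (use K' in auto)
  qed
qed

lemma jet_bound_pathE:
  assumes "2 \<le> n" "0 < K" "0 \<le> L" "1 \<le> j" "j < n"
  obtains K' where "0 < K'"
    "\<And>c t \<theta>. c \<in> bounded_paths n K L \<Longrightarrow> t \<in> {0..1} \<Longrightarrow> \<theta> \<in> {0..2 * pi} \<Longrightarrow> jet_bound j K' (c t) \<theta>"
  using jet_bound_path[OF assms] by blast

text \<open>With all jets below order \<open>n\<close> already bounded, the affine coefficient is
  bounded too, and the velocity estimate becomes linear in the path speed alone.\<close>

lemma norm_dtheta_velocity_le:
  assumes n: "2 \<le> n" and K: "0 < K" and L: "0 \<le> L"
  obtains C where "0 \<le> C"
    "\<And>c t \<theta> i. c \<in> bounded_paths n K L \<Longrightarrow> t \<in> {0..1} \<Longrightarrow> \<theta> \<in> {0..2 * pi} \<Longrightarrow> i \<in> {1..n - 1} \<Longrightarrow>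
      norm ((dtheta ^^ i) (path_velocity c t) \<theta>) \<le> C * path_speed n c t"
proof -
  obtain M where M: "0 \<le> M"
    "\<And>c t \<theta> i. c \<in> bounded_paths n K L \<Longrightarrow> t \<in> {0..1} \<Longrightarrow> \<theta> \<in> {0..2 * pi} \<Longrightarrow> 1 \<le> i \<Longrightarrow> i < n \<Longrightarrow>
      norm ((arc_deriv (c t) ^^ i) (path_velocity c t) \<theta>) \<le> M * path_speed n c t"
    by (rule norm_arc_deriv_path_le[OF n K, of L], rule that; assumption)
  obtain K' where K': "K' > 0"
    "\<And>c t \<theta>. c \<in> bounded_paths n K L \<Longrightarrow> t \<in> {0..1} \<Longrightarrow> \<theta> \<in> {0..2 * pi} \<Longrightarrow> jet_bound (n - 1) K' (c t) \<theta>"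
    by (rule jet_bound_pathE[OF n K L, of "n - 1"]) (use n in auto)
  have "\<exists>C\<ge>0. \<forall>c\<in>bounded_paths n K L. \<forall>t\<in>{0..1}. \<forall>\<theta>\<in>{0..2 * pi}.
      norm ((dtheta ^^ i) (path_velocity c t) \<theta>) \<le> C * path_speed n c t" (is "\<exists>C. ?Q i C")
    if i: "i \<in> {1..n - 1}" for i
  proof (cases "i = 1")
    \<comment> \<open>Order \<open>1\<close> is separate, since \<open>norm_dtheta_funpow_le\<close>
      starts at order \<open>2\<close>; here \<open>\<partial>_\<theta> h\<close> is the speed times
      \<open>D_s h\<close>.\<close>
    case True
    show ?thesis
    proof (intro exI[of _ "K' * M"] conjI ballI)
      fix c and t \<theta> :: real assume c: "c \<in> bounded_paths n K L" and t: "t \<in> {0..1}" and \<theta>: "\<theta> \<in> {0..2 * pi::real}"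
      then have path: "Imm_path c" by (auto simp: bounded_paths_def)
      have "speed (c t) \<theta> \<le> K'" using jet_bound_speed[OF K'(2)[OF c t \<theta>]] n by auto
      then have "speed (c t) \<theta> * norm ((arc_deriv (c t) ^^ 1) (path_velocity c t) \<theta>) \<le> K' * (M * path_speed n c t)"
        using K'(1) n by (intro mult_mono M(2) c t \<theta>) auto
      then show "norm ((dtheta ^^ i) (path_velocity c t) \<theta>) \<le> K' * M * path_speed n c t"
        using ImmD(3)[OF path_ImmD(3)[OF path t], of \<theta>] by (simp add: True arc_deriv_def mult.assoc)
    qed (use K' M in auto)
  next
    case False
    then obtain j where j: "i = Suc j" "1 \<le> j" "Suc j < n" using i by (cases i) auto
    obtain C where C: "C \<ge> 0"
      "\<And>c h \<theta> e. c \<in> Imm \<Longrightarrow> h \<in> smooth_circle \<Longrightarrow> jet_bound j K' c \<theta> \<Longrightarrow>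
        (\<forall>i\<in>{1..j}. norm ((arc_deriv c ^^ i) h \<theta>) \<le> e) \<Longrightarrow>
        norm ((dtheta ^^ Suc j) h \<theta>) \<le> C * (e * (1 + norm ((dtheta ^^ Suc j) c \<theta>)) + norm ((arc_deriv c ^^ Suc j) h \<theta>))"
      by (rule norm_dtheta_funpow_le[OF j(2) K'(1)], rule that; assumption)
    show ?thesis
    proof (intro exI[of _ "C * M * (2 + K')"] conjI ballI)
      fix c and t \<theta> :: real assume c: "c \<in> bounded_paths n K L" and t: "t \<in> {0..1}" and \<theta>: "\<theta> \<in> {0..2 * pi::real}"
      then have path: "Imm_path c" by (auto simp: bounded_paths_def)
      have jb: "jet_bound j K' (c t) \<theta>" "norm ((dtheta ^^ Suc j) (c t) \<theta>) \<le> K'"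
        using K'(2)[OF c t \<theta>] j by (auto simp: jet_bound_def simp del: funpow.simps)
      let ?e = "M * path_speed n c t"
      have e0: "0 \<le> ?e" using M(1) path_speed_nonneg[OF path t] by simp
      have "norm ((dtheta ^^ Suc j) (path_velocity c t) \<theta>) \<le>
          C * (?e * (1 + norm ((dtheta ^^ Suc j) (c t) \<theta>)) + norm ((arc_deriv (c t) ^^ Suc j) (path_velocity c t) \<theta>))"
        using j M(2)[OF c t \<theta>] by (intro C(2) path_ImmD[OF path] jb c t \<theta>) auto
      also have "\<dots> \<le> C * (?e * (1 + K') + ?e)"
        using jb(2) j by (intro mult_left_mono add_mono C(1) e0 M(2) c t \<theta>) auto
      finally show "norm ((dtheta ^^ i) (path_velocity c t) \<theta>) \<le> C * M * (2 + K') * path_speed n c t"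
        by (simp add: j(1) algebra_simps del: funpow.simps)
    qed (use K' M C in auto)
  qed
  then have "\<forall>i\<in>{1..n - 1}. \<exists>C. ?Q i C" by blast
  from bchoice[OF this] obtain C where C: "\<forall>i\<in>{1..n - 1}. ?Q i (C i)" ..
  show ?thesis
  proof (rule that[of "\<Sum>i=1..n-1. C i"])
    show "0 \<le> (\<Sum>i=1..n-1. C i)" using C by (intro sum_nonneg) blast
    fix c i and t \<theta> :: real assume *: "c \<in> bounded_paths n K L" "t \<in> {0..1}" "\<theta> \<in> {0..2 * pi::real}" "i \<in> {1..n - 1}"
    then have path: "Imm_path c" by (auto simp: bounded_paths_def)
    have "norm ((dtheta ^^ i) (path_velocity c t) \<theta>) \<le> C i * path_speed n c t" using C * by blast
    also have "\<dots> \<le> (\<Sum>i=1..n-1. C i) * path_speed n c t"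
      using C *(4) by (intro mult_right_mono path_speed_nonneg[OF path *(2)] member_le_sum) auto
    finally show "norm ((dtheta ^^ i) (path_velocity c t) \<theta>) \<le> (\<Sum>i=1..n-1. C i) * path_speed n c t" .
  qed
qed

text \<open>Gronwall bounds the derivative of order \<open>n\<close> at all times in terms of its
  initial value and the time integral of \<open>|D_s^n h|\<close>, and this bound is put back into
  the velocity estimate. The outcome is linear in quantities that lie in
  \<open>L^2(d\<theta>)\<close>, and every term carries a factor that is small for short
  paths.\<close>

lemma norm_top_path_diff_le:
  assumes n: "2 \<le> n" and K: "0 < K" and L: "0 \<le> L"
  obtains C where "0 \<le> C"
    "\<And>c \<theta>. c \<in> bounded_paths n K L \<Longrightarrow> \<theta> \<in> {0..2 * pi} \<Longrightarrow>
      norm ((dtheta ^^ n) (c 1) \<theta> - (dtheta ^^ n) (c 0) \<theta>) \<le>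
        C * (integral {0..1} (\<lambda>t. norm ((arc_deriv (c t) ^^ n) (path_velocity c t) \<theta>)) +
          integral {0..1} (path_speed n c) * (1 + norm ((dtheta ^^ n) (c 0) \<theta>)))"
proof -
  obtain m where m: "n = Suc m" "1 \<le> m" using n by (cases n) auto
  obtain M where M: "0 \<le> M"
    "\<And>c t \<theta> i. c \<in> bounded_paths n K L \<Longrightarrow> t \<in> {0..1} \<Longrightarrow> \<theta> \<in> {0..2 * pi} \<Longrightarrow> 1 \<le> i \<Longrightarrow> i < n \<Longrightarrow>
      norm ((arc_deriv (c t) ^^ i) (path_velocity c t) \<theta>) \<le> M * path_speed n c t"
    by (rule norm_arc_deriv_path_le[OF n K, of L], rule that; assumption)
  obtain K' where K': "K' > 0"
    "\<And>c t \<theta>. c \<in> bounded_paths n K L \<Longrightarrow> t \<in> {0..1} \<Longrightarrow> \<theta> \<in> {0..2 * pi} \<Longrightarrow> jet_bound m K' (c t) \<theta>"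
    by (rule jet_bound_pathE[OF n K L, of m]) (use m in auto)
  obtain C where C: "C \<ge> 0"
    "\<And>c h \<theta> e. c \<in> Imm \<Longrightarrow> h \<in> smooth_circle \<Longrightarrow> jet_bound m K' c \<theta> \<Longrightarrow>
      (\<forall>i\<in>{1..m}. norm ((arc_deriv c ^^ i) h \<theta>) \<le> e) \<Longrightarrow>
      norm ((dtheta ^^ Suc m) h \<theta>) \<le> C * (e * (1 + norm ((dtheta ^^ Suc m) c \<theta>)) + norm ((arc_deriv c ^^ Suc m) h \<theta>))"
    by (rule norm_dtheta_funpow_le[OF m(2) K'(1)], rule that; assumption)
  define X where "X = exp (C * M * L)"
  have X: "0 \<le> X" by (simp add: X_def)
  show ?thesis
  proof (rule that[of "C * (1 + C * M * L * X) + C * M * X"])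
    show "0 \<le> C * (1 + C * M * L * X) + C * M * X" using C(1) M(1) L X by (auto intro!: add_nonneg_nonneg mult_nonneg_nonneg)
    fix c \<theta> assume c: "c \<in> bounded_paths n K L" and \<theta>: "\<theta> \<in> {0..2 * pi::real}"
    then have path: "Imm_path c" and I: "integral {0..1} (path_speed n c) \<le> L" by (auto simp: bounded_paths_def)
    let ?e = "path_speed n c" and ?q = "\<lambda>t. norm ((arc_deriv (c t) ^^ n) (path_velocity c t) \<theta>)"
    let ?y = "\<lambda>t. norm ((dtheta ^^ n) (c t) \<theta>)"
    define I where "I = integral {0..1} ?e"
    define Q where "Q = integral {0..1} ?q"
    have IL: "I \<le> L" "0 \<le> I" using I integral_path_speed_nonneg[OF path] by (auto simp: I_def)
    note ce = continuous_on_path_speed[OF path, of n]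
    have cq: "continuous_on {0..1} ?q"
      by (intro continuous_intros continuous_on_strip(2)[OF path_cont_arc_deriv[OF path]]) auto
    have Q: "0 \<le> Q" unfolding Q_def by (intro integral_nonneg integrable_continuous_real cq) auto
    have h: "norm ((dtheta ^^ n) (path_velocity c t) \<theta>) \<le> C * ?q t + C * M * ?e t * (1 + ?y t)" if t: "t \<in> {0..1}" for t
    proof -
      have "norm ((dtheta ^^ Suc m) (path_velocity c t) \<theta>) \<le>
          C * (M * ?e t * (1 + norm ((dtheta ^^ Suc m) (c t) \<theta>)) + norm ((arc_deriv (c t) ^^ Suc m) (path_velocity c t) \<theta>))"
        using m M(2)[OF c t \<theta>] by (intro C(2) path_ImmD[OF path] K'(2) c t \<theta>) auto
      then show ?thesis unfolding m(1) by (simp add: algebra_simps del: funpow.simps)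
    qed
    \<comment> \<open>The Gronwall bound at the fixed \<open>\<theta>\<close>: the forcing
      \<open>C * ?q\<close> contributes \<open>C * Q\<close>, and \<open>X\<close> bounds the
      exponential.\<close>
    define Y where "Y = (1 + ?y 0 + C * Q) * X"
    have y: "1 + ?y t \<le> Y" if t: "t \<in> {0..1}" for t
    proof -
      have "1 + ?y t \<le> (1 + ?y 0 + integral {0..1} (\<lambda>t. C * ?q t)) * exp (integral {0..1} (\<lambda>t. C * M * ?e t))"
        using C(1) M(1) path_speed_nonneg[OF path]
        by (intro dtheta_path_gronwall[OF path h] t continuous_intros cq ce) auto
      also have "\<dots> \<le> (1 + ?y 0 + C * Q) * X"
        unfolding X_def using C(1) M(1) Q IL(1) mult_left_mono[OF IL(1), of "C * M"]
        by (intro mult_mono) (auto simp: Q_def I_def)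
      finally show ?thesis by (simp add: Y_def)
    qed
    have "norm ((dtheta ^^ n) (c 1) \<theta> - (dtheta ^^ n) (c 0) \<theta>) \<le> integral {0..1} (\<lambda>t. C * ?q t + C * M * Y * ?e t)"
    proof (rule norm_dtheta_path_diff_le[OF path])
      show "(\<lambda>t. C * ?q t + C * M * Y * ?e t) integrable_on {0..1}"
        by (intro integrable_continuous_real continuous_intros cq ce)
      fix t :: real assume t: "t \<in> {0..1}"
      have "C * M * ?e t * (1 + ?y t) \<le> C * M * ?e t * Y"
        using C(1) M(1) path_speed_nonneg[OF path t] by (intro mult_left_mono y t) auto
      with h[OF t] show "norm ((dtheta ^^ n) (path_velocity c t) \<theta>) \<le> C * ?q t + C * M * Y * ?e t"
        by (simp only: mult_ac)
    qed simp
    also have "\<dots> = C * Q + C * M * Y * I"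
      unfolding Q_def I_def
      by (subst integral_add) (auto intro!: integrable_continuous_real continuous_intros cq ce)
    also have "\<dots> = C * Q + C * C * M * X * Q * I + C * M * X * (I * (1 + ?y 0))"
      by (simp add: Y_def algebra_simps)
    \<comment> \<open>In the product of \<open>Q\<close> and \<open>I\<close> one factor
      \<open>I\<close> is replaced by \<open>L\<close>, which leaves a term linear in
      \<open>Q\<close>; the factor \<open>I\<close> in front of \<open>1 + ?y 0\<close> must stay,
      because it is the gain.\<close>
    also have "\<dots> \<le> C * Q + C * C * M * X * Q * L + C * M * X * (I * (1 + ?y 0))"
      using C(1) M(1) X Q IL by (intro add_mono mult_left_mono) auto
    also have "\<dots> = C * (1 + C * M * L * X) * Q + C * M * X * (I * (1 + ?y 0))"
      by (simp add: algebra_simps)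
    also have "\<dots> \<le> (C * (1 + C * M * L * X) + C * M * X) * Q + (C * (1 + C * M * L * X) + C * M * X) * (I * (1 + ?y 0))"
      using C(1) M(1) X Q IL L by (intro add_mono mult_right_mono) auto
    finally show "norm ((dtheta ^^ n) (c 1) \<theta> - (dtheta ^^ n) (c 0) \<theta>) \<le>
        (C * (1 + C * M * L * X) + C * M * X) *
        (integral {0..1} ?q + integral {0..1} ?e * (1 + ?y 0))"
      unfolding Q_def I_def by (simp only: distrib_left)
  qed
qed

section \<open>Estimates between the end points of a path\<close>

text \<open>The form of boundedness that is transported along paths, with the order \<open>n\<close>
  measured only in \<open>L^2(d\<theta>)\<close>.\<close>

definition curve_bound :: "nat \<Rightarrow> real \<Rightarrow> (real \<Rightarrow> real^2) \<Rightarrow> bool" where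
  "curve_bound n K c \<longleftrightarrow> (\<forall>\<theta>\<in>{0..2 * pi}. jet_bound (n - 1) K c \<theta>) \<and>
     integral {0..2 * pi} (\<lambda>\<theta>. (norm ((dtheta ^^ n) c \<theta>))\<^sup>2) \<le> K\<^sup>2"

lemma continuous_on_dtheta: "c \<in> Imm \<Longrightarrow> continuous_on S ((dtheta ^^ i) c)"
  using C_infinity_continuous_on[OF C_infinity_dtheta_funpow[OF ImmD(1)]] continuous_on_subset by blast

lemma three_squares: "(x + y + z)\<^sup>2 \<le> 3 * (x\<^sup>2 + y\<^sup>2 + z\<^sup>2)" for x y z :: real
  using zero_le_power2[of "x - y"] zero_le_power2[of "y - z"] zero_le_power2[of "x - z"]
  by (simp add: power2_eq_square algebra_simps)

lemma integral_square_top_path_diff_le: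
  assumes n: "2 \<le> n" and K: "0 < K" and L: "0 \<le> L"
  obtains C where "0 \<le> C"
    "\<And>c. c \<in> bounded_paths n K L \<Longrightarrow> curve_bound n K (c 0) \<Longrightarrow>
      integral {0..2 * pi} (\<lambda>\<theta>. (norm ((dtheta ^^ n) (c 1) \<theta> - (dtheta ^^ n) (c 0) \<theta>))\<^sup>2) \<le>
        (C * integral {0..1} (path_speed n c))\<^sup>2"
proof -
  obtain C where C: "0 \<le> C"
    "\<And>c \<theta>. c \<in> bounded_paths n K L \<Longrightarrow> \<theta> \<in> {0..2 * pi} \<Longrightarrow>
      norm ((dtheta ^^ n) (c 1) \<theta> - (dtheta ^^ n) (c 0) \<theta>) \<le>
        C * (integral {0..1} (\<lambda>t. norm ((arc_deriv (c t) ^^ n) (path_velocity c t) \<theta>)) +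
          integral {0..1} (path_speed n c) * (1 + norm ((dtheta ^^ n) (c 0) \<theta>)))"
    by (rule norm_top_path_diff_le[OF n K L], rule that; assumption)
  obtain K' where K': "K' > 0"
    "\<And>c t \<theta>. c \<in> bounded_paths n K L \<Longrightarrow> t \<in> {0..1} \<Longrightarrow> \<theta> \<in> {0..2 * pi} \<Longrightarrow> jet_bound (n - 1) K' (c t) \<theta>"
    by (rule jet_bound_pathE[OF n K L, of "n - 1"]) (use n in auto)
  \<comment> \<open>The factor \<open>3\<close> is from \<open>three_squares\<close>;
    \<open>K'\<close> comes from the Minkowski term, \<open>2 * pi\<close> from the constant
    \<open>I\<close> on the circle, and the square of \<open>K\<close> from the initial top
    derivative.\<close>
  define C' where "C' = C * sqrt (3 * (K' + 2 * pi + K\<^sup>2))"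
  show ?thesis
  proof (rule that[of C'])
    show "0 \<le> C'" using C(1) K'(1) by (auto simp: C'_def intro!: mult_nonneg_nonneg add_nonneg_nonneg)
    fix c assume c: "c \<in> bounded_paths n K L" and cb: "curve_bound n K (c 0)"
    then have path: "Imm_path c" by (auto simp: bounded_paths_def)
    let ?q = "\<lambda>t \<theta>. norm ((arc_deriv (c t) ^^ n) (path_velocity c t) \<theta>)"
    let ?y = "\<lambda>\<theta>. norm ((dtheta ^^ n) (c 0) \<theta>)"
    let ?d = "\<lambda>\<theta>. norm ((dtheta ^^ n) (c 1) \<theta> - (dtheta ^^ n) (c 0) \<theta>)"
    define I where "I = integral {0..1} (path_speed n c)"
    have I: "0 \<le> I" using integral_path_speed_nonneg[OF path] by (simp add: I_def)
    define Q where "Q = (\<lambda>\<theta>. integral {0..1} (\<lambda>t. ?q t \<theta>))"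
    have cq: "continuous_on ({0..1} \<times> {0..2 * pi}) (\<lambda>(t, \<theta>). ?q t \<theta>)"
      using continuous_on_strip(1)[OF path_cont_arc_deriv[OF path]]
      by (auto simp: case_prod_unfold intro!: continuous_intros)
    have cQ: "continuous_on {0..2 * pi} Q"
    proof -
      have "continuous_on ({0..2 * pi} \<times> {0..1}) (\<lambda>(\<theta>, t). ?q t \<theta>)"
        using continuous_on_strip(3)[OF path_cont_arc_deriv[OF path], of "{0..1}" "{0..2 * pi}"]
        by (auto simp: case_prod_unfold intro!: continuous_intros)
      then show ?thesis
        using integral_continuous_on_param[of "{0..2 * pi}" 0 1 "\<lambda>\<theta> t. ?q t \<theta>"] by (simp add: Q_def)
    qed
    note cy = continuous_on_dtheta[OF path_ImmD(3)[OF path]]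
    have "integral {0..2 * pi} (\<lambda>\<theta>. (Q \<theta>)\<^sup>2) \<le> (integral {0..1} (\<lambda>t. sqrt K' * path_speed n c t))\<^sup>2"
      unfolding Q_def
    proof (rule Minkowski_integral[OF cq])
      show "continuous_on {0..1} (\<lambda>t. sqrt K' * path_speed n c t)"
        by (intro continuous_intros continuous_on_path_speed[OF path])
      fix t :: real assume t: "t \<in> {0..1}"
      note It = path_ImmD(3)[OF path t] path_ImmD(4)[OF path t]
      show "0 \<le> sqrt K' * path_speed n c t" using K'(1) path_speed_nonneg[OF path t] by simp
      \<comment> \<open>A speed of at least \<open>1 / K'\<close> turns the norm in
        \<open>L^2(d\<theta>)\<close> into the one in \<open>L^2(ds)\<close> that the path speed
        controls.\<close>
      have "integral {0..2 * pi} (\<lambda>\<theta>. (?q t \<theta>)\<^sup>2) \<le> integral {0..2 * pi} (\<lambda>\<theta>. K' * ((?q t \<theta>)\<^sup>2 * speed (c t) \<theta>))"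
      proof (intro integral_le integrable_continuous_real continuous_intros continuous_on_arc_deriv continuous_on_speed It)
        fix \<theta> :: real assume "\<theta> \<in> {0..2 * pi}"
        then have "1 \<le> K' * speed (c t) \<theta>" using K'(2)[OF c t] K'(1) by (simp add: jet_bound_def field_simps)
        then show "(?q t \<theta>)\<^sup>2 \<le> K' * ((?q t \<theta>)\<^sup>2 * speed (c t) \<theta>)"
          using mult_left_mono[of 1 "K' * speed (c t) \<theta>" "(?q t \<theta>)\<^sup>2"] by (simp add: mult_ac)
      qed
      also have "\<dots> = K' * arc_energy (c t) (path_velocity c t) n" by (simp add: arc_energy_def)
      also have "\<dots> \<le> K' * (path_speed n c t)\<^sup>2"
        unfolding path_speed_def using K'(1) by (intro mult_left_mono arc_energy_le It) auto
      finally show "integral {0..2 * pi} (\<lambda>\<theta>. (?q t \<theta>)\<^sup>2) \<le> (sqrt K' * path_speed n c t)\<^sup>2"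
        using K'(1) by (simp add: power_mult_distrib)
    qed
    then have Q2: "integral {0..2 * pi} (\<lambda>\<theta>. (Q \<theta>)\<^sup>2) \<le> K' * I\<^sup>2"
      using K'(1) by (simp add: I_def power_mult_distrib)
    have "integral {0..2 * pi} (\<lambda>\<theta>. (?d \<theta>)\<^sup>2) \<le>
        integral {0..2 * pi} (\<lambda>\<theta>. 3 * C\<^sup>2 * ((Q \<theta>)\<^sup>2 + I\<^sup>2 + I\<^sup>2 * (?y \<theta>)\<^sup>2))"
    proof (intro integral_le integrable_continuous_real continuous_intros cQ cy)
      fix \<theta> :: real assume \<theta>: "\<theta> \<in> {0..2 * pi}"
      have "?d \<theta> \<le> C * (Q \<theta> + I + I * ?y \<theta>)"
        using C(2)[OF c \<theta>] by (simp add: Q_def I_def distrib_left add.assoc)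
      then have "(?d \<theta>)\<^sup>2 \<le> (C * (Q \<theta> + I + I * ?y \<theta>))\<^sup>2" by (intro power_mono) auto
      also have "\<dots> \<le> C\<^sup>2 * (3 * ((Q \<theta>)\<^sup>2 + I\<^sup>2 + (I * ?y \<theta>)\<^sup>2))"
        unfolding power_mult_distrib[of C] by (intro mult_left_mono three_squares) auto
      finally show "(?d \<theta>)\<^sup>2 \<le> 3 * C\<^sup>2 * ((Q \<theta>)\<^sup>2 + I\<^sup>2 + I\<^sup>2 * (?y \<theta>)\<^sup>2)"
        by (simp add: power_mult_distrib algebra_simps)
    qed auto
    also have "\<dots> = 3 * C\<^sup>2 * integral {0..2 * pi} (\<lambda>\<theta>. (Q \<theta>)\<^sup>2 + I\<^sup>2 + I\<^sup>2 * (?y \<theta>)\<^sup>2)" by simp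
    also have "integral {0..2 * pi} (\<lambda>\<theta>. (Q \<theta>)\<^sup>2 + I\<^sup>2 + I\<^sup>2 * (?y \<theta>)\<^sup>2) =
        integral {0..2 * pi} (\<lambda>\<theta>. (Q \<theta>)\<^sup>2) + integral {0..2 * pi} (\<lambda>\<theta>. I\<^sup>2) +
        integral {0..2 * pi} (\<lambda>\<theta>. I\<^sup>2 * (?y \<theta>)\<^sup>2)"
      by (subst integral_add, (intro integrable_continuous_real continuous_intros cQ cy; simp)+)
         (subst integral_add, (intro integrable_continuous_real continuous_intros cQ cy; simp)+, rule refl)
    also have "\<dots> \<le> K' * I\<^sup>2 + 2 * pi * I\<^sup>2 + I\<^sup>2 * K\<^sup>2"
      using Q2 cb mult_left_mono[of "integral {0..2 * pi} (\<lambda>\<theta>. (?y \<theta>)\<^sup>2)" "K\<^sup>2" "I\<^sup>2"]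
      by (simp add: curve_bound_def)
    also have "3 * C\<^sup>2 * \<dots> = (C' * I)\<^sup>2"
      using K'(1) by (simp add: C'_def power_mult_distrib add_nonneg_nonneg algebra_simps)
    finally show "integral {0..2 * pi} (\<lambda>\<theta>. (?d \<theta>)\<^sup>2) \<le> (C' * integral {0..1} (path_speed n c))\<^sup>2"
      by (simp add: I_def mult_left_mono)
  qed
qed

text \<open>Here the pointwise estimates below order \<open>n\<close> and the \<open>L^2\<close>
  estimate at order \<open>n\<close> meet under one constant. That the end curve is bounded in the
  same sense as the start curve provides both the bounds on metric balls and the jet bounds needed
  to compare functions at the two ends.\<close>

lemma path_estimate:
  assumes n: "2 \<le> n" and K: "0 < K" and L: "0 \<le> L"
  obtains C where "0 < C"
    "\<And>c. Imm_path c \<Longrightarrow> curve_bound n K (c 0) \<Longrightarrow> integral {0..1} (path_speed n c) \<le> L \<Longrightarrow> curve_bound n C (c 1)"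
    "\<And>c \<theta> i. Imm_path c \<Longrightarrow> curve_bound n K (c 0) \<Longrightarrow> integral {0..1} (path_speed n c) \<le> L \<Longrightarrow>
      \<theta> \<in> {0..2 * pi} \<Longrightarrow> i \<in> {1..n - 1} \<Longrightarrow>
      norm ((dtheta ^^ i) (c 1) \<theta> - (dtheta ^^ i) (c 0) \<theta>) \<le> C * integral {0..1} (path_speed n c)"
    "\<And>c. Imm_path c \<Longrightarrow> curve_bound n K (c 0) \<Longrightarrow> integral {0..1} (path_speed n c) \<le> L \<Longrightarrow>
      integral {0..2 * pi} (\<lambda>\<theta>. (norm ((dtheta ^^ n) (c 1) \<theta> - (dtheta ^^ n) (c 0) \<theta>))\<^sup>2) \<le>
        (C * integral {0..1} (path_speed n c))\<^sup>2"
proof -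
  obtain C1 where C1: "0 \<le> C1"
    "\<And>c. c \<in> bounded_paths n K L \<Longrightarrow> curve_bound n K (c 0) \<Longrightarrow>
      integral {0..2 * pi} (\<lambda>\<theta>. (norm ((dtheta ^^ n) (c 1) \<theta> - (dtheta ^^ n) (c 0) \<theta>))\<^sup>2) \<le>
        (C1 * integral {0..1} (path_speed n c))\<^sup>2"
    by (rule integral_square_top_path_diff_le[OF n K L], rule that; assumption)
  obtain C2 where C2: "0 \<le> C2"
    "\<And>c t \<theta> i. c \<in> bounded_paths n K L \<Longrightarrow> t \<in> {0..1} \<Longrightarrow> \<theta> \<in> {0..2 * pi} \<Longrightarrow> i \<in> {1..n - 1} \<Longrightarrow>
      norm ((dtheta ^^ i) (path_velocity c t) \<theta>) \<le> C2 * path_speed n c t"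
    by (rule norm_dtheta_velocity_le[OF n K L], rule that; assumption)
  obtain K' where K': "K' > 0"
    "\<And>c t \<theta>. c \<in> bounded_paths n K L \<Longrightarrow> t \<in> {0..1} \<Longrightarrow> \<theta> \<in> {0..2 * pi} \<Longrightarrow> jet_bound (n - 1) K' (c t) \<theta>"
    by (rule jet_bound_pathE[OF n K L, of "n - 1"]) (use n in auto)
  \<comment> \<open>The last two summands bound the top derivative of the end curve, through
    \<open>2 * a^2 + 2 * b^2 \<le> (2 * a + 2 * b)^2\<close> with \<open>a = K\<close> and
    \<open>b = C1 * L\<close>.\<close>
  define C where "C = C1 + C2 + K' + 2 * K + 2 * C1 * L"
  have C: "0 < C" "C1 \<le> C" "C2 \<le> C" "K' \<le> C" "2 * K + 2 * C1 * L \<le> C"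
  proof -
    have "0 \<le> 2 * C1 * L" using C1(1) L by simp
    then show "0 < C" "C1 \<le> C" "C2 \<le> C" "K' \<le> C" "2 * K + 2 * C1 * L \<le> C"
      unfolding C_def using C1(1) C2(1) K'(1) K by linarith+
  qed
  show ?thesis
  proof (rule that[of C])
    show "0 < C" by (rule C)
    fix c assume path: "Imm_path c" and cb: "curve_bound n K (c 0)" and I: "integral {0..1} (path_speed n c) \<le> L"
    then have c: "c \<in> bounded_paths n K L" by (simp add: bounded_paths_def curve_bound_def)
    note I0 = integral_path_speed_nonneg[OF path, of n]
    have top: "integral {0..2 * pi} (\<lambda>\<theta>. (norm ((dtheta ^^ n) (c 1) \<theta> - (dtheta ^^ n) (c 0) \<theta>))\<^sup>2) \<le>
        (C1 * integral {0..1} (path_speed n c))\<^sup>2" by (rule C1(2)[OF c cb])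
    also have "\<dots> \<le> (C * integral {0..1} (path_speed n c))\<^sup>2"
      using C C1(1) I0 by (intro power_mono mult_right_mono mult_nonneg_nonneg) auto
    finally show "integral {0..2 * pi} (\<lambda>\<theta>. (norm ((dtheta ^^ n) (c 1) \<theta> - (dtheta ^^ n) (c 0) \<theta>))\<^sup>2) \<le>
        (C * integral {0..1} (path_speed n c))\<^sup>2" .
    show "norm ((dtheta ^^ i) (c 1) \<theta> - (dtheta ^^ i) (c 0) \<theta>) \<le> C * integral {0..1} (path_speed n c)"
      if \<theta>: "\<theta> \<in> {0..2 * pi}" and i: "i \<in> {1..n - 1}" for \<theta> i
    proof -
      have "norm ((dtheta ^^ i) (c 1) \<theta> - (dtheta ^^ i) (c 0) \<theta>) \<le> integral {0..1} (\<lambda>t. C2 * path_speed n c t)"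
        by (intro norm_dtheta_path_diff_le[OF path] integrable_continuous_real continuous_intros
            continuous_on_path_speed[OF path] C2(2) c \<theta> i) auto
      also have "\<dots> \<le> C * integral {0..1} (path_speed n c)"
        using C(3) I0 by (simp add: mult_right_mono)
      finally show ?thesis .
    qed
    show "curve_bound n C (c 1)"
      unfolding curve_bound_def
    proof (intro conjI ballI)
      show "jet_bound (n - 1) C (c 1) \<theta>" if "\<theta> \<in> {0..2 * pi}" for \<theta>
        using jet_bound_mono[OF K'(2)[OF c _ that] K'(1) C(4)] by simp
      let ?y = "\<lambda>t \<theta>. norm ((dtheta ^^ n) (c t) \<theta>)"
      let ?d = "\<lambda>\<theta>. norm ((dtheta ^^ n) (c 1) \<theta> - (dtheta ^^ n) (c 0) \<theta>)"
      note cy = continuous_on_dtheta[OF path_ImmD(3)[OF path]]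
      have "integral {0..2 * pi} (\<lambda>\<theta>. (?y 1 \<theta>)\<^sup>2) \<le> integral {0..2 * pi} (\<lambda>\<theta>. 2 * (?y 0 \<theta>)\<^sup>2 + 2 * (?d \<theta>)\<^sup>2)"
      proof (intro integral_le integrable_continuous_real continuous_intros cy)
        fix \<theta>
        have "(?y 1 \<theta>)\<^sup>2 \<le> (?y 0 \<theta> + ?d \<theta>)\<^sup>2"
          using norm_triangle_sub[of "(dtheta ^^ n) (c 1) \<theta>" "(dtheta ^^ n) (c 0) \<theta>"] by (intro power_mono) auto
        also have "\<dots> \<le> 2 * (?y 0 \<theta>)\<^sup>2 + 2 * (?d \<theta>)\<^sup>2"
          using zero_le_power2[of "?y 0 \<theta> - ?d \<theta>"] by (simp add: power2_eq_square algebra_simps)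
        finally show "(?y 1 \<theta>)\<^sup>2 \<le> 2 * (?y 0 \<theta>)\<^sup>2 + 2 * (?d \<theta>)\<^sup>2" .
      qed auto
      also have "\<dots> = 2 * integral {0..2 * pi} (\<lambda>\<theta>. (?y 0 \<theta>)\<^sup>2) + 2 * integral {0..2 * pi} (\<lambda>\<theta>. (?d \<theta>)\<^sup>2)"
        by (subst integral_add) (auto intro!: integrable_continuous_real continuous_intros cy)
      also have "\<dots> \<le> 2 * K\<^sup>2 + 2 * (C1 * L)\<^sup>2"
      proof -
        have "(C1 * integral {0..1} (path_speed n c))\<^sup>2 \<le> (C1 * L)\<^sup>2"
          using C1(1) I0 I by (intro power_mono mult_left_mono mult_nonneg_nonneg) auto
        then show ?thesis using cb top by (auto simp: curve_bound_def)
      qed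
      also have "\<dots> \<le> (2 * K + 2 * C1 * L)\<^sup>2"
      proof -
        have "2 * a\<^sup>2 + 2 * b\<^sup>2 \<le> (2 * a + 2 * b)\<^sup>2" if "0 \<le> a" "0 \<le> b" for a b :: real
          using mult_nonneg_nonneg[OF that] by (simp add: power2_sum power_mult_distrib)
        from this[of K "C1 * L"] show ?thesis using K C1(1) L by (simp add: mult.assoc)
      qed
      also have "\<dots> \<le> C\<^sup>2" using C(5) K C1(1) L by (intro power_mono) auto
      finally show "integral {0..2 * pi} (\<lambda>\<theta>. (?y 1 \<theta>)\<^sup>2) \<le> C\<^sup>2" .
    qed
  qed
qed

section \<open>Lipschitz continuity\<close>

lemma curve_bound_exists:
  assumes "c \<in> Imm"
  shows "\<exists>K>0. curve_bound n K c"
proof -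
  have bd: "\<exists>B\<ge>0. \<forall>\<theta>\<in>{0..2 * pi}. \<bar>f \<theta>\<bar> \<le> B" if "continuous_on {0..2 * pi} f" for f :: "real \<Rightarrow> real"
    using compact_imp_bounded[OF compact_continuous_image[OF that compact_Icc]]
    unfolding bounded_pos by (auto intro: less_imp_le)
  have "\<exists>B\<ge>0. \<forall>\<theta>\<in>{0..2 * pi}. norm ((dtheta ^^ i) c \<theta>) \<le> B" for i
    using bd[of "\<lambda>\<theta>. norm ((dtheta ^^ i) c \<theta>)"] by (auto intro!: continuous_intros continuous_on_dtheta assms)
  then obtain B where B: "\<And>i. 0 \<le> B i" "\<And>i \<theta>. \<theta> \<in> {0..2 * pi} \<Longrightarrow> norm ((dtheta ^^ i) c \<theta>) \<le> B i" by metis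
  obtain S where S: "S \<ge> 0" "\<And>\<theta>. \<theta> \<in> {0..2 * pi} \<Longrightarrow> \<bar>1 / speed c \<theta>\<bar> \<le> S"
  proof -
    have "continuous_on {0..2 * pi} (\<lambda>\<theta>. 1 / speed c \<theta>)"
      using ImmD(3)[OF assms] by (intro continuous_intros continuous_on_speed assms) (simp add: less_imp_neq[symmetric])
    from bd[OF this] show thesis using that by blast
  qed
  define J where "J = integral {0..2 * pi} (\<lambda>\<theta>. (norm ((dtheta ^^ n) c \<theta>))\<^sup>2)"
  have J: "0 \<le> J"
    unfolding J_def by (intro integral_nonneg integrable_continuous_real continuous_intros continuous_on_dtheta assms) auto
  \<comment> \<open>The summand \<open>1\<close> gives \<open>1 \<le> K\<close>, hence
    \<open>J \<le> K \<le> K^2\<close>, as the squared form of the top bound demands.\<close>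
  define K where "K = 1 + S + (\<Sum>i\<le>n. B i) + J"
  have sB: "0 \<le> (\<Sum>i\<le>n. B i)" using B(1) by (intro sum_nonneg)
  have K: "0 < K" "S \<le> K" "1 + J \<le> K" using sB S J by (auto simp: K_def)
  have "jet_bound (n - 1) K c \<theta>" if \<theta>: "\<theta> \<in> {0..2 * pi}" for \<theta>
    unfolding jet_bound_def
  proof (intro conjI ballI)
    have "1 / speed c \<theta> \<le> K" using S(2)[OF \<theta>] K by linarith
    then show "1 / K \<le> speed c \<theta>" using K ImmD(3)[OF assms, of \<theta>] by (simp add: field_simps)
    fix i assume "i \<in> {1..n - 1}"
    then have "B i \<le> (\<Sum>i\<le>n. B i)" using B(1) by (intro member_le_sum) auto
    then show "norm ((dtheta ^^ i) c \<theta>) \<le> K" using B(2)[OF \<theta>, of i] S J by (simp add: K_def)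
  qed
  moreover have "J \<le> K\<^sup>2"
  proof -
    have "J \<le> 1 * K" using K by simp
    also have "\<dots> \<le> K * K" using K J by (intro mult_right_mono) auto
    finally show ?thesis by (simp add: power2_eq_square)
  qed
  ultimately show ?thesis using K(1) by (auto simp: curve_bound_def J_def)
qed

lemma L2_norm_continuous:
  assumes "continuous_on {0..2 * pi} u"
  shows "L2_norm u = sqrt (integral {0..2 * pi} (\<lambda>\<theta>. (u \<theta>)\<^sup>2))"
  unfolding L2_norm_def using assms
  by (subst lebesgue_integral_eq_integral) (auto intro!: continuous_imp_integrable_real continuous_intros)

lemma affine_jet_continuous:
  assumes "affine_jet m F" "c \<in> Imm"
  shows "continuous_on S (F c)"
proof -
  have "jet_poly (Suc m) F" using assms(1) by (rule affine_jet_imp_jet_poly)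
  then obtain g where "\<And>\<theta>. (F c has_real_derivative g c \<theta>) (at \<theta>)"
    using jet_poly_deriv[of "Suc m" F] assms(2) by auto
  then show ?thesis by (meson DERIV_isCont continuous_at_imp_continuous_on)
qed

lemma affine_jet_L2_circle:
  assumes "affine_jet m F" "c \<in> Imm"
  shows "F c \<in> L2_circle"
proof -
  note cont = affine_jet_continuous[OF assms, of "{0..2 * pi}"]
  have "periodic_2pi (F c)" using jet_poly_periodic[OF affine_jet_imp_jet_poly[OF assms(1)] assms(2)] .
  moreover have "F c \<in> borel_measurable (lebesgue_on {0..2 * pi})"
    using continuous_imp_integrable_real[OF cont] by (rule borel_measurable_integrable)
  moreover have "integrable (lebesgue_on {0..2 * pi}) (\<lambda>\<theta>. \<bar>F c \<theta>\<bar>\<^sup>2)"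
    by (intro continuous_imp_integrable_real continuous_intros cont)
  ultimately show ?thesis by (simp add: L2_circle_def)
qed

lemma affine_jet_L2_bound:
  assumes n: "2 \<le> n" and K: "0 < K" and F: "affine_jet (n - 1) F"
  obtains C where "0 \<le> C"
    "\<And>c. c \<in> Imm \<Longrightarrow> curve_bound n K c \<Longrightarrow> integral {0..2 * pi} (\<lambda>\<theta>. (F c \<theta>)\<^sup>2) \<le> C\<^sup>2"
proof -
  have top: "Suc (n - 1) = n" using n by simp
  obtain C where C: "C \<ge> 0"
    "\<And>c \<theta>. jet_bound (n - 1) K c \<theta> \<Longrightarrow> \<bar>F c \<theta>\<bar> \<le> C * (1 + norm ((dtheta ^^ n) c \<theta>))"
    by (rule affine_jet_bounds[OF F K, unfolded top], rule that; assumption)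
  show ?thesis
  proof (rule that[of "C * sqrt (2 * (2 * pi + K\<^sup>2))"])
    show "0 \<le> C * sqrt (2 * (2 * pi + K\<^sup>2))" using C(1) by simp
    fix c assume c: "c \<in> Imm" and cb: "curve_bound n K c"
    let ?y = "\<lambda>\<theta>. norm ((dtheta ^^ n) c \<theta>)"
    have "integral {0..2 * pi} (\<lambda>\<theta>. (F c \<theta>)\<^sup>2) \<le> integral {0..2 * pi} (\<lambda>\<theta>. 2 * C\<^sup>2 * (1 + (?y \<theta>)\<^sup>2))"
    proof (intro integral_le integrable_continuous_real continuous_intros affine_jet_continuous[OF F] continuous_on_dtheta c)
      fix \<theta> :: real assume "\<theta> \<in> {0..2 * pi}"
      then have "\<bar>F c \<theta>\<bar> \<le> C * (1 + ?y \<theta>)" using cb by (intro C(2)) (simp add: curve_bound_def)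
      then have "(F c \<theta>)\<^sup>2 \<le> (C * (1 + ?y \<theta>))\<^sup>2" by (metis abs_ge_zero power2_abs power_mono)
      also have "\<dots> \<le> C\<^sup>2 * (2 * (1 + (?y \<theta>)\<^sup>2))"
        unfolding power_mult_distrib[of C]
        using zero_le_power2[of "1 - ?y \<theta>"] by (intro mult_left_mono) (auto simp: power2_eq_square algebra_simps)
      finally show "(F c \<theta>)\<^sup>2 \<le> 2 * C\<^sup>2 * (1 + (?y \<theta>)\<^sup>2)" by (simp add: algebra_simps)
    qed
    also have "\<dots> = 2 * C\<^sup>2 * integral {0..2 * pi} (\<lambda>\<theta>. 1 + (?y \<theta>)\<^sup>2)" by simp
    also have "integral {0..2 * pi} (\<lambda>\<theta>. 1 + (?y \<theta>)\<^sup>2) = 2 * pi + integral {0..2 * pi} (\<lambda>\<theta>. (?y \<theta>)\<^sup>2)"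
      by (subst integral_add) (auto intro!: integrable_continuous_real continuous_intros continuous_on_dtheta c)
    also have "2 * C\<^sup>2 * \<dots> \<le> 2 * C\<^sup>2 * (2 * pi + K\<^sup>2)"
      using cb by (intro mult_left_mono add_left_mono) (auto simp: curve_bound_def)
    also have "\<dots> = (C * sqrt (2 * (2 * pi + K\<^sup>2)))\<^sup>2"
      by (simp add: power_mult_distrib add_nonneg_nonneg)
    finally show "integral {0..2 * pi} (\<lambda>\<theta>. (F c \<theta>)\<^sup>2) \<le> (C * sqrt (2 * (2 * pi + K\<^sup>2)))\<^sup>2" .
  qed
qed

lemma L2_norm_minus_commute: "L2_norm (\<lambda>\<theta>. u \<theta> - v \<theta>) = L2_norm (\<lambda>\<theta>. v \<theta> - u \<theta>)"
  unfolding L2_norm_def by (simp add: abs_minus_commute)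

text \<open>The pointwise Lipschitz estimate for affine functions is squared and integrated with
  \<open>\<delta>\<close> proportional to the integral of the path speed; the only unbounded factors
  are the initial top derivative and its increment, both controlled in \<open>L^2\<close>.\<close>

lemma affine_jet_L2_path:
  assumes n: "2 \<le> n" and K: "0 < K" and L: "0 \<le> L" and F: "affine_jet (n - 1) F"
  obtains C where "0 \<le> C"
    "\<And>c. Imm_path c \<Longrightarrow> curve_bound n K (c 0) \<Longrightarrow> integral {0..1} (path_speed n c) \<le> L \<Longrightarrow>
      L2_norm (\<lambda>\<theta>. F (c 0) \<theta> - F (c 1) \<theta>) \<le> C * integral {0..1} (path_speed n c)"
proof -
  have top: "Suc (n - 1) = n" using n by simp
  obtain K' where K': "0 < K'"
    "\<And>c. Imm_path c \<Longrightarrow> curve_bound n K (c 0) \<Longrightarrow> integral {0..1} (path_speed n c) \<le> L \<Longrightarrow> curve_bound n K' (c 1)"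
    "\<And>c \<theta> i. Imm_path c \<Longrightarrow> curve_bound n K (c 0) \<Longrightarrow> integral {0..1} (path_speed n c) \<le> L \<Longrightarrow>
      \<theta> \<in> {0..2 * pi} \<Longrightarrow> i \<in> {1..n - 1} \<Longrightarrow>
      norm ((dtheta ^^ i) (c 1) \<theta> - (dtheta ^^ i) (c 0) \<theta>) \<le> K' * integral {0..1} (path_speed n c)"
    "\<And>c. Imm_path c \<Longrightarrow> curve_bound n K (c 0) \<Longrightarrow> integral {0..1} (path_speed n c) \<le> L \<Longrightarrow>
      integral {0..2 * pi} (\<lambda>\<theta>. (norm ((dtheta ^^ n) (c 1) \<theta> - (dtheta ^^ n) (c 0) \<theta>))\<^sup>2) \<le>
        (K' * integral {0..1} (path_speed n c))\<^sup>2"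
    by (rule path_estimate[OF n K L], rule that; assumption)
  \<comment> \<open>A common jet bound for the start and the end of the path.\<close>
  define B where "B = max K K'"
  have B: "0 < B" "K \<le> B" "K' \<le> B" using K by (auto simp: B_def)
  obtain C where C: "C \<ge> 0"
    "\<And>c d \<theta> \<delta>. jet_bound (n - 1) B c \<theta> \<Longrightarrow> jet_bound (n - 1) B d \<theta> \<Longrightarrow> 0 \<le> \<delta> \<Longrightarrow>
       (\<forall>i\<in>{1..n - 1}. norm ((dtheta ^^ i) c \<theta> - (dtheta ^^ i) d \<theta>) \<le> \<delta>) \<Longrightarrow>
       \<bar>F c \<theta> - F d \<theta>\<bar> \<le> C * (\<delta> * (1 + norm ((dtheta ^^ n) d \<theta>)) +
         norm ((dtheta ^^ n) c \<theta> - (dtheta ^^ n) d \<theta>))"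
    by (rule affine_jet_bounds[OF F B(1), unfolded top], rule that; assumption)
  \<comment> \<open>After \<open>three_squares\<close> the summands belong to the constant
    \<open>\<delta>\<close>, to \<open>\<delta>\<close> times the initial top derivative, and to the
    increment of the top derivative.\<close>
  define C' where "C' = C * K' * sqrt (3 * (2 * pi + K\<^sup>2 + 1))"
  show ?thesis
  proof (rule that[of C'])
    show C': "0 \<le> C'" using C(1) K'(1) by (simp add: C'_def)
    fix c assume path: "Imm_path c" and cb: "curve_bound n K (c 0)" and I: "integral {0..1} (path_speed n c) \<le> L"
    note Im = path_ImmD(3)[OF path]
    define \<delta> where "\<delta> = K' * integral {0..1} (path_speed n c)"
    have \<delta>: "0 \<le> \<delta>" using K'(1) integral_path_speed_nonneg[OF path] by (simp add: \<delta>_def)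
    let ?y = "\<lambda>\<theta>. norm ((dtheta ^^ n) (c 0) \<theta>)"
    let ?d = "\<lambda>\<theta>. norm ((dtheta ^^ n) (c 1) \<theta> - (dtheta ^^ n) (c 0) \<theta>)"
    note cont = affine_jet_continuous[OF F] continuous_on_dtheta
    have "integral {0..2 * pi} (\<lambda>\<theta>. (F (c 1) \<theta> - F (c 0) \<theta>)\<^sup>2) \<le>
        integral {0..2 * pi} (\<lambda>\<theta>. 3 * C\<^sup>2 * (\<delta>\<^sup>2 + \<delta>\<^sup>2 * (?y \<theta>)\<^sup>2 + (?d \<theta>)\<^sup>2))"
    proof (intro integral_le integrable_continuous_real continuous_intros cont Im)
      fix \<theta> :: real assume \<theta>: "\<theta> \<in> {0..2 * pi}"
      have "jet_bound (n - 1) B (c 0) \<theta>" "jet_bound (n - 1) B (c 1) \<theta>"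
        using cb K'(2)[OF path cb I] \<theta> jet_bound_mono[OF _ K B(2)] jet_bound_mono[OF _ K'(1) B(3)]
        by (auto simp: curve_bound_def)
      then have "\<bar>F (c 1) \<theta> - F (c 0) \<theta>\<bar> \<le> C * (\<delta> * (1 + ?y \<theta>) + ?d \<theta>)"
        using K'(3)[OF path cb I \<theta>] \<delta> by (intro C(2)) (auto simp: \<delta>_def)
      then have "(F (c 1) \<theta> - F (c 0) \<theta>)\<^sup>2 \<le> (C * (\<delta> * (1 + ?y \<theta>) + ?d \<theta>))\<^sup>2"
        by (metis abs_ge_zero power2_abs power_mono)
      also have "\<dots> = C\<^sup>2 * (\<delta> + \<delta> * ?y \<theta> + ?d \<theta>)\<^sup>2" by (simp only: distrib_left[of \<delta>] power_mult_distrib mult_1_right)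
      also have "\<dots> \<le> C\<^sup>2 * (3 * (\<delta>\<^sup>2 + (\<delta> * ?y \<theta>)\<^sup>2 + (?d \<theta>)\<^sup>2))"
        by (intro mult_left_mono three_squares) auto
      finally show "(F (c 1) \<theta> - F (c 0) \<theta>)\<^sup>2 \<le> 3 * C\<^sup>2 * (\<delta>\<^sup>2 + \<delta>\<^sup>2 * (?y \<theta>)\<^sup>2 + (?d \<theta>)\<^sup>2)"
        by (simp add: power_mult_distrib algebra_simps)
    qed auto
    also have "\<dots> = 3 * C\<^sup>2 * integral {0..2 * pi} (\<lambda>\<theta>. \<delta>\<^sup>2 + \<delta>\<^sup>2 * (?y \<theta>)\<^sup>2 + (?d \<theta>)\<^sup>2)" by simp
    also have "integral {0..2 * pi} (\<lambda>\<theta>. \<delta>\<^sup>2 + \<delta>\<^sup>2 * (?y \<theta>)\<^sup>2 + (?d \<theta>)\<^sup>2) =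
        integral {0..2 * pi} (\<lambda>\<theta>. \<delta>\<^sup>2) + integral {0..2 * pi} (\<lambda>\<theta>. \<delta>\<^sup>2 * (?y \<theta>)\<^sup>2) +
        integral {0..2 * pi} (\<lambda>\<theta>. (?d \<theta>)\<^sup>2)"
      by (subst integral_add, (intro integrable_continuous_real continuous_intros cont Im; simp)+)
         (subst integral_add, (intro integrable_continuous_real continuous_intros cont Im; simp)+, rule refl)
    also have "\<dots> \<le> 2 * pi * \<delta>\<^sup>2 + \<delta>\<^sup>2 * K\<^sup>2 + \<delta>\<^sup>2"
      using K'(4)[OF path cb I] cb mult_left_mono[of "integral {0..2 * pi} (\<lambda>\<theta>. (?y \<theta>)\<^sup>2)" "K\<^sup>2" "\<delta>\<^sup>2"]
      by (simp add: curve_bound_def \<delta>_def)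
    also have "3 * C\<^sup>2 * \<dots> = (C' * integral {0..1} (path_speed n c))\<^sup>2"
      by (simp add: C'_def \<delta>_def power_mult_distrib add_nonneg_nonneg algebra_simps)
    finally have "integral {0..2 * pi} (\<lambda>\<theta>. (F (c 1) \<theta> - F (c 0) \<theta>)\<^sup>2) \<le>
        (C' * integral {0..1} (path_speed n c))\<^sup>2" by (simp add: mult_left_mono)
    then have "L2_norm (\<lambda>\<theta>. F (c 1) \<theta> - F (c 0) \<theta>) \<le> C' * integral {0..1} (path_speed n c)"
      using C' integral_path_speed_nonneg[OF path]
      by (subst L2_norm_continuous) (auto intro!: real_le_lsqrt continuous_intros cont Im)
    then show "L2_norm (\<lambda>\<theta>. F (c 0) \<theta> - F (c 1) \<theta>) \<le> C' * integral {0..1} (path_speed n c)"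
      by (simp only: L2_norm_minus_commute[of "F (c 0)"])
  qed
qed

section \<open>From paths to the geodesic distance\<close>

definition controls_sobolev ::
  "nat \<Rightarrow> real \<Rightarrow> ((real \<Rightarrow> real^2) \<Rightarrow> (real \<Rightarrow> real^2) \<Rightarrow> (real \<Rightarrow> real^2) \<Rightarrow> real) \<Rightarrow> bool" where
  "controls_sobolev n A G \<longleftrightarrow> (\<forall>c\<in>Imm. \<forall>h\<in>smooth_circle.
     arc_integral c (\<lambda>\<theta>. (norm (h \<theta>))\<^sup>2 + (norm ((arc_deriv c ^^ n) h \<theta>))\<^sup>2) \<le> A * G c h h)"

text \<open>At each time the assumed inequality bounds the path speed by \<open>sqrt A\<close> times
  the integrand of the length. The comparison is made between nonnegative integrals, where the
  length is defined.\<close>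

lemma path_len_ge:
  assumes "0 < A" and path: "Imm_path c"
    and G: "controls_sobolev n A G"
  shows "ennreal (integral {0..1} (path_speed n c) / sqrt A) \<le> path_len G c"
proof -
  have "ennreal (integral {0..1} (\<lambda>t. path_speed n c t / sqrt A)) =
      (\<integral>\<^sup>+t. ennreal (path_speed n c t / sqrt A) * indicator {0..1} t \<partial>lborel)"
    using assms(1) path_speed_nonneg[OF path]
    by (intro nn_integral_has_integral_lebesgue'[symmetric] integrable_integral integrable_continuous_real
        continuous_intros continuous_on_path_speed[OF path]) auto
  also have "\<dots> \<le> path_len G c"
    unfolding path_len_def
  proof (rule nn_integral_mono)
    fix t :: real
    show "ennreal (path_speed n c t / sqrt A) * indicator {0..1} t \<le>
      ennreal (sqrt (G (c t) (path_velocity c t) (path_velocity c t))) * indicator {0..1} t"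
    proof (cases "t \<in> {0..1}")
      case True
      note I = path_ImmD(3)[OF path True] path_ImmD(4)[OF path True]
      have "(path_speed n c t)\<^sup>2 \<le> A * G (c t) (path_velocity c t) (path_velocity c t)"
        using G I by (simp add: controls_sobolev_def path_speed_def sobolev_norm_squared[OF I])
      then have "(path_speed n c t / sqrt A)\<^sup>2 \<le> G (c t) (path_velocity c t) (path_velocity c t)"
        using assms(1) by (simp add: power_divide field_simps)
      then have "path_speed n c t / sqrt A \<le> sqrt (G (c t) (path_velocity c t) (path_velocity c t))"
        by (rule real_le_rsqrt)
      then show ?thesis by (intro mult_right_mono ennreal_leI) auto
    qed simp
  qed
  finally show ?thesis by simp
qed

lemma geodesic_dist_lessE:
  assumes "geodesic_dist G c1 c2 < r" "0 < A"
    and G: "controls_sobolev n A G"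
  obtains c where "Imm_path c" "c 0 = c1" "c 1 = c2"
    "ennreal (integral {0..1} (path_speed n c) / sqrt A) < r"
proof -
  from assms(1) obtain c where c: "c \<in> Imm_paths c1 c2" "path_len G c < r"
    unfolding geodesic_dist_def INF_less_iff by blast
  then have "Imm_path c" by (simp add: Imm_paths_def Imm_path_def)
  with path_len_ge[OF assms(2) this G] c that show ?thesis
    by (auto simp: Imm_paths_def intro: le_less_trans)
qed

text \<open>Curves at distance less than \<open>1\<close> are joined by paths of length less than
  \<open>1\<close>, whose integrated path speed is at most \<open>sqrt A\<close>; this fixes the
  parameter \<open>L\<close>. Only \<open>c1\<close> needs a bound, because the path estimates start
  there.\<close>

lemma affine_jet_local_lipschitz:
  assumes n: "2 \<le> n" and A: "0 < A" and K: "0 < K" and F: "affine_jet (n - 1) F"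
    and G: "controls_sobolev n A G"
  shows "\<exists>C>0. \<forall>c1 c2. curve_bound n K c1 \<longrightarrow> geodesic_dist G c1 c2 < 1 \<longrightarrow>
    ennreal (L2_norm (\<lambda>\<theta>. F c1 \<theta> - F c2 \<theta>)) \<le> ennreal C * geodesic_dist G c1 c2"
proof -
  have sA: "0 < sqrt A" using A by simp
  obtain C where C: "0 \<le> C"
    "\<And>c. Imm_path c \<Longrightarrow> curve_bound n K (c 0) \<Longrightarrow> integral {0..1} (path_speed n c) \<le> sqrt A \<Longrightarrow>
      L2_norm (\<lambda>\<theta>. F (c 0) \<theta> - F (c 1) \<theta>) \<le> C * integral {0..1} (path_speed n c)"
    by (rule affine_jet_L2_path[OF n K _ F, of "sqrt A"], use sA in simp, rule that; assumption)
  \<comment> \<open>\<open>C\<close> may be zero; adding \<open>1\<close> makes \<open>C'\<close>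
    positive, so the norm can be divided by it.\<close>
  define C' where "C' = (C + 1) * sqrt A"
  have C': "0 < C'" using C(1) sA by (simp add: C'_def)
  show ?thesis
  proof (intro exI[of _ C'] conjI allI impI)
    fix c1 c2 assume cb: "curve_bound n K c1" and d: "geodesic_dist G c1 c2 < 1"
    let ?N = "L2_norm (\<lambda>\<theta>. F c1 \<theta> - F c2 \<theta>)"
    \<comment> \<open>A minimizing path may be missing, so the estimate is shown for every
      \<open>r\<close> strictly between the distance and \<open>1\<close>, and density gives it for
      the distance.\<close>
    have "ennreal (?N / C') \<le> r" if r: "geodesic_dist G c1 c2 < r" "r < 1" for r
    proof -
      obtain c where c: "Imm_path c" "c 0 = c1" "c 1 = c2"
        "ennreal (integral {0..1} (path_speed n c) / sqrt A) < r"
        by (rule geodesic_dist_lessE[OF r(1) A G]) 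
      let ?I = "integral {0..1} (path_speed n c)"
      have "ennreal (?I / sqrt A) < 1" using c(4) r(2) by (rule less_trans)
      then have "?I \<le> sqrt A" using sA by (simp add: ennreal_less_one_iff field_simps)
      then have "?N \<le> C * ?I" using C(2)[of c] c cb by simp
      also have "\<dots> \<le> (C + 1) * ?I" using integral_path_speed_nonneg[OF c(1), of n] by (simp add: mult_right_mono)
      finally have "?N / C' \<le> (C + 1) * ?I / C'" using C' by (simp add: divide_right_mono)
      also have "\<dots> = ?I / sqrt A" using C(1) by (simp add: C'_def)
      finally have "?N / C' \<le> ?I / sqrt A" .
      then have "ennreal (?N / C') \<le> ennreal (?I / sqrt A)" by (rule ennreal_leI)
      with c(4) show ?thesis by (meson less_imp_le order_trans)
    qed
    then have "ennreal (?N / C') \<le> geodesic_dist G c1 c2" by (rule dense_ge_bounded[OF d])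
    then have "ennreal C' * ennreal (?N / C') \<le> ennreal C' * geodesic_dist G c1 c2" by (rule mult_left_mono) simp
    moreover have "0 \<le> ?N" unfolding L2_norm_def by simp
    ultimately show "ennreal ?N \<le> ennreal C' * geodesic_dist G c1 c2"
      using C' by (simp flip: ennreal_mult'')
  qed (rule C')
qed

text \<open>Every curve of the ball is the end of a path that starts at the fixed centre and has
  integrated path speed at most \<open>sqrt A * N\<close>, so the endpoint bound of
  \<open>path_estimate\<close> is uniform on the ball.\<close>

lemma curve_bound_metric_ball:
  assumes n: "2 \<le> n" and A: "0 < A" and c0: "c0 \<in> Imm" and N: "0 < N" and G: "controls_sobolev n A G"
  obtains K where "0 < K" "\<And>c. geodesic_dist G c0 c < ennreal N \<Longrightarrow> curve_bound n K c"
proof -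
  obtain K0 where K0: "0 < K0" "curve_bound n K0 c0" using curve_bound_exists[OF c0] by blast
  have L: "0 \<le> sqrt A * N" using A N by simp
  obtain K where K: "0 < K"
    "\<And>c. Imm_path c \<Longrightarrow> curve_bound n K0 (c 0) \<Longrightarrow> integral {0..1} (path_speed n c) \<le> sqrt A * N \<Longrightarrow> curve_bound n K (c 1)"
    by (rule path_estimate[OF n K0(1) L], rule that; assumption)
  show ?thesis
  proof (rule that[OF K(1)])
    fix c1 assume d: "geodesic_dist G c0 c1 < ennreal N"
    obtain c where c: "Imm_path c" "c 0 = c0" "c 1 = c1"
      "ennreal (integral {0..1} (path_speed n c) / sqrt A) < ennreal N"
      by (rule geodesic_dist_lessE[OF d A G])
    have "0 \<le> integral {0..1} (path_speed n c) / sqrt A" using integral_path_speed_nonneg[OF c(1)] A by simp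
    then have "integral {0..1} (path_speed n c) / sqrt A < N" using c(4) by (simp only: ennreal_less_iff)
    then have "integral {0..1} (path_speed n c) \<le> sqrt A * N" using A by (simp add: field_simps)
    then show "curve_bound n K c1" using K(2)[of c] c K0 by simp
  qed
qed

text \<open>
  Points at distance at least \<open>1\<close> are handled by boundedness alone, so the triangle inequality for
  \<open>geodesic_dist\<close> is not needed.
\<close>

lemma affine_jet_lipschitz_on_ball:
  assumes n: "2 \<le> n" and A: "0 < A" and c0: "c0 \<in> Imm" and N: "0 < N" and G: "controls_sobolev n A G"
    and F: "affine_jet (n - 1) F"
  shows "\<exists>C\<ge>0. \<forall>c1\<in>Imm. \<forall>c2\<in>Imm. geodesic_dist G c0 c1 < ennreal N \<longrightarrow> geodesic_dist G c0 c2 < ennreal N \<longrightarrow>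
    ennreal (L2_norm (\<lambda>\<theta>. F c1 \<theta> - F c2 \<theta>)) \<le> ennreal C * geodesic_dist G c1 c2"
proof -
  obtain K where K: "0 < K" "\<And>c. geodesic_dist G c0 c < ennreal N \<Longrightarrow> curve_bound n K c"
    by (rule curve_bound_metric_ball[OF n A c0 N G], rule that; assumption)
  obtain B where B: "0 \<le> B"
    "\<And>c. c \<in> Imm \<Longrightarrow> curve_bound n K c \<Longrightarrow> integral {0..2 * pi} (\<lambda>\<theta>. (F c \<theta>)\<^sup>2) \<le> B\<^sup>2"
    by (rule affine_jet_L2_bound[OF n K(1) F], rule that; assumption)
  obtain C where C: "0 < C" "\<And>c1 c2. curve_bound n K c1 \<Longrightarrow> geodesic_dist G c1 c2 < 1 \<Longrightarrow>
    ennreal (L2_norm (\<lambda>\<theta>. F c1 \<theta> - F c2 \<theta>)) \<le> ennreal C * geodesic_dist G c1 c2"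
    using affine_jet_local_lipschitz[OF n A K(1) F G] by blast
  show ?thesis
  proof (intro exI[of _ "C + 2 * B"] conjI ballI impI)
    fix c1 c2 assume I: "c1 \<in> Imm" "c2 \<in> Imm"
      and d: "geodesic_dist G c0 c1 < ennreal N" "geodesic_dist G c0 c2 < ennreal N"
    let ?N = "L2_norm (\<lambda>\<theta>. F c1 \<theta> - F c2 \<theta>)"
    note cont = affine_jet_continuous[OF F]
    show "ennreal ?N \<le> ennreal (C + 2 * B) * geodesic_dist G c1 c2"
    proof (cases "geodesic_dist G c1 c2 < 1")
      case True
      have "ennreal ?N \<le> ennreal C * geodesic_dist G c1 c2" by (rule C(2)[OF K(2)[OF d(1)] True])
      also have "\<dots> \<le> ennreal (C + 2 * B) * geodesic_dist G c1 c2"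
        using B(1) by (intro mult_right_mono ennreal_leI) auto
      finally show ?thesis .
    next
      case False
      have "integral {0..2 * pi} (\<lambda>\<theta>. (F c1 \<theta> - F c2 \<theta>)\<^sup>2) \<le>
          integral {0..2 * pi} (\<lambda>\<theta>. 2 * (F c1 \<theta>)\<^sup>2 + 2 * (F c2 \<theta>)\<^sup>2)"
      proof (intro integral_le integrable_continuous_real continuous_intros cont I)
        fix \<theta>
        show "(F c1 \<theta> - F c2 \<theta>)\<^sup>2 \<le> 2 * (F c1 \<theta>)\<^sup>2 + 2 * (F c2 \<theta>)\<^sup>2"
          using zero_le_power2[of "F c1 \<theta> + F c2 \<theta>"] by (simp add: power2_eq_square algebra_simps)
      qed
      also have "\<dots> = 2 * integral {0..2 * pi} (\<lambda>\<theta>. (F c1 \<theta>)\<^sup>2) + 2 * integral {0..2 * pi} (\<lambda>\<theta>. (F c2 \<theta>)\<^sup>2)"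
        by (subst integral_add) (auto intro!: integrable_continuous_real continuous_intros cont I)
      also have "\<dots> \<le> (2 * B)\<^sup>2" using B(2)[OF I(1) K(2)[OF d(1)]] B(2)[OF I(2) K(2)[OF d(2)]] by (simp add: power_mult_distrib)
      finally have "?N \<le> 2 * B"
        using B(1) by (subst L2_norm_continuous) (auto intro!: real_le_lsqrt continuous_intros cont I)
      then have "ennreal ?N \<le> ennreal (C + 2 * B) * 1" using C(1) by (simp add: ennreal_leI)
      also have "\<dots> \<le> ennreal (C + 2 * B) * geodesic_dist G c1 c2"
        using False by (intro mult_left_mono) auto
      finally show ?thesis .
    qed
  qed (use B(1) C(1) in simp)
qed

text \<open>Continuity at \<open>c\<close> follows from the local estimate with the bound of
  \<open>c\<close> itself; the minimum with \<open>1\<close> in the choice of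
  \<open>\<delta>\<close> puts the pair in the range of that estimate.\<close>

lemma affine_jet_maps_continuously:
  assumes n: "2 \<le> n" and A: "0 < A" and G: "controls_sobolev n A G"
    and F: "affine_jet (n - 1) F" "\<And>c. c \<in> Imm \<Longrightarrow> H c = F c"
  shows "maps_to_L2_continuously G H"
  unfolding maps_to_L2_continuously_def
proof (intro conjI ballI allI impI)
  show "H c \<in> L2_circle" if "c \<in> Imm" for c using affine_jet_L2_circle[OF F(1) that] F(2)[OF that] by simp
next
  fix c and \<epsilon> :: real assume c: "c \<in> Imm" and \<epsilon>: "0 < \<epsilon>"
  obtain K where K: "0 < K" "curve_bound n K c" using curve_bound_exists[OF c] by blast
  obtain C where C: "0 < C" "\<And>c1 c2. curve_bound n K c1 \<Longrightarrow> geodesic_dist G c1 c2 < 1 \<Longrightarrow>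
    ennreal (L2_norm (\<lambda>\<theta>. F c1 \<theta> - F c2 \<theta>)) \<le> ennreal C * geodesic_dist G c1 c2"
    using affine_jet_local_lipschitz[OF n A K(1) F(1) G] by blast
  show "\<exists>\<delta>>0. \<forall>c'\<in>Imm. geodesic_dist G c c' < ennreal \<delta> \<longrightarrow> L2_dist (H c) (H c') < \<epsilon>"
  proof (intro exI[of _ "min 1 (\<epsilon> / C)"] conjI ballI impI)
    fix c' assume c': "c' \<in> Imm" and d: "geodesic_dist G c c' < ennreal (min 1 (\<epsilon> / C))"
    have d1: "geodesic_dist G c c' < 1" "geodesic_dist G c c' < ennreal (\<epsilon> / C)"
      using less_le_trans[OF d ennreal_leI, of 1] less_le_trans[OF d ennreal_leI, of "\<epsilon> / C"] by auto
    have "ennreal (L2_norm (\<lambda>\<theta>. F c \<theta> - F c' \<theta>)) \<le> ennreal C * geodesic_dist G c c'"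
      by (rule C(2)[OF K(2) d1(1)])
    also have "\<dots> < ennreal C * ennreal (\<epsilon> / C)"
      using d1(2) C(1) by (intro ennreal_mult_strict_left_mono) auto
    also have "\<dots> = ennreal \<epsilon>" using C(1) by (simp flip: ennreal_mult')
    finally have "L2_norm (\<lambda>\<theta>. F c \<theta> - F c' \<theta>) < \<epsilon>" using \<epsilon> by (simp add: ennreal_less_iff L2_norm_def)
    then show "L2_dist (H c) (H c') < \<epsilon>" by (simp add: L2_dist_def F(2) c c')
  qed (use C \<epsilon> in auto)
qed

theorem theorem4p7:
  fixes G :: "(real \<Rightarrow> real^2) \<Rightarrow> (real \<Rightarrow> real^2) \<Rightarrow> (real \<Rightarrow> real^2) \<Rightarrow> real"
    and n :: nat and A :: real
  assumes "riemannian_metric G"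
    and "n \<ge> 2"
    and "A > 0"
    and "\<And>c h. c \<in> Imm \<Longrightarrow> h \<in> smooth_circle \<Longrightarrow>
           arc_integral c (\<lambda>\<theta>. (norm (h \<theta>))\<^sup>2 + (norm ((arc_deriv c ^^ n) h \<theta>))\<^sup>2) \<le> A * G c h h"
  shows
    "(\<forall>c0\<in>Imm. \<forall>N>0. \<exists>C\<ge>0. \<forall>c1\<in>Imm. \<forall>c2\<in>Imm.
        geodesic_dist G c0 c1 < ennreal N \<longrightarrow> geodesic_dist G c0 c2 < ennreal N \<longrightarrow>
        (\<forall>k\<le>n - 2.
           ennreal (L2_norm (\<lambda>\<theta>. (arc_deriv c1 ^^ k) (curvature c1) \<theta> * sqrt (speed c1 \<theta>)
                               - (arc_deriv c2 ^^ k) (curvature c2) \<theta> * sqrt (speed c2 \<theta>)))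
             \<le> ennreal C * geodesic_dist G c1 c2 \<and>
           ennreal (L2_norm (\<lambda>\<theta>. (arc_deriv c1 ^^ (k + 1)) (\<lambda>\<phi>. ln (speed c1 \<phi>)) \<theta> * sqrt (speed c1 \<theta>)
                               - (arc_deriv c2 ^^ (k + 1)) (\<lambda>\<phi>. ln (speed c2 \<phi>)) \<theta> * sqrt (speed c2 \<theta>)))
             \<le> ennreal C * geodesic_dist G c1 c2)) \<and>
     (\<forall>k\<le>n - 2.
        maps_to_L2_continuously G (curvature_map k) \<and>
        maps_to_L2_continuously G (log_speed_map k) \<and>
        (\<forall>c0\<in>Imm. \<forall>N>0.
           L2_lipschitz_on_set G (metric_ball G c0 N) (curvature_map k) \<and>
           L2_lipschitz_on_set G (metric_ball G c0 N) (log_speed_map k)))"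
proof -
  have G: "controls_sobolev n A G" using assms(4) by (simp add: controls_sobolev_def)
  \<comment> \<open>For \<open>k \<le> n - 2\<close> the top order is at most \<open>n\<close>, and
    functions affine in order \<open>n\<close> are \<open>affine_jet (n - 1)\<close>.\<close>
  have top: "Suc (n - 2) = n - 1" using assms(2) by simp
  let ?lip = "\<lambda>C c0 N H. \<forall>c1\<in>Imm. \<forall>c2\<in>Imm.
      geodesic_dist G c0 c1 < ennreal N \<longrightarrow> geodesic_dist G c0 c2 < ennreal N \<longrightarrow>
      ennreal (L2_norm (\<lambda>\<theta>. H c1 \<theta> - H c2 \<theta>)) \<le> ennreal C * geodesic_dist G c1 c2"
  have jet: "\<exists>F. affine_jet (n - 1) F \<and> (\<forall>c\<in>Imm. H c = F c)"
    if "k \<le> n - 2" "H = curvature_map k \<or> H = log_speed_map k" for k H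
    using that curvature_map_jet[OF that(1)] log_speed_map_jet[OF that(1)] unfolding top by auto
  have cont: "maps_to_L2_continuously G H" if k: "k \<le> n - 2" "H = curvature_map k \<or> H = log_speed_map k" for k H
  proof -
    obtain F where F: "affine_jet (n - 1) F" "\<And>c. c \<in> Imm \<Longrightarrow> H c = F c" using jet[OF k] by blast
    show ?thesis by (rule affine_jet_maps_continuously[OF assms(2,3) G F])
  qed
  have lip: "\<exists>C\<ge>0. ?lip C c0 N H"
    if k: "k \<le> n - 2" "H = curvature_map k \<or> H = log_speed_map k" and c0: "c0 \<in> Imm" and N: "0 < N" for k H c0 N
  proof -
    obtain F where F: "affine_jet (n - 1) F" "\<And>c. c \<in> Imm \<Longrightarrow> H c = F c" using jet[OF k] by blast
    then show ?thesis using affine_jet_lipschitz_on_ball[OF assms(2,3) c0 N G F(1)] by auto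
  qed
  have uniform: "\<exists>C\<ge>0. \<forall>k\<le>n - 2. ?lip C c0 N (curvature_map k) \<and> ?lip C c0 N (log_speed_map k)"
    if c0: "c0 \<in> Imm" and N: "0 < N" for c0 N
  proof -
    have "\<forall>k\<in>{..n - 2}. \<exists>C. 0 \<le> C \<and> ?lip C c0 N (curvature_map k)" using lip[OF _ _ c0 N] by blast
    from bchoice[OF this] obtain C where C: "\<forall>k\<in>{..n - 2}. 0 \<le> C k \<and> ?lip (C k) c0 N (curvature_map k)" ..
    have "\<forall>k\<in>{..n - 2}. \<exists>C. 0 \<le> C \<and> ?lip C c0 N (log_speed_map k)" using lip[OF _ _ c0 N] by blast
    from bchoice[OF this] obtain D where D: "\<forall>k\<in>{..n - 2}. 0 \<le> D k \<and> ?lip (D k) c0 N (log_speed_map k)" ..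
    \<comment> \<open>The constant has to serve all \<open>k\<close> and both families at once; as
      there are finitely many nonnegative constants, their sum dominates each.\<close>
    let ?S = "\<Sum>k\<le>n - 2. C k + D k"
    have S: "C k \<le> ?S" "D k \<le> ?S" "0 \<le> ?S" if "k \<le> n - 2" for k
    proof -
      have "C k + D k \<le> ?S" using C D that by (intro member_le_sum) auto
      moreover have "0 \<le> C k" "0 \<le> D k" using C D that by auto
      ultimately show "C k \<le> ?S" "D k \<le> ?S" "0 \<le> ?S" by linarith+
    qed
    have mono: "?lip B' c0 N H" if "?lip B c0 N H" "B \<le> B'" for B B' H
      using that(1) mult_right_mono[OF ennreal_leI[OF that(2)]] by (meson order_trans zero_le)
    show ?thesis
    proof (intro exI[of _ ?S] conjI allI impI)
      show "0 \<le> ?S" using S(3)[of 0] by simp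
      fix k assume k: "k \<le> n - 2"
      show "?lip ?S c0 N (curvature_map k)" by (rule mono[OF _ S(1)[OF k]]) (use C k in blast)
      show "?lip ?S c0 N (log_speed_map k)" by (rule mono[OF _ S(2)[OF k]]) (use D k in blast)
    qed
  qed
  have ball: "L2_lipschitz_on_set G (metric_ball G c0 N) H"
    if "k \<le> n - 2" "H = curvature_map k \<or> H = log_speed_map k" "c0 \<in> Imm" "0 < N" for k H c0 N
    using lip[OF that] unfolding L2_lipschitz_on_set_def metric_ball_def L2_dist_def by blast
  show ?thesis
  proof (intro conjI allI ballI impI)
    fix c0 and N :: real assume "c0 \<in> Imm" "0 < N"
    from uniform[OF this] show "\<exists>C\<ge>0. \<forall>c1\<in>Imm. \<forall>c2\<in>Imm.
        geodesic_dist G c0 c1 < ennreal N \<longrightarrow> geodesic_dist G c0 c2 < ennreal N \<longrightarrow>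
        (\<forall>k\<le>n - 2.
           ennreal (L2_norm (\<lambda>\<theta>. (arc_deriv c1 ^^ k) (curvature c1) \<theta> * sqrt (speed c1 \<theta>)
                               - (arc_deriv c2 ^^ k) (curvature c2) \<theta> * sqrt (speed c2 \<theta>)))
             \<le> ennreal C * geodesic_dist G c1 c2 \<and>
           ennreal (L2_norm (\<lambda>\<theta>. (arc_deriv c1 ^^ (k + 1)) (\<lambda>\<phi>. ln (speed c1 \<phi>)) \<theta> * sqrt (speed c1 \<theta>)
                               - (arc_deriv c2 ^^ (k + 1)) (\<lambda>\<phi>. ln (speed c2 \<phi>)) \<theta> * sqrt (speed c2 \<theta>)))
             \<le> ennreal C * geodesic_dist G c1 c2)"
      unfolding curvature_map_def log_speed_map_def by blast
  qed (use cont ball in blast)+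
qed

end
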